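(* Let $k$ be a field and let $c,d,q$ be integers with $c\ge1$ and $2\le q\le d$. Suppose that $A=k[\Delta]$ is a $d$-dimensional Buchsbaum Stanley--Reisner ring with $q$-linear resolution, with $\operatorname{codim}A=c$, and put $h=\dim_k H^{q-1}_{\mathfrak m}(A)$. Then the $h$-vector $(h_0,h_1,\dots,h_d)$ of $\Delta$ is given by $h_0=1$ and $$h_p=\binom{c+p-1}{p}\quad(1\le p\le q-1),\qquad h_p=(-1)^{p-q+1}\binom{d}{p}h\quad(q\le p\le d).$$ Moreover, $h$ satisfies $$0\le h\le \frac{(c+q-2)\cdots(c+1)c}{d(d-1)\cdots(d-q+2)}.$$
   Context: A simplicial complex $\Delta$ on $V=\{x_1,\dots,x_n\}$ is a collection of subsets of $V$ closed under taking subsets and containing every singleton $\{x_i\}$. $S=k[x_1,\dots,x_n]$ (standard grading), $I_\Delta$ is generated by the square-free monomials $x_{i_1}\cdots x_{i_r}$ with $\{x_{i_1},\dots,x_{i_r}\}\notin\Delta$, $k[\Delta]=S/I_\Delta$ is the Stanley--Reisner ring and $\mathfrak m$ its homogeneous maximal ideal. If $d=\dim k[\Delta]=\dim\Delta+1$, then $\operatorname{codim}k[\Delta]=n-d$. $k[\Delta]$ is Buchsbaum if $\Delta$ is pure and $\widetilde H_i(\operatorname{link}_\Delta F;k)=0$ for every nonempty face $F$ and every $i<\dim\operatorname{link}_\Delta F$; then $H^i_{\mathfrak m}(k[\Delta])\cong\widetilde H_{i-1}(\Delta;k)$ for $i<d$. With $f_{i}$ the number of $i$-dimensional faces ($f_{-1}=1$),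 the $h$-vector is defined by $\sum_{i=0}^d \frac{f_{i-1}t^i}{(1-t)^i}=\frac{h_0+h_1t+\cdots+h_dt^d}{(1-t)^d}$. For $A=S/I$, $\beta_{i,j}(A)=\dim_k\operatorname{Tor}_i^S(A,k)_j$, $\operatorname{reg}A=\max\{j-i:\beta_{i,j}(A)\ne0\}$ and $\operatorname{indeg}A=\min\{j: I_j\neq0\}$. $A$ has $q$-linear resolution if $\operatorname{reg}A=\operatorname{indeg}A-1=q-1$. *)

theory Defs
  imports
    "HOL-Library.Poly_Mapping"
    "HOL-Library.Function_Algebras"
    "HOL-Library.Extended_Nat"
    "HOL-Library.Cardinality"
    "HOL-Computational_Algebra.Formal_Power_Series"
begin

section \<open>Simplicial complexes\<close>

text \<open>The vertex set \<open>{x\<^sub>1, \<dots>, x\<^sub>n}\<close> is a finite type \<open>'v\<close>, so \<open>n = CARD('v)\<close>. Its linear order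
  (the order of the indices) only enters through signs.\<close>

definition simplicial_complex :: "'v set set \<Rightarrow> bool" where
  "simplicial_complex \<Delta> \<longleftrightarrow> (\<forall>F\<in>\<Delta>. \<forall>G\<subseteq>F. G \<in> \<Delta>) \<and> (\<forall>v. {v} \<in> \<Delta>)"

definition face_dim :: "'v set \<Rightarrow> int" where
  "face_dim F = int (card F) - 1"

definition complex_dim :: "'v set set \<Rightarrow> int" where
  "complex_dim \<Delta> = Max (face_dim ` \<Delta>)"

definition facet :: "'v set set \<Rightarrow> 'v set \<Rightarrow> bool" where
  "facet \<Delta> F \<longleftrightarrow> F \<in> \<Delta> \<and> (\<forall>G\<in>\<Delta>. F \<subseteq> G \<longrightarrow> G = F)"

definition pure_complex :: "'v set set \<Rightarrow> bool" where
  "pure_complex \<Delta> \<longleftrightarrow> (\<forall>F. facet \<Delta> F \<longrightarrow> face_dim F = complex_dim \<Delta>)"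

definition link :: "'v set set \<Rightarrow> 'v set \<Rightarrow> 'v set set" where
  "link \<Delta> F = {G. F \<inter> G = {} \<and> F \<union> G \<in> \<Delta>}"

definition f_number :: "'v set set \<Rightarrow> int \<Rightarrow> nat" where
  "f_number \<Delta> i = card {F \<in> \<Delta>. face_dim F = i}"

text \<open>The \<open>h\<close>-vector, extended by \<open>0\<close> beyond \<open>d = dim \<Delta> + 1\<close>; the defining identity is read in the
  ring of formal power series.\<close>

definition h_vector :: "'v set set \<Rightarrow> nat \<Rightarrow> int" where
  "h_vector \<Delta> = (let d = nat (complex_dim \<Delta> + 1) in
     THE h. (\<forall>p>d. h p = 0) \<and>
       (\<Sum>i\<le>d. of_nat (f_number \<Delta> (int i - 1)) * fps_X ^ i / (1 - fps_X) ^ i)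
         = (\<Sum>i\<le>d. of_int (h i) * fps_X ^ i) / (1 - fps_X :: rat fps) ^ d)"


section \<open>Reduced simplicial homology and Buchsbaum complexes\<close>

definition incidence_sign :: "'v::linorder \<Rightarrow> 'v set \<Rightarrow> 'a::comm_ring_1" where
  "incidence_sign v F = (-1) ^ card {w \<in> F. w < v}"

text \<open>An \<open>i\<close>-chain is given by its coefficients on the \<open>i\<close>-dimensional faces; the empty face has
  dimension \<open>-1\<close>, so the complex is the augmented one. The boundary of
  \<open>{v\<^sub>0 < \<dots> < v\<^sub>i}\<close> is \<open>\<Sum>j. (-1)\<^sup>j {v\<^sub>0, \<dots>, v\<^sub>i} - {v\<^sub>j}\<close>.\<close>

definition chains :: "'v set set \<Rightarrow> int \<Rightarrow> ('v set \<Rightarrow> 'k::field) set" where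
  "chains \<Delta> i = {c. \<forall>F. c F \<noteq> 0 \<longrightarrow> F \<in> \<Delta> \<and> face_dim F = i}"

definition boundary :: "('v::{finite,linorder} set \<Rightarrow> 'k::field) \<Rightarrow> 'v set \<Rightarrow> 'k" where
  "boundary c G = (\<Sum>v\<in>- G. incidence_sign v (insert v G) * c (insert v G))"

definition reduced_homology_vanishes ::
    "'k::field itself \<Rightarrow> 'v::{finite,linorder} set set \<Rightarrow> int \<Rightarrow> bool" where
  "reduced_homology_vanishes _ \<Delta> i \<longleftrightarrow>
     {z \<in> chains \<Delta> i. boundary z = (\<lambda>_. 0 :: 'k)} = boundary ` chains \<Delta> (i + 1)"

definition buchsbaum :: "'k::field itself \<Rightarrow> 'v::{finite,linorder} set set \<Rightarrow> bool" where
  "buchsbaum K \<Delta> \<longleftrightarrow> pure_complex \<Delta> \<and>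
     (\<forall>F\<in>\<Delta>. F \<noteq> {} \<longrightarrow>
        (\<forall>i < complex_dim (link \<Delta> F). reduced_homology_vanishes K (link \<Delta> F) i))"


section \<open>Stanley--Reisner rings\<close>

type_synonym ('v, 'k) mpoly = "('v \<Rightarrow>\<^sub>0 nat) \<Rightarrow>\<^sub>0 'k"
type_synonym ('v, 'k) laurent = "('v \<Rightarrow>\<^sub>0 int) \<Rightarrow>\<^sub>0 'k"

definition mdegree :: "('v::finite \<Rightarrow>\<^sub>0 nat) \<Rightarrow> nat" where
  "mdegree t = (\<Sum>v\<in>UNIV. Poly_Mapping.lookup t v)"

definition homogeneous :: "nat \<Rightarrow> ('v::finite, 'k::field) mpoly \<Rightarrow> bool" where
  "homogeneous j f \<longleftrightarrow> (\<forall>t\<in>Poly_Mapping.keys f. mdegree t = j)"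

definition squarefree_monomial :: "'v::finite set \<Rightarrow> ('v, 'k::field) mpoly" where
  "squarefree_monomial F = Poly_Mapping.single (\<Sum>v\<in>F. Poly_Mapping.single v 1) 1"

definition stanley_reisner_ideal :: "'v::finite set set \<Rightarrow> ('v, 'k::field) mpoly set" where
  "stanley_reisner_ideal \<Delta> = module.span (*) {squarefree_monomial F | F. F \<notin> \<Delta>}"

text \<open>Below, a quotient ring \<open>A = S/I\<close> is represented by its ideal \<open>I\<close>.\<close>

definition prime_ideal :: "'a::comm_ring_1 set \<Rightarrow> bool" where
  "prime_ideal P \<longleftrightarrow> module.subspace (*) P \<and> P \<noteq> UNIV \<and> (\<forall>x y. x * y \<in> P \<longrightarrow> x \<in> P \<or> y \<in> P)"

text \<open>Krull dimension of \<open>S/I\<close>: primes of \<open>S/I\<close> are the primes of \<open>S\<close> containing \<open>I\<close>.\<close>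

definition krull_dim_quotient :: "'a::comm_ring_1 set \<Rightarrow> enat" where
  "krull_dim_quotient I =
     Sup {enat m | m. \<exists>P. (\<forall>i\<le>m. prime_ideal (P i) \<and> I \<subseteq> P i) \<and> (\<forall>i<m. P i \<subset> P (Suc i))}"

definition codim_quotient :: "('v::finite, 'k::field) mpoly set \<Rightarrow> enat" where
  "codim_quotient I = enat CARD('v) - krull_dim_quotient I"


section \<open>Dimension of a quotient vector space\<close>

text \<open>\<open>dim\<^sub>k (Z/B)\<close> for subspaces \<open>B \<subseteq> Z\<close>: the largest number of elements of \<open>Z\<close> that are linearly
  independent modulo \<open>B\<close>, and \<open>\<infinity>\<close> if there is no largest one.\<close>

definition quotient_dim ::
    "('k::field \<Rightarrow> 'a \<Rightarrow> 'a) \<Rightarrow> 'a set \<Rightarrow> 'a::ab_group_add set \<Rightarrow> enat" where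
  "quotient_dim scale Z B =
     Sup {enat (card X) | X. finite X \<and> X \<subseteq> Z \<and>
       (\<forall>u. (\<Sum>x\<in>X. scale (u x) x) \<in> B \<longrightarrow> (\<forall>x\<in>X. u x = 0))}"


section \<open>Graded Betti numbers and regularity\<close>

text \<open>A complex \<open>\<dots> \<longrightarrow> F\<^sub>1 \<longrightarrow> F\<^sub>0 \<longrightarrow> S/I\<close> with \<open>F\<^sub>i = \<Oplus>\<^bsub>b < rank i\<^esub> S(-shift i b)\<close>. The entry
  \<open>diff i a b\<close> is the \<open>a\<close>-th coordinate of the image in \<open>F\<^sub>i\<close> of the \<open>b\<close>-th basis vector of \<open>F\<^sub>i\<^sub>+\<^sub>1\<close>,
  and \<open>aug b\<close> is a lift to \<open>S\<close> of the image in \<open>S/I\<close> of the \<open>b\<close>-th basis vector of \<open>F\<^sub>0\<close>.\<close>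

record 's free_complex =
  rank :: "nat \<Rightarrow> nat"
  shift :: "nat \<Rightarrow> nat \<Rightarrow> nat"
  diff :: "nat \<Rightarrow> nat \<Rightarrow> nat \<Rightarrow> 's"
  aug :: "nat \<Rightarrow> 's"

definition free_module :: "('v, 'k::field) mpoly free_complex \<Rightarrow> nat \<Rightarrow> (nat \<Rightarrow> ('v, 'k) mpoly) set" where
  "free_module R i = {u. \<forall>b\<ge>rank R i. u b = 0}"

definition diff_map ::
    "('v, 'k::field) mpoly free_complex \<Rightarrow> nat \<Rightarrow> (nat \<Rightarrow> ('v, 'k) mpoly) \<Rightarrow> nat \<Rightarrow> ('v, 'k) mpoly" where
  "diff_map R i u = (\<lambda>a. if a < rank R i then \<Sum>b<rank R (Suc i). diff R i a b * u b else 0)"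

definition aug_map ::
    "('v, 'k::field) mpoly free_complex \<Rightarrow> (nat \<Rightarrow> ('v, 'k) mpoly) \<Rightarrow> ('v, 'k) mpoly" where
  "aug_map R u = (\<Sum>b<rank R 0. aug R b * u b)"

definition graded_free_resolution ::
    "('v::finite, 'k::field) mpoly set \<Rightarrow> ('v, 'k) mpoly free_complex \<Rightarrow> bool" where
  "graded_free_resolution I R \<longleftrightarrow>
     (\<forall>i. \<forall>a<rank R i. \<forall>b<rank R (Suc i). \<forall>t\<in>Poly_Mapping.keys (diff R i a b).
        shift R i a + mdegree t = shift R (Suc i) b) \<and>
     (\<forall>b<rank R 0. homogeneous (shift R 0 b) (aug R b)) \<and>
     (\<forall>f. \<exists>u\<in>free_module R 0. f - aug_map R u \<in> I) \<and>
     {u \<in> free_module R 0. aug_map R u \<in> I} = diff_map R 0 ` free_module R 1 \<and>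
     (\<forall>i. {u \<in> free_module R (Suc i). diff_map R i u = (\<lambda>_. 0)}
            = diff_map R (Suc i) ` free_module R (Suc (Suc i)))"

text \<open>The degree \<open>j\<close> part of \<open>F\<^sub>i \<otimes>\<^sub>S k\<close>, where \<open>k = S/\<mm>\<close>, has as basis the basis vectors of \<open>F\<^sub>i\<close> of
  degree \<open>j\<close>; the induced differential is given by the constant terms of the matrix entries.\<close>

definition tensor_module ::
    "('v, 'k::field) mpoly free_complex \<Rightarrow> nat \<Rightarrow> nat \<Rightarrow> (nat \<Rightarrow> 'k) set" where
  "tensor_module R i j = {u. \<forall>b. u b \<noteq> 0 \<longrightarrow> b < rank R i \<and> shift R i b = j}"

definition tensor_diff ::
    "('v, 'k::field) mpoly free_complex \<Rightarrow> nat \<Rightarrow> (nat \<Rightarrow> 'k) \<Rightarrow> nat \<Rightarrow> 'k" where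
  "tensor_diff R i u =
     (\<lambda>a. if a < rank R i
          then \<Sum>b<rank R (Suc i). Poly_Mapping.lookup (diff R i a b) 0 * u b else 0)"

definition tensor_cycles :: "('v, 'k::field) mpoly free_complex \<Rightarrow> nat \<Rightarrow> nat \<Rightarrow> (nat \<Rightarrow> 'k) set" where
  "tensor_cycles R i j =
     (case i of 0 \<Rightarrow> tensor_module R 0 j
      | Suc i' \<Rightarrow> {u \<in> tensor_module R i j. tensor_diff R i' u = (\<lambda>_. 0)})"

definition tensor_boundaries ::
    "('v, 'k::field) mpoly free_complex \<Rightarrow> nat \<Rightarrow> nat \<Rightarrow> (nat \<Rightarrow> 'k) set" where
  "tensor_boundaries R i j = tensor_diff R i ` tensor_module R (Suc i) j"

text \<open>\<open>\<beta>\<^sub>i\<^sub>,\<^sub>j(S/I) = dim\<^sub>k Tor\<^sub>i\<^sup>S(S/I, k)\<^sub>j\<close>, computed from some graded free resolution of \<open>S/I\<close> by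
  free modules of finite rank. As \<open>S/I\<close> lives in nonnegative degrees, \<open>j :: nat\<close> suffices.\<close>

definition betti :: "('v::finite, 'k::field) mpoly set \<Rightarrow> nat \<Rightarrow> nat \<Rightarrow> enat" where
  "betti I i j = (let R = (SOME R. graded_free_resolution I R) in
     quotient_dim (\<lambda>a u b. a * u b) (tensor_cycles R i j) (tensor_boundaries R i j))"

definition regularity :: "('v::finite, 'k::field) mpoly set \<Rightarrow> int" where
  "regularity I = Max {int j - int i | i j. betti I i j \<noteq> 0}"

definition indeg :: "('v::finite, 'k::field) mpoly set \<Rightarrow> nat" where
  "indeg I = (LEAST j. \<exists>f\<in>I. f \<noteq> 0 \<and> homogeneous j f)"

definition has_linear_resolution :: "nat \<Rightarrow> ('v::finite, 'k::field) mpoly set \<Rightarrow> bool" where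
  "has_linear_resolution q I \<longleftrightarrow>
     regularity I = int (indeg I) - 1 \<and> int (indeg I) - 1 = int q - 1"


section \<open>Local cohomology\<close>

text \<open>\<open>H\<^sup>i\<^sub>\<mm>(S/I)\<close> is the cohomology of the Cech complex \<open>\<Oplus>\<^bsub>|\<sigma>| = i\<^esub> (S/I)\<^bsub>x\<^sub>\<sigma>\<^esub>\<close> with respect to the
  variables, where \<open>x\<^sub>\<sigma>\<close> is the product of the \<open>x\<^sub>v\<close>, \<open>v \<in> \<sigma>\<close>. All localizations \<open>S\<^bsub>x\<^sub>\<sigma>\<^esub>\<close> are
  subrings of the Laurent polynomial ring, \<open>localize \<sigma> M\<close> is the localization of an ideal \<open>M\<close> inside
  it, and \<open>(S/I)\<^bsub>x\<^sub>\<sigma>\<^esub> = S\<^bsub>x\<^sub>\<sigma>\<^esub>/I\<^bsub>x\<^sub>\<sigma>\<^esub>\<close>.\<close>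

definition to_laurent :: "('v, 'k::field) mpoly \<Rightarrow> ('v, 'k) laurent" where
  "to_laurent f = (\<Sum>t\<in>Poly_Mapping.keys f.
     Poly_Mapping.single (Poly_Mapping.map int t) (Poly_Mapping.lookup f t))"

definition laurent_power :: "'v::finite set \<Rightarrow> nat \<Rightarrow> ('v, 'k::field) laurent" where
  "laurent_power \<sigma> N = Poly_Mapping.single (\<Sum>v\<in>\<sigma>. Poly_Mapping.single v (int N)) 1"

definition localize ::
    "'v::finite set \<Rightarrow> ('v, 'k::field) mpoly set \<Rightarrow> ('v, 'k) laurent set" where
  "localize \<sigma> M = {f. \<exists>N. \<exists>g\<in>M. laurent_power \<sigma> N * f = to_laurent g}"

definition cech_cochains ::
    "('v::finite, 'k::field) mpoly set \<Rightarrow> int \<Rightarrow> ('v set \<Rightarrow> ('v, 'k) laurent) set" where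
  "cech_cochains M i = {c. \<forall>\<sigma>. if int (card \<sigma>) = i then c \<sigma> \<in> localize \<sigma> M else c \<sigma> = 0}"

definition cech_diff ::
    "('v::{finite,linorder} set \<Rightarrow> ('v, 'k::field) laurent) \<Rightarrow> 'v set \<Rightarrow> ('v, 'k) laurent" where
  "cech_diff c \<tau> = (\<Sum>v\<in>\<tau>. incidence_sign v \<tau> * c (\<tau> - {v}))"

text \<open>Cocycles and coboundaries modulo \<open>I\<close>, represented by their lifts to the Cech complex of \<open>S\<close>.\<close>

definition cech_cocycles ::
    "('v::{finite,linorder}, 'k::field) mpoly set \<Rightarrow> int \<Rightarrow> ('v set \<Rightarrow> ('v, 'k) laurent) set" where
  "cech_cocycles I i = {c \<in> cech_cochains UNIV i. cech_diff c \<in> cech_cochains I (i + 1)}"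

definition cech_coboundaries ::
    "('v::{finite,linorder}, 'k::field) mpoly set \<Rightarrow> int \<Rightarrow> ('v set \<Rightarrow> ('v, 'k) laurent) set" where
  "cech_coboundaries I i =
     {c \<in> cech_cochains UNIV i. \<exists>b\<in>cech_cochains UNIV (i - 1). c - cech_diff b \<in> cech_cochains I i}"

definition local_cohomology_dim ::
    "('v::{finite,linorder}, 'k::field) mpoly set \<Rightarrow> int \<Rightarrow> enat" where
  "local_cohomology_dim I i =
     quotient_dim (\<lambda>a c \<sigma>. Poly_Mapping.single 0 a * c \<sigma>) (cech_cocycles I i) (cech_coboundaries I i)"

end

(*
  All homological input is turned into vanishing of cohomology of families of faces. A graded free
  resolution of k[Delta], indexed by pairs (F, G) of disjoint sets with F in Delta, tensored with k
  splits into the cochain complexes of the induced subcomplexes of Delta; comparing it with an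
  arbitrary resolution, the q-linear resolution says that the (q-2)-skeleton of Delta is complete
  and that the reduced cohomology of induced subcomplexes vanishes above degree q-2. Long exact
  sequences carry this over to the links of vertices v, and the Buchsbaum property to vanishing for
  links with some vertices deleted. Writing H_v for the h-polynomial of the link of v, the Euler
  characteristics of its restrictions show that H_v has degree at most q-1 and a nonnegative
  coefficient in degree q-1. The identity (1-t) H' + d H = sum_v H_v then determines h_p from h_d
  for p >= q and gives the upper bound, while h_d is, up to sign, the reduced Euler characteristic
  of Delta, i.e. the dimension of its cohomology in degree q-2. The latter is the local cohomology
  module in degree q-1, by the multigrading of the Cech complex.
*)

theory Submission
  imports Defs "HOL-Library.Product_Lexorder"
begin

section \<open>Relative cochain complexes of order-convex families and their long exact
  sequences\<close>

section \<open>Cochains of convex families of sets\<close>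

text \<open>The degree bound for H_v comes from two overlapping vanishing ranges. Restrict the star
  of v to a vertex set W: linearity kills its cohomology above degree q, the Buchsbaum property
  kills it up to degree |W| - c - 1. For |W| > c + q the ranges cover everything and the Euler
  characteristic is 0; for |W| = c + q only degree q survives, which fixes the sign. Sums of these
  numbers are the coefficients of H_v (1-t)^c, and its leading coefficient is that of H_v up to
  sign. Stars {F. v \<in> F} replace links: stars, deletions, restrictions, the strands of the Cech
  complex and those of the resolution are all order-convex families of finite sets, so one
  coboundary operator serves them all. On the algebraic side the obstacle is that Betti numbers are
  read off from an unspecified resolution. Only vanishing has to be carried over, so exactness in a
  single bidegree is transferred along a homotopy equivalence, without minimal resolutions and
  without invariance of dimensions.\<close>

definition cochains :: "'a set set \<Rightarrow> int \<Rightarrow> ('a set \<Rightarrow> 'k::field) set" where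
  "cochains X i = {c. \<forall>F. c F \<noteq> 0 \<longrightarrow> F \<in> X \<and> int (card F) = i}"

text \<open>The value outside X is cut to 0; on cochains of X this is the relative simplicial
  coboundary of a pair of complexes.\<close>

definition coboundary ::
    "'a set set \<Rightarrow> ('a::{finite,linorder} set \<Rightarrow> 'k::field) \<Rightarrow> 'a set \<Rightarrow> 'k" where
  "coboundary X c T = (if T \<in> X then \<Sum>v\<in>T. incidence_sign v T * c (T - {v}) else 0)"

text \<open>Degree is cardinality, so degree i is reduced simplicial cohomology in dimension i - 1.
  Speaking of vanishing alone avoids forming cohomology groups.\<close>

definition acyclic_at :: "'k::field itself \<Rightarrow> 'a::{finite,linorder} set set \<Rightarrow> int \<Rightarrow> bool" where
  "acyclic_at _ X i \<longleftrightarrow>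
     (\<forall>c \<in> cochains X i. coboundary X c = (0 :: 'a set \<Rightarrow> 'k) \<longrightarrow> c \<in> coboundary X ` cochains X (i - 1))"

text \<open>These are exactly the differences of two downward closed families, that is, the families
  that carry a relative cochain complex.\<close>

definition convex_family :: "'a set set \<Rightarrow> bool" where
  "convex_family X \<longleftrightarrow> (\<forall>F\<in>X. \<forall>H\<in>X. \<forall>G. F \<subseteq> G \<and> G \<subseteq> H \<longrightarrow> G \<in> X)"

definition restrict_to :: "'a set \<Rightarrow> ('a \<Rightarrow> 'k::zero) \<Rightarrow> 'a \<Rightarrow> 'k" where
  "restrict_to Z c = (\<lambda>F. if F \<in> Z then c F else 0)"

lemma cochainsI: "(\<And>F. c F \<noteq> 0 \<Longrightarrow> F \<in> X \<and> int (card F) = i) \<Longrightarrow> c \<in> cochains X i"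
  by (auto simp: cochains_def)

lemma cochains_zero: "c \<in> cochains X i \<Longrightarrow> F \<notin> X \<Longrightarrow> c F = 0"
  by (auto simp: cochains_def)

lemma cochains_card: "c \<in> cochains X i \<Longrightarrow> c F \<noteq> 0 \<Longrightarrow> int (card F) = i"
  by (auto simp: cochains_def)

lemma cochains_diff: "c \<in> cochains X i \<Longrightarrow> d \<in> cochains X i \<Longrightarrow> c - d \<in> cochains X i"
  by (auto simp: cochains_def) (metis diff_zero)+

lemma cochains_add: "c \<in> cochains X i \<Longrightarrow> d \<in> cochains X i \<Longrightarrow> c + d \<in> cochains X i"
  by (auto simp: cochains_def) (metis add.right_neutral)+

lemma cochains_zero_fun [simp]: "0 \<in> cochains X i"
  by (auto simp: cochains_def)

lemma cochains_restrict: "c \<in> cochains X i \<Longrightarrow> Z \<subseteq> X \<Longrightarrow> restrict_to Z c \<in> cochains Z i"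
  by (auto simp: cochains_def restrict_to_def)

lemma cochains_mono: "c \<in> cochains Z i \<Longrightarrow> Z \<subseteq> X \<Longrightarrow> c \<in> cochains X i"
  by (auto simp: cochains_def)

lemma coboundary_add: "coboundary X (c + d) = coboundary X c + coboundary X d"
  by (auto simp: coboundary_def fun_eq_iff sum.distrib algebra_simps)

lemma coboundary_diff: "coboundary X (c - d) = coboundary X c - coboundary X d"
  by (auto simp: coboundary_def fun_eq_iff sum_subtractf algebra_simps)

lemma coboundary_0 [simp]: "coboundary X 0 = 0"
  by (auto simp: coboundary_def fun_eq_iff)

lemma coboundary_cochains:
  assumes "c \<in> cochains X i" shows "coboundary X c \<in> cochains X (i + 1)"
proof (rule cochainsI)
  fix T assume T: "coboundary X c T \<noteq> 0"
  then obtain v where v: "v \<in> T" "c (T - {v}) \<noteq> 0"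
    by (auto simp: coboundary_def split: if_splits elim!: sum.not_neutral_contains_not_neutral)
  have "card T = Suc (card (T - {v}))" using v(1) by (rule card.remove[OF finite])
  with cochains_card[OF assms v(2)] T show "T \<in> X \<and> int (card T) = i + 1"
    by (auto simp: coboundary_def split: if_splits)
qed

lemma incidence_sign_square [simp]: "incidence_sign v F * incidence_sign v F = (1 :: 'k::comm_ring_1)"
  by (simp add: incidence_sign_def flip: power_add)

lemma incidence_sign_square_left [simp]:
  "incidence_sign v F * (incidence_sign v F * x) = (x :: 'k::comm_ring_1)"
  by (simp flip: mult.assoc)

lemma incidence_sign_nonzero [simp]: "incidence_sign v F \<noteq> (0 :: 'k::field)"
  by (simp add: incidence_sign_def)

lemma incidence_sign_remove_less:
  fixes T :: "'a::{finite,linorder} set"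
  assumes "v \<in> T" "v < u"
  shows "incidence_sign u (T - {v}) = - (incidence_sign u T :: 'k::comm_ring_1)"
proof -
  have "{w \<in> T. w < u} = insert v {w \<in> T - {v}. w < u}" using assms by auto
  then have "card {w \<in> T. w < u} = Suc (card {w \<in> T - {v}. w < u})" by simp
  then show ?thesis by (simp add: incidence_sign_def)
qed

lemma incidence_sign_remove_greater:
  fixes T :: "'a::{finite,linorder} set"
  assumes "v < u"
  shows "incidence_sign v (T - {u}) = incidence_sign v T"
proof -
  have "{w \<in> T. w < v} = {w \<in> T - {u}. w < v}" using assms by auto
  then show ?thesis by (simp add: incidence_sign_def)
qed

text \<open>Deleting the smaller of two elements lowers the position of the larger by one, while
  deleting the larger leaves the smaller alone.\<close>

lemma incidence_sign_anticommute:
  fixes T :: "'a::{finite,linorder} set"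
  assumes "u \<in> T" "v \<in> T" "u \<noteq> v"
  shows "incidence_sign v T * incidence_sign u (T - {v}) =
    - (incidence_sign u T * incidence_sign v (T - {u}) :: 'k::comm_ring_1)"
  using assms by (cases "u < v") (simp_all add: incidence_sign_remove_less incidence_sign_remove_greater)

text \<open>The two orders in which u and v can be removed from T contribute with opposite
  signs.\<close>

lemma coboundary_coboundary:
  assumes X: "convex_family X" and c: "c \<in> cochains X i"
  shows "coboundary X (coboundary X c) = 0"
proof
  fix T
  show "coboundary X (coboundary X c) T = 0 T"
  proof (cases "T \<in> X")
    case T: True
    define g where "g v u = incidence_sign v T * (incidence_sign u (T - {v}) * c (T - {v} - {u}))" for v u
    have g: "g v u = - g u v" if "v \<in> T" "u \<in> T" "v \<noteq> u" for u v
    proof -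
      have "g v u = (incidence_sign v T * incidence_sign u (T - {v})) * c (T - {u} - {v})"
        by (simp add: g_def mult.assoc Diff_insert2[symmetric] insert_commute)
      also have "\<dots> = - g u v"
        using incidence_sign_anticommute[OF that(2,1) that(3)[symmetric], where 'k='b]
        by (simp add: g_def mult.assoc)
      finally show ?thesis .
    qed
    \<comment> \<open>Convexity enters here: if T - {v} is missing from X, then so is every T - {v}
      - {u}, and c vanishes there.\<close>
    have inner: "coboundary X c (T - {v}) = (\<Sum>u\<in>T - {v}. incidence_sign u (T - {v}) * c (T - {v} - {u}))"
      if "v \<in> T" for v
    proof (cases "T - {v} \<in> X")
      case False
      have "c (T - {v} - {u}) = 0" for u
      proof (rule cochains_zero[OF c], rule notI)
        assume "T - {v} - {u} \<in> X"
        moreover have "T - {v} - {u} \<subseteq> T - {v}" "T - {v} \<subseteq> T" by auto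
        ultimately have "T - {v} \<in> X" using T X unfolding convex_family_def by metis
        with False show False ..
      qed
      then show ?thesis using False by (simp add: coboundary_def)
    qed (simp add: coboundary_def)
    have "coboundary X (coboundary X c) T = (\<Sum>v\<in>T. \<Sum>u\<in>T - {v}. g v u)"
      using T by (simp add: coboundary_def[of X "coboundary X c"] inner g_def sum_distrib_left)
    also have "\<dots> = (\<Sum>p\<in>Sigma T (\<lambda>v. T - {v}). g (fst p) (snd p))"
      by (simp add: sum.Sigma split_def)
    also have "Sigma T (\<lambda>v. T - {v}) = {p\<in>T\<times>T. fst p < snd p} \<union> {p\<in>T\<times>T. snd p < fst p}" by auto
    also have "(\<Sum>p\<in>\<dots>. g (fst p) (snd p)) = (\<Sum>p\<in>{p\<in>T\<times>T. fst p < snd p}. g (fst p) (snd p))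
        + (\<Sum>p\<in>{p\<in>T\<times>T. snd p < fst p}. g (fst p) (snd p))"
      by (rule sum.union_disjoint) auto
    also have "(\<Sum>p\<in>{p\<in>T\<times>T. snd p < fst p}. g (fst p) (snd p))
        = (\<Sum>p\<in>{p\<in>T\<times>T. fst p < snd p}. g (snd p) (fst p))"
      by (rule sum.reindex_bij_witness[of _ prod.swap prod.swap]) auto
    also have "\<dots> = (\<Sum>p\<in>{p\<in>T\<times>T. fst p < snd p}. - g (fst p) (snd p))"
      by (rule sum.cong[OF refl], rule g) auto
    also have "\<dots> = - (\<Sum>p\<in>{p\<in>T\<times>T. fst p < snd p}. g (fst p) (snd p))"
      by (rule sum_negf)
    finally show ?thesis by simp
  qed (simp add: coboundary_def)
qed

lemma acyclic_atD:
  fixes X :: "'a::{finite,linorder} set set" and c :: "'a set \<Rightarrow> 'k::field"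
  assumes "acyclic_at TYPE('k) X i" "c \<in> cochains X i" "coboundary X c = 0"
  obtains b :: "'a set \<Rightarrow> 'k" where "b \<in> cochains X (i - 1)" "coboundary X b = c"
  using assms unfolding acyclic_at_def by blast

lemma acyclic_atI:
  fixes X :: "'a::{finite,linorder} set set"
  assumes "\<And>c :: 'a set \<Rightarrow> 'k::field. c \<in> cochains X i \<Longrightarrow> coboundary X c = 0 \<Longrightarrow>
    \<exists>b \<in> cochains X (i - 1). coboundary X b = c"
  shows "acyclic_at TYPE('k) X i"
  using assms unfolding acyclic_at_def by blast

lemma acyclic_at_no_faces:
  assumes "\<And>F. F \<in> X \<Longrightarrow> int (card F) \<noteq> i"
  shows "acyclic_at TYPE('k::field) (X :: 'a::{finite,linorder} set set) i"
proof (rule acyclic_atI)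
  fix c :: "'a set \<Rightarrow> 'k" assume "c \<in> cochains X i"
  then have "c = 0" using assms by (auto simp: cochains_def fun_eq_iff)
  then show "\<exists>b \<in> cochains X (i - 1). coboundary X b = c" by (intro bexI[of _ 0]) auto
qed

text \<open>Upward closedness of Y in X gives a short exact sequence: extension by zero embeds the
  cochains of Y, restriction to Z is the quotient map. The lemmas on acyclicity below are the three
  exact spots of its long exact sequence.\<close>

locale cut_family =
  fixes X Y Z :: "'a::{finite,linorder} set set"
  assumes conv: "convex_family X"
    and X: "X = Y \<union> Z" and disj: "Y \<inter> Z = {}"
    and upper: "\<And>F G. F \<in> Y \<Longrightarrow> G \<in> X \<Longrightarrow> F \<subseteq> G \<Longrightarrow> G \<in> Y"
begin

lemma restrict_lower:
  assumes "c \<in> cochains X i"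
  shows "restrict_to Z (coboundary X c) = coboundary Z (restrict_to Z c)"
proof
  fix T
  have "c (T - {v}) = restrict_to Z c (T - {v})" if "T \<in> Z" for v
    using cochains_zero[OF assms, of "T - {v}"] upper[of "T - {v}" T] disj that X
    by (auto simp: restrict_to_def)
  then show "restrict_to Z (coboundary X c) T = coboundary Z (restrict_to Z c) T"
    using X by (auto simp: restrict_to_def coboundary_def)
qed

lemma extend_upper:
  assumes "c \<in> cochains Y i"
  shows "coboundary X c = coboundary Y c"
proof
  fix T
  have "c (T - {v}) = 0" if "T \<in> Z" for v
    using cochains_zero[OF assms, of "T - {v}"] upper[of "T - {v}" T] disj that X by auto
  then show "coboundary X c T = coboundary Y c T"
    using X by (auto simp: coboundary_def)
qed

lemma upper_cochain:
  assumes "c \<in> cochains X i" "restrict_to Z c = 0"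
  shows "c \<in> cochains Y i"
proof -
  have "c F = 0" if "F \<in> Z" for F using fun_cong[OF assms(2), of F] that by (simp add: restrict_to_def)
  then show ?thesis using assms(1) X unfolding cochains_def by blast
qed

lemma YX: "Y \<subseteq> X" and ZX: "Z \<subseteq> X" using X by auto

lemma restrict_Z: "c \<in> cochains Z i \<Longrightarrow> restrict_to Z c = c"
  by (auto simp: restrict_to_def fun_eq_iff cochains_zero)

lemma restrict_Y: "c \<in> cochains Y i \<Longrightarrow> restrict_to Z c = 0"
  using disj by (auto simp: restrict_to_def fun_eq_iff intro: cochains_zero)

lemma restrict_diff: "restrict_to Z (c - d) = restrict_to Z c - (restrict_to Z d :: 'a set \<Rightarrow> 'k::field)"
  by (auto simp: restrict_to_def)

lemma restrict_0: "restrict_to Z 0 = (0 :: 'a set \<Rightarrow> 'k::field)"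
  by (auto simp: restrict_to_def)

text \<open>Exactness at X: H^i(Y) -> H^i(X) -> H^i(Z).\<close>

lemma acyclic_whole:
  assumes Y: "acyclic_at TYPE('k::field) Y i" and Z: "acyclic_at TYPE('k) Z i"
  shows "acyclic_at TYPE('k) X i"
proof (rule acyclic_atI)
  fix c :: "'a set \<Rightarrow> 'k" assume c: "c \<in> cochains X i" "coboundary X c = 0"
  have "coboundary Z (restrict_to Z c) = 0" using restrict_lower[OF c(1)] c(2) restrict_0 by metis
  then obtain b :: "'a set \<Rightarrow> 'k" where b: "b \<in> cochains Z (i - 1)" "coboundary Z b = restrict_to Z c"
    using acyclic_atD[OF Z cochains_restrict[OF c(1) ZX]] by metis
  have bX: "b \<in> cochains X (i - 1)" using cochains_mono[OF b(1) ZX] .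
  \<comment> \<open>Subtracting the coboundary of a lifted primitive moves the cocycle from X into
    Y.\<close>
  define e where "e = c - coboundary X b"
  have eX: "e \<in> cochains X i"
    unfolding e_def using coboundary_cochains[OF bX] c(1) by (intro cochains_diff) auto
  have "restrict_to Z e = 0"
    unfolding e_def restrict_diff restrict_lower[OF bX] restrict_Z[OF b(1)] b(2) by simp
  then have eY: "e \<in> cochains Y i" using upper_cochain eX by blast
  have "coboundary Y e = coboundary X e" using extend_upper[OF eY] by simp
  also have "\<dots> = 0"
    unfolding e_def coboundary_diff c(2) coboundary_coboundary[OF conv bX] by simp
  finally obtain a where a: "a \<in> cochains Y (i - 1)" "coboundary Y a = e"
    using acyclic_atD[OF Y eY] by metis
  show "\<exists>b \<in> cochains X (i - 1). coboundary X b = c"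
  proof (rule bexI)
    show "coboundary X (b + a) = c"
      unfolding coboundary_add extend_upper[OF a(1)] a(2) e_def by simp
    show "b + a \<in> cochains X (i - 1)" using cochains_add[OF bX cochains_mono[OF a(1) YX]] .
  qed
qed

text \<open>Exactness at Y: H^(i-1)(Z) -> H^i(Y) -> H^i(X). A primitive of c over X is corrected
  until it vanishes on Z.\<close>

lemma acyclic_upper:
  assumes X: "acyclic_at TYPE('k::field) X i" and Z: "acyclic_at TYPE('k) Z (i - 1)"
  shows "acyclic_at TYPE('k) Y i"
proof (rule acyclic_atI)
  fix c :: "'a set \<Rightarrow> 'k" assume c: "c \<in> cochains Y i" "coboundary Y c = 0"
  have "coboundary X c = 0" using c extend_upper by metis
  then obtain b :: "'a set \<Rightarrow> 'k" where b: "b \<in> cochains X (i - 1)" "coboundary X b = c"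
    using acyclic_atD[OF X cochains_mono[OF c(1) YX]] by metis
  have "coboundary Z (restrict_to Z b) = 0"
    using restrict_lower[OF b(1)] b(2) restrict_Y[OF c(1)] by metis
  then obtain a where a: "a \<in> cochains Z (i - 1 - 1)" "coboundary Z a = restrict_to Z b"
    using acyclic_atD[OF Z cochains_restrict[OF b(1) ZX]] by metis
  have aX: "a \<in> cochains X (i - 1 - 1)" using cochains_mono[OF a(1) ZX] .
  define e where "e = b - coboundary X a"
  have eX: "e \<in> cochains X (i - 1)"
    unfolding e_def using coboundary_cochains[OF aX] b(1) by (intro cochains_diff) auto
  have "restrict_to Z e = 0"
    unfolding e_def restrict_diff restrict_lower[OF aX] restrict_Z[OF a(1)] a(2) by simp
  then have eY: "e \<in> cochains Y (i - 1)" using upper_cochain eX by blast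
  have "coboundary Y e = coboundary X e" using extend_upper[OF eY] by simp
  also have "\<dots> = c"
    unfolding e_def coboundary_diff b(2) coboundary_coboundary[OF conv aX] by simp
  finally show "\<exists>b \<in> cochains Y (i - 1). coboundary Y b = c" using eY by blast
qed

text \<open>Exactness at Z: H^i(X) -> H^i(Z) -> H^(i+1)(Y). The coboundary over X of a cocycle of Z
  lives on Y; its primitive there corrects c to a cocycle of X.\<close>

lemma acyclic_lower:
  assumes X: "acyclic_at TYPE('k::field) X i" and Y: "acyclic_at TYPE('k) Y (i + 1)"
  shows "acyclic_at TYPE('k) Z i"
proof (rule acyclic_atI)
  fix c :: "'a set \<Rightarrow> 'k" assume c: "c \<in> cochains Z i" "coboundary Z c = 0"
  have cX: "c \<in> cochains X i" using cochains_mono[OF c(1) ZX] .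
  have "restrict_to Z (coboundary X c) = 0"
    using restrict_lower[OF cX] restrict_Z[OF c(1)] c(2) by metis
  then have dY: "coboundary X c \<in> cochains Y (i + 1)"
    using upper_cochain coboundary_cochains[OF cX] by blast
  have "coboundary Y (coboundary X c) = 0"
    using extend_upper[OF dY] coboundary_coboundary[OF conv cX] by metis
  then obtain b :: "'a set \<Rightarrow> 'k" where b: "b \<in> cochains Y (i + 1 - 1)" "coboundary Y b = coboundary X c"
    using acyclic_atD[OF Y dY] by metis
  have bY: "b \<in> cochains Y i" using b(1) by simp
  have "coboundary X (c - b) = 0"
    unfolding coboundary_diff extend_upper[OF b(1)] b(2) by simp
  then obtain a where a: "a \<in> cochains X (i - 1)" "coboundary X a = c - b"
    using acyclic_atD[OF X cochains_diff[OF cX cochains_mono[OF bY YX]]] by metis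
  have "coboundary Z (restrict_to Z a) = c"
    unfolding restrict_lower[OF a(1), symmetric] a(2) restrict_diff restrict_Z[OF c(1)] restrict_Y[OF bY] by simp
  then show "\<exists>b \<in> cochains Z (i - 1). coboundary Z b = c"
    using cochains_restrict[OF a(1) ZX] by blast
qed

end

text \<open>Toggling v never leaves X, so evaluating c after adding v, with the incidence sign, is a
  contracting homotopy.\<close>

lemma acyclic_cone:
  fixes X :: "'a::{finite,linorder} set set"
  assumes "\<And>F. F \<in> X \<Longrightarrow> insert v F \<in> X \<and> F - {v} \<in> X"
  shows "acyclic_at TYPE('k::field) X i"
proof (rule acyclic_atI)
  fix c :: "'a set \<Rightarrow> 'k" assume c: "c \<in> cochains X i" "coboundary X c = 0"
  define b where "b F = (if v \<in> F then 0 else incidence_sign v (insert v F) * c (insert v F))" for F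
  have b: "b \<in> cochains X (i - 1)"
  proof (rule cochainsI)
    fix F assume "b F \<noteq> 0"
    then have F: "v \<notin> F" "c (insert v F) \<noteq> 0" by (auto simp: b_def split: if_splits)
    have "insert v F \<in> X" using F(2) cochains_zero[OF c(1)] by blast
    moreover note cochains_card[OF c(1) F(2)]
    ultimately
    show "F \<in> X \<and> int (card F) = i - 1"
      using assms[of "insert v F"] F(1) by auto
  qed
  have "coboundary X b T = c T" for T
  proof (cases "T \<in> X")
    case T: True
    show ?thesis
    proof (cases "v \<in> T")
      case True
      have "coboundary X b T = (\<Sum>u\<in>T. incidence_sign u T * b (T - {u}))"
        using T by (simp add: coboundary_def)
      also have "\<dots> = (\<Sum>u\<in>T. if u = v then c T else 0)"
      proof (rule sum.cong[OF refl])
        fix u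
        show "incidence_sign u T * b (T - {u}) = (if u = v then c T else 0)"
          using True by (cases "u = v") (auto simp: b_def insert_absorb)
      qed
      finally show ?thesis using True by simp
    next
      case v: False
      \<comment> \<open>For v outside T the coboundary of b at T involves the same values of c as
        the cocycle condition at \<open>insert v T\<close>, up to one common sign.\<close>
      define T' where "T' = insert v T"
      have T': "T' \<in> X" "T' - {v} = T" "v \<in> T'" using assms[OF T] v by (auto simp: T'_def)
      have "0 = coboundary X c T'" using c(2) by simp
      also have "\<dots> = (\<Sum>u\<in>T'. incidence_sign u T' * c (T' - {u}))" using T' by (simp add: coboundary_def)
      also have "\<dots> = incidence_sign v T' * c T + (\<Sum>u\<in>T. incidence_sign u T' * c (T' - {u}))"
        using v T'(2) by (simp add: T'_def)
      finally have eq: "(\<Sum>u\<in>T. incidence_sign u T' * c (T' - {u})) = - (incidence_sign v T' * c T)"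
        by (simp add: eq_neg_iff_add_eq_0 add.commute)
      have "coboundary X b T = (\<Sum>u\<in>T. - (incidence_sign v T' * (incidence_sign u T' * c (T' - {u}))))"
        using T unfolding coboundary_def
      proof (simp, intro sum.cong refl)
        fix u assume u: "u \<in> T"
        have un: "u \<noteq> v" "u \<in> T'" using u v by (auto simp: T'_def)
        have *: "incidence_sign v T' * incidence_sign u T = - (incidence_sign u T' * incidence_sign v (T' - {u}) :: 'k)"
          using incidence_sign_anticommute[OF un(2) T'(3) un(1), where 'k='k] T'(2) by simp
        have "incidence_sign u T = incidence_sign v T' * (incidence_sign v T' * incidence_sign u T :: 'k)" by simp
        also have "\<dots> = - (incidence_sign v T' * incidence_sign u T' * incidence_sign v (T' - {u}))"
          unfolding * by simp
        finally have **: "incidence_sign u T = - (incidence_sign v T' * incidence_sign u T' * incidence_sign v (T' - {u}) :: 'k)" .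
        have "insert v (T - {u}) = T' - {u}" using un by (auto simp: T'_def)
        then have "b (T - {u}) = incidence_sign v (T' - {u}) * c (T' - {u})" using v by (simp add: b_def)
        then show "incidence_sign u T * b (T - {u}) = - (incidence_sign v T' * (incidence_sign u T' * c (T' - {u})))"
          unfolding ** by (simp add: mult.assoc mult.left_commute)
      qed
      also have "\<dots> = - (incidence_sign v T' * (\<Sum>u\<in>T. incidence_sign u T' * c (T' - {u})))"
        by (simp add: sum_negf sum_distrib_left)
      finally show ?thesis unfolding eq by simp
    qed
  qed (simp add: coboundary_def cochains_zero[OF c(1)])
  then show "\<exists>b \<in> cochains X (i - 1). coboundary X b = c" using b by blast
qed


text \<open>Adjoining a fixed set G to all faces shifts degrees by \<open>card G\<close>. The signs
  of the two complexes differ by one factor per vertex, which a rescaling of each face absorbs. This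
  serves both to pass from links to stars and from restrictions of \<Delta> to strands of the cell
  resolution.\<close>

lemma acyclic_translate:
  fixes f :: "'a::{finite,linorder} \<Rightarrow> 'b::{finite,linorder}"
  assumes f: "strict_mono f" and disj: "\<And>F. F \<in> Y \<Longrightarrow> f ` F \<inter> G = {}"
    and X: "X = (\<lambda>F. f ` F \<union> G) ` Y"
  shows "acyclic_at TYPE('k::field) X (i + int (card G)) \<longleftrightarrow> acyclic_at TYPE('k) Y i"
proof -
  have inj: "inj f" using f by (rule strict_mono_imp_inj_on)
  \<comment> \<open>\<open>\<epsilon> v\<close> is the sign caused by the elements of G below
    \<open>f v\<close>; \<open>\<theta>\<close> multiplies these over a face and is its own
    inverse.\<close>
  define \<epsilon> :: "'a \<Rightarrow> 'k" where "\<epsilon> v = (-1) ^ card {w \<in> G. w < f v}" for v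
  define \<theta> where "\<theta> F = (\<Prod>v\<in>F. \<epsilon> v)" for F
  have \<epsilon>: "\<epsilon> v * \<epsilon> v = 1" for v by (simp add: \<epsilon>_def flip: power_add)
  have \<theta>: "\<theta> F * \<theta> F = 1" for F
    unfolding \<theta>_def prod.distrib[symmetric] \<epsilon> by simp
  then have \<theta>': "\<theta> F * (\<theta> F * x) = x" for F x by (simp flip: mult.assoc)
  have \<theta>_remove: "\<theta> F = \<epsilon> v * \<theta> (F - {v})" if "v \<in> F" for F v
    using that by (simp add: \<theta>_def prod.remove[OF finite])
  define e where "e F = f ` F \<union> G" for F
  have e_inj: "F = H" if "F \<in> Y" "e H = e F" "f ` H \<inter> G = {}" for F H
  proof -
    have "f ` F = f ` H" using that disj[of F] unfolding e_def by blast
    then show ?thesis using inj by (simp add: inj_image_eq_iff)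
  qed
  have e_inj_on: "inj_on e Y" using e_inj disj by (metis inj_onI)
  have card_e: "int (card (e F)) = int (card F) + int (card G)" if "F \<in> Y" for F
    using disj[OF that] inj by (simp add: e_def card_Un_disjoint card_image inj_on_subset)
  have sgn: "incidence_sign (f v) (e F) = incidence_sign v F * \<epsilon> v" if "F \<in> Y" for F v
  proof -
    have "{w \<in> e F. w < f v} = f ` {w \<in> F. w < v} \<union> {w \<in> G. w < f v}"
      using f by (auto simp: e_def strict_mono_less)
    moreover have "card (f ` {w \<in> F. w < v} \<union> {w \<in> G. w < f v}) = card {w \<in> F. w < v} + card {w \<in> G. w < f v}"
      using disj[OF that] inj by (subst card_Un_disjoint) (auto simp: card_image inj_on_subset)
    ultimately show ?thesis by (simp add: incidence_sign_def \<epsilon>_def power_add)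
  qed
  define pull where "pull c = (\<lambda>F. if F \<in> Y then \<theta> F * c (e F) else 0)" for c :: "'b set \<Rightarrow> 'k"
  \<comment> \<open>The inverse of \<open>e\<close> is taken only on X, which is the image of
    Y.\<close>
  define push where "push c = (\<lambda>H. if H \<in> X then (let F = the_inv_into Y e H in \<theta> F * c F) else 0)"
    for c :: "'a set \<Rightarrow> 'k"
  have XY: "X = e ` Y" using X by (simp add: e_def[abs_def])
  have push_e: "push c (e F) = \<theta> F * c F" if "F \<in> Y" for c F
    using that by (simp add: push_def XY the_inv_into_f_f[OF e_inj_on])
  have pull_cochain: "pull c \<in> cochains Y j" if "c \<in> cochains X (j + int (card G))" for c j
  proof (rule cochainsI)
    fix F assume F: "pull c F \<noteq> 0"
    then have FY: "F \<in> Y" "c (e F) \<noteq> 0" by (auto simp: pull_def split: if_splits)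
    from cochains_card[OF that FY(2)] card_e[OF FY(1)] FY(1) show "F \<in> Y \<and> int (card F) = j" by simp
  qed
  have push_cochain: "push c \<in> cochains X (j + int (card G))" if "c \<in> cochains Y j" for c j
  proof (rule cochainsI)
    fix H assume H: "push c H \<noteq> 0"
    then have "H \<in> X" by (auto simp: push_def split: if_splits)
    then obtain F where F: "F \<in> Y" "H = e F" using XY by blast
    from H have "c F \<noteq> 0" using F by (auto simp: push_e)
    from cochains_card[OF that this] card_e[OF F(1)] F \<open>H \<in> X\<close> show "H \<in> X \<and> int (card H) = j + int (card G)" by simp
  qed
  have pull_push: "pull (push c) = c" if "c \<in> cochains Y j" for c j
    using cochains_zero[OF that] by (auto simp: pull_def push_e \<theta>' fun_eq_iff)
  have push_pull: "push (pull c) = c" if "c \<in> cochains X j" for c j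
  proof
    fix H show "push (pull c) H = c H"
    proof (cases "H \<in> X")
      case True
      then obtain F where F: "F \<in> Y" "H = e F" using XY by blast
      then show ?thesis by (simp add: push_e) (simp add: pull_def \<theta>')
    next
      case False
      then show ?thesis using cochains_zero[OF that] by (simp add: push_def)
    qed
  qed
  have d_pull: "coboundary Y (pull c) = pull (coboundary X c)" if c: "c \<in> cochains X j" for c j
  proof
    fix F
    show "coboundary Y (pull c) F = pull (coboundary X c) F"
    proof (cases "F \<in> Y")
      case True
      have FG: "f ` F \<inter> G = {}" using disj[OF True] .
      have outG: "c (e F - {w}) = 0" if "w \<in> G" for w
        using that FG by (intro cochains_zero[OF c]) (auto simp: XY e_def)
      have step: "c (e F - {f v}) = (if F - {v} \<in> Y then c (e (F - {v})) else 0)" if v: "v \<in> F" for v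
      proof -
        have "f v \<notin> G" using v FG by blast
        then have eq: "e F - {f v} = e (F - {v})" using inj by (auto simp: e_def inj_def)
        have "c (e (F - {v})) = 0" if "F - {v} \<notin> Y"
        proof (rule cochains_zero[OF c], rule notI)
          assume "e (F - {v}) \<in> X"
          then obtain H where H: "H \<in> Y" "e (F - {v}) = e H" using XY by blast
          then have "H = F - {v}" using FG by (intro e_inj) auto
          with H that show False by simp
        qed
        with eq show ?thesis by simp
      qed
      have "pull (coboundary X c) F = \<theta> F * (\<Sum>w\<in>e F. incidence_sign w (e F) * c (e F - {w}))"
        using True by (simp add: pull_def coboundary_def XY)
      also have "(\<Sum>w\<in>e F. incidence_sign w (e F) * c (e F - {w})) = (\<Sum>w\<in>f ` F. incidence_sign w (e F) * c (e F - {w}))"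
        by (rule sum.mono_neutral_right) (auto simp: e_def outG[unfolded e_def])
      also have "\<dots> = (\<Sum>v\<in>F. incidence_sign (f v) (e F) * c (e F - {f v}))"
        by (subst sum.reindex) (auto simp: inj_on_subset[OF inj])
      also have "\<theta> F * \<dots> = (\<Sum>v\<in>F. incidence_sign v F * pull c (F - {v}))"
        unfolding sum_distrib_left
      proof (rule sum.cong[OF refl])
        fix v assume v: "v \<in> F"
        have "\<theta> F * (incidence_sign v F * \<epsilon> v) = incidence_sign v F * \<theta> (F - {v}) * (\<epsilon> v * \<epsilon> v)"
          unfolding \<theta>_remove[OF v] by (simp only: mult_ac)
        then have "\<theta> F * (incidence_sign v F * \<epsilon> v) = incidence_sign v F * \<theta> (F - {v})" unfolding \<epsilon> by simp
        then show "\<theta> F * (incidence_sign (f v) (e F) * c (e F - {f v})) = incidence_sign v F * pull c (F - {v})"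
          unfolding sgn[OF True] step[OF v] by (simp add: pull_def mult.assoc[symmetric])
      qed
      finally show ?thesis using True by (simp add: coboundary_def[of Y "pull c"])
    qed (simp add: coboundary_def pull_def)
  qed
  have d_push: "coboundary X (push c) = push (coboundary Y c)" if c: "c \<in> cochains Y j" for c j
  proof -
    have "push (coboundary Y c) = push (pull (coboundary X (push c)))"
      using d_pull[OF push_cochain[OF c]] pull_push[OF c] by simp
    also have "\<dots> = coboundary X (push c)"
      by (rule push_pull[OF coboundary_cochains[OF push_cochain[OF c]]])
    finally show ?thesis by simp
  qed
  have push0: "push 0 = 0" and pull0: "pull 0 = 0"
    by (auto simp: push_def pull_def fun_eq_iff Let_def)
  have shift: "i + int (card G) - 1 = (i - 1) + int (card G)" by simp
  show ?thesis
  proof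
    assume A: "acyclic_at TYPE('k) X (i + int (card G))"
    show "acyclic_at TYPE('k) Y i"
    proof (rule acyclic_atI)
      fix c :: "'a set \<Rightarrow> 'k" assume c: "c \<in> cochains Y i" "coboundary Y c = 0"
      obtain b where b: "b \<in> cochains X (i + int (card G) - 1)" "coboundary X b = push c"
        using acyclic_atD[OF A push_cochain[OF c(1)]] d_push[OF c(1)] c(2) push0 by metis
      have "coboundary Y (pull b) = c" using d_pull[OF b(1)] b(2) pull_push[OF c(1)] by simp
      then show "\<exists>b \<in> cochains Y (i - 1). coboundary Y b = c"
        using pull_cochain b(1) unfolding shift by blast
    qed
  next
    assume A: "acyclic_at TYPE('k) Y i"
    show "acyclic_at TYPE('k) X (i + int (card G))"
    proof (rule acyclic_atI)
      fix c :: "'b set \<Rightarrow> 'k" assume c: "c \<in> cochains X (i + int (card G))" "coboundary X c = 0"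
      obtain b where b: "b \<in> cochains Y (i - 1)" "coboundary Y b = pull c"
        using acyclic_atD[OF A pull_cochain[OF c(1)]] d_pull[OF c(1)] c(2) pull0 by metis
      have "coboundary X (push b) = c" using d_push[OF b(1)] b(2) push_pull[OF c(1)] by simp
      then show "\<exists>b \<in> cochains X (i + int (card G) - 1). coboundary X b = c"
        using push_cochain[OF b(1)] unfolding shift by blast
    qed
  qed
qed

section \<open>Dimensions of subquotients of spaces of functions\<close>

section \<open>Dimensions of quotient spaces\<close>

interpretation fun_space: vector_space "(\<lambda>a f x. a * f x) :: 'k::field \<Rightarrow> ('a \<Rightarrow> 'k) \<Rightarrow> 'a \<Rightarrow> 'k"
  by standard (auto simp: fun_eq_iff algebra_simps)

interpretation fun_space_pair: vector_space_pair
  "(\<lambda>a f x. a * f x) :: 'k::field \<Rightarrow> ('a \<Rightarrow> 'k) \<Rightarrow> 'a \<Rightarrow> 'k"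
  "(\<lambda>a f x. a * f x) :: 'k::field \<Rightarrow> ('b \<Rightarrow> 'k) \<Rightarrow> 'b \<Rightarrow> 'k" ..

definition delta :: "'a \<Rightarrow> 'a \<Rightarrow> 'k::field" where
  "delta x y = (if x = y then 1 else 0)"

lemma sum_fun_apply: "(\<Sum>x\<in>A. f x) y = (\<Sum>x\<in>A. f x y)"
  by (induction A rule: infinite_finite_induct) auto

lemma delta_expansion: "f = (\<Sum>x\<in>(UNIV :: 'a::finite set). (\<lambda>y. f x * (delta x y :: 'k::field)))"
proof
  fix y
  have "(\<Sum>x\<in>UNIV. f x * delta x y) = (\<Sum>x\<in>UNIV. if x = y then f x else 0)"
    by (rule sum.cong) (auto simp: delta_def)
  then show "f y = (\<Sum>x\<in>UNIV. (\<lambda>y. f x * delta x y)) y" by (simp add: sum_fun_apply)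
qed

interpretation finite_fun_space: finite_dimensional_vector_space
  "(\<lambda>a f x. a * f x) :: 'k::field \<Rightarrow> ('a::finite \<Rightarrow> 'k) \<Rightarrow> 'a \<Rightarrow> 'k" "range delta"
proof
  show "finite (range delta :: ('a \<Rightarrow> 'k) set)" by simp
  show "fun_space.independent (range delta :: ('a \<Rightarrow> 'k) set)"
  proof (rule fun_space.independent_if_scalars_zero)
    fix u :: "('a \<Rightarrow> 'k) \<Rightarrow> 'k" and g :: "'a \<Rightarrow> 'k"
    assume *: "(\<Sum>g\<in>range delta. (\<lambda>x. u g * g x)) = 0" and "g \<in> range delta"
    then obtain x where g: "g = delta x" by auto
    have inj: "inj (delta :: 'a \<Rightarrow> 'a \<Rightarrow> 'k)"
      by (rule injI) (metis delta_def one_neq_zero)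
    have "0 = (\<Sum>g\<in>range delta. (\<lambda>x. u g * g x)) x" using * by simp
    also have "\<dots> = (\<Sum>y\<in>UNIV. u (delta y) * delta y x)"
      by (simp add: sum_fun_apply sum.reindex[OF inj])
    also have "\<dots> = (\<Sum>y\<in>UNIV. if y = x then u (delta y) else 0)"
      by (rule sum.cong) (auto simp: delta_def)
    finally show "u g = 0" by (simp add: g)
  qed simp
  show "fun_space.span (range delta :: ('a \<Rightarrow> 'k) set) = UNIV"
  proof (intro equalityI subsetI UNIV_I)
    fix f :: "'a \<Rightarrow> 'k"
    have "(\<Sum>x\<in>UNIV. (\<lambda>y. f x * delta x y)) \<in> fun_space.span (range delta)"
      by (intro fun_space.span_sum fun_space.span_scale fun_space.span_base) auto
    then show "f \<in> fun_space.span (range delta)" using delta_expansion[of f] by simp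
  qed
qed

text \<open>Independence modulo B and modulo B' correspond under \<pi>, so both suprema range over
  the same cardinalities. The source enters through its finite combinations (\<open>closed\<close>,
  \<open>hom\<close>), which lets Cech cochains be compared with vectors over the field
  directly.\<close>

lemma quotient_dim_cong:
  fixes \<pi> :: "'a::ab_group_add \<Rightarrow> 'b::ab_group_add"
    and scale1 :: "'k::field \<Rightarrow> 'a \<Rightarrow> 'a" and scale2 :: "'k \<Rightarrow> 'b \<Rightarrow> 'b"
  assumes vs: "vector_space scale2"
    and closed: "\<And>X u. finite X \<Longrightarrow> X \<subseteq> Z \<Longrightarrow> (\<Sum>x\<in>X. scale1 (u x) x) \<in> Z"
    and hom: "\<And>X u. finite X \<Longrightarrow> X \<subseteq> Z \<Longrightarrow> \<pi> (\<Sum>x\<in>X. scale1 (u x) x) = (\<Sum>x\<in>X. scale2 (u x) (\<pi> x))"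
    and surj: "\<pi> ` Z = Z'" and kernel: "\<And>z. z \<in> Z \<Longrightarrow> \<pi> z \<in> B' \<longleftrightarrow> z \<in> B" and zero: "0 \<in> B'"
  shows "quotient_dim scale1 Z B = quotient_dim scale2 Z' B'"
proof -
  interpret vector_space scale2 by (rule vs)
  define P1 where "P1 X \<longleftrightarrow> finite X \<and> X \<subseteq> Z \<and> (\<forall>u. (\<Sum>x\<in>X. scale1 (u x) x) \<in> B \<longrightarrow> (\<forall>x\<in>X. u x = 0))" for X
  define P2 where "P2 X \<longleftrightarrow> finite X \<and> X \<subseteq> Z' \<and> (\<forall>u. (\<Sum>x\<in>X. scale2 (u x) x) \<in> B' \<longrightarrow> (\<forall>x\<in>X. u x = 0))" for X
  have "\<exists>Y. P2 Y \<and> card Y = card X" if "P1 X" for X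
  proof -
    have X: "finite X" "X \<subseteq> Z" and ind: "\<And>u x. (\<Sum>x\<in>X. scale1 (u x) x) \<in> B \<Longrightarrow> x \<in> X \<Longrightarrow> u x = 0"
      using that by (auto simp: P1_def)
    have eq: "(\<Sum>x\<in>X. scale1 (u x) x) \<in> B \<longleftrightarrow> (\<Sum>x\<in>X. scale2 (u x) (\<pi> x)) \<in> B'" for u
      using kernel[OF closed[OF X, of u]] hom[OF X, of u] by simp
    \<comment> \<open>Equal images would make x - y a nontrivial combination that \<pi> sends to 0,
      hence into B'.\<close>
    have inj: "inj_on \<pi> X"
    proof (rule inj_onI, rule ccontr)
      fix x y assume xy: "x \<in> X" "y \<in> X" "\<pi> x = \<pi> y" "x \<noteq> y"
      define u where "u z = (if z = x then 1 else if z = y then -1 else 0 :: 'k)" for z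
      have "(\<Sum>z\<in>X. scale2 (u z) (\<pi> z)) = (\<Sum>z\<in>{x,y}. scale2 (u z) (\<pi> z))"
        using xy X by (intro sum.mono_neutral_right) (auto simp: u_def)
      also have "\<dots> = 0" using xy by (simp add: u_def)
      finally have "u x = 0" using ind eq zero xy(1) by simp
      then show False by (simp add: u_def)
    qed
    have "P2 (\<pi> ` X)"
      unfolding P2_def
    proof (intro conjI allI impI ballI)
      show "finite (\<pi> ` X)" "\<pi> ` X \<subseteq> Z'" using X surj by auto
      fix u y assume u: "(\<Sum>x\<in>\<pi> ` X. scale2 (u x) x) \<in> B'" and "y \<in> \<pi> ` X"
      then obtain x where x: "x \<in> X" "y = \<pi> x" by auto
      have "(\<Sum>x\<in>X. scale1 (u (\<pi> x)) x) \<in> B" using u inj unfolding eq by (simp add: sum.reindex)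
      from ind[OF this x(1)] x(2) show "u y = 0" by simp
    qed
    then show ?thesis using card_image[OF inj] by blast
  qed
  moreover have "\<exists>X. P1 X \<and> card X = card Y" if "P2 Y" for Y
  proof -
    have Y: "finite Y" "Y \<subseteq> Z'" and ind: "\<And>u x. (\<Sum>x\<in>Y. scale2 (u x) x) \<in> B' \<Longrightarrow> x \<in> Y \<Longrightarrow> u x = 0"
      using that by (auto simp: P2_def)
    from Y(2) surj have "\<forall>y\<in>Y. \<exists>z\<in>Z. \<pi> z = y" by blast
    then obtain g where g: "\<And>y. y \<in> Y \<Longrightarrow> g y \<in> Z \<and> \<pi> (g y) = y" by metis
    have inj: "inj_on g Y" using g by (metis inj_onI)
    have gY: "finite (g ` Y)" "g ` Y \<subseteq> Z" using g Y by auto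
    have "P1 (g ` Y)"
      unfolding P1_def
    proof (intro conjI allI impI ballI gY)
      fix u x assume u: "(\<Sum>x\<in>g ` Y. scale1 (u x) x) \<in> B" and "x \<in> g ` Y"
      then obtain y where y: "y \<in> Y" "x = g y" by auto
      have "(\<Sum>x\<in>g ` Y. scale2 (u x) (\<pi> x)) \<in> B'"
        using kernel[OF closed[OF gY, of u]] hom[OF gY, of u] u by simp
      then have "(\<Sum>y\<in>Y. scale2 (u (g y)) y) \<in> B'"
        using g by (simp add: sum.reindex[OF inj])
      from ind[OF this y(1)] y(2) show "u x = 0" by simp
    qed
    then show ?thesis using card_image[OF inj] by blast
  qed
  ultimately have "{enat (card X) |X. P1 X} = {enat (card X) |X. P2 X}" by (smt (verit) Collect_cong)
  then show ?thesis unfolding quotient_dim_def P1_def P2_def by simp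
qed

context finite_dimensional_vector_space
begin

text \<open>A family independent modulo B stays independent after adjoining a basis of B, which
  gives the upper bound; the vectors that extend a basis of B to one of Z attain it.\<close>

lemma quotient_dim_eq_dim:
  assumes B: "subspace B" and Z: "subspace Z" and "B \<subseteq> Z"
  shows "quotient_dim scale Z B = enat (dim Z - dim B)" and "dim B \<le> dim Z"
proof -
  obtain b where b: "b \<subseteq> B" "independent b" "B \<subseteq> span b" "card b = dim B"
    using basis_exists by blast
  have "b \<subseteq> Z" using b assms by blast
  then obtain z where z: "b \<subseteq> z" "z \<subseteq> Z" "independent z" "Z \<subseteq> span z"
    using maximal_independent_subset_extend[OF _ b(2), of Z] by blast
  have fin: "finite z" "finite b" using z(3) b(2) finiteI_independent by auto
  have dz: "dim Z = card z" using z basis_card_eq_dim by metis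
  show le: "dim B \<le> dim Z" using b(4) dz card_mono[OF fin(1) z(1)] by simp
  have spanb: "span b = B" using b(1,3) B by (simp add: span_minimal subset_antisym)
  have ub: "card X \<le> dim Z - dim B"
    if X: "finite X" "X \<subseteq> Z" and ind: "\<And>u x. (\<Sum>x\<in>X. scale (u x) x) \<in> B \<Longrightarrow> x \<in> X \<Longrightarrow> u x = 0" for X
  proof -
    have disj: "X \<inter> b = {}"
    proof (rule ccontr)
      assume "X \<inter> b \<noteq> {}"
      then obtain x where x: "x \<in> X" "x \<in> b" by blast
      have "(\<Sum>y\<in>X. scale (if y = x then 1 else 0) y) = (\<Sum>y\<in>X. if y = x then x else 0)"
        by (rule sum.cong) auto
      then have "(\<Sum>y\<in>X. scale (if y = x then 1 else 0) y) = x" using X(1) x by simp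
      then have "(\<Sum>y\<in>X. scale (if y = x then 1 else 0) y) \<in> B" using x b(1) by auto
      from ind[OF this x(1)] show False by simp
    qed
    have "independent (X \<union> b)"
    proof (rule independent_if_scalars_zero)
      show "finite (X \<union> b)" using X fin by simp
      fix u y assume u: "(\<Sum>x\<in>X \<union> b. scale (u x) x) = 0" and y: "y \<in> X \<union> b"
      have sum0: "(\<Sum>x\<in>X. scale (u x) x) + (\<Sum>x\<in>b. scale (u x) x) = 0"
        using u sum.union_disjoint[OF X(1) fin(2) disj] by metis
      have "(\<Sum>x\<in>b. scale (- u x) x) \<in> B"
        unfolding spanb[symmetric] by (intro span_sum span_scale span_base)
      moreover have "(\<Sum>x\<in>X. scale (u x) x) = (\<Sum>x\<in>b. scale (- u x) x)"
        using sum0 by (simp add: sum_negf eq_neg_iff_add_eq_0)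
      ultimately have uX: "\<And>x. x \<in> X \<Longrightarrow> u x = 0" using ind by metis
      then have "(\<Sum>x\<in>b. scale (u x) x) = 0" using sum0 by simp
      then have "u x = 0" if "x \<in> b" for x
        using b(2) that fin unfolding independent_explicit_finite_subsets by blast
      then show "u y = 0" using uX y by blast
    qed
    moreover have "X \<union> b \<subseteq> Z" using X \<open>b \<subseteq> Z\<close> by auto
    ultimately have "card (X \<union> b) \<le> dim Z" using independent_card_le_dim by blast
    then show ?thesis using card_Un_disjoint[OF X(1) fin(2) disj] b(4) by simp
  qed
  have "\<exists>X. finite X \<and> X \<subseteq> Z \<and> (\<forall>u. (\<Sum>x\<in>X. scale (u x) x) \<in> B \<longrightarrow> (\<forall>x\<in>X. u x = 0)) \<and> card X = dim Z - dim B"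
  proof (intro exI conjI allI impI ballI)
    show "finite (z - b)" "z - b \<subseteq> Z" using fin z by auto
    show "card (z - b) = dim Z - dim B" using card_Diff_subset[OF fin(2) z(1)] dz b(4) by simp
    fix u x assume u: "(\<Sum>x\<in>z - b. scale (u x) x) \<in> B" and x: "x \<in> z - b"
    obtain w where w: "(\<Sum>x\<in>z - b. scale (u x) x) = (\<Sum>x\<in>b. scale (w x) x)"
      using u spanb span_finite[OF fin(2)] by auto
    define v where "v y = (if y \<in> b then - w y else u y)" for y
    have "(\<Sum>y\<in>z. scale (v y) y) = (\<Sum>y\<in>z - b. scale (v y) y) + (\<Sum>y\<in>b. scale (v y) y)"
      using sum.subset_diff[OF z(1) fin(1)] by blast
    also have "(\<Sum>y\<in>z - b. scale (v y) y) = (\<Sum>y\<in>z - b. scale (u y) y)"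
      by (rule sum.cong) (auto simp: v_def)
    also have "(\<Sum>y\<in>b. scale (v y) y) = - (\<Sum>y\<in>b. scale (w y) y)"
      by (simp add: v_def sum_negf)
    finally have "(\<Sum>y\<in>z. scale (v y) y) = 0" using w by simp
    then have "v x = 0" using z(3) x fin unfolding independent_explicit_finite_subsets by blast
    then show "u x = 0" using x by (simp add: v_def)
  qed
  then have mem: "enat (dim Z - dim B) \<in> {enat (card X) | X. finite X \<and> X \<subseteq> Z \<and>
       (\<forall>u. (\<Sum>x\<in>X. scale (u x) x) \<in> B \<longrightarrow> (\<forall>x\<in>X. u x = 0))}"
    by (smt (verit) mem_Collect_eq)
  show "quotient_dim scale Z B = enat (dim Z - dim B)"
    unfolding quotient_dim_def
  proof (intro antisym Sup_least)
    fix e assume "e \<in> {enat (card X) | X. finite X \<and> X \<subseteq> Z \<and>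
       (\<forall>u. (\<Sum>x\<in>X. scale (u x) x) \<in> B \<longrightarrow> (\<forall>x\<in>X. u x = 0))}"
    then obtain X where X: "e = enat (card X)" "finite X" "X \<subseteq> Z"
      "\<forall>u. (\<Sum>x\<in>X. scale (u x) x) \<in> B \<longrightarrow> (\<forall>x\<in>X. u x = 0)" by blast
    have "card X \<le> dim Z - dim B" using ub[OF X(2,3)] X(4) by blast
    then show "e \<le> enat (dim Z - dim B)" using X(1) by simp
  qed (use mem in \<open>rule Sup_upper\<close>)
qed

end

abbreviation fun_linear :: "(('a \<Rightarrow> 'k::field) \<Rightarrow> 'b \<Rightarrow> 'k) \<Rightarrow> bool" where
  "fun_linear \<equiv> Vector_Spaces.linear (\<lambda>a f x. a * f x) (\<lambda>a f x. a * f x)"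

lemma fun_linearI:
  assumes "\<And>x y. f (x + y) = f x + f y" and "\<And>a x. f (\<lambda>z. a * x z) = (\<lambda>z. a * f x z)"
  shows "fun_linear f"
  using assms by unfold_locales auto

text \<open>The isomorphism of S modulo the kernel with the image, with both quotient dimensions
  evaluated as differences.\<close>

lemma rank_nullity:
  fixes f :: "('a::finite \<Rightarrow> 'k::field) \<Rightarrow> 'b::finite \<Rightarrow> 'k"
  assumes f: "fun_linear f" and S: "fun_space.subspace S"
  shows "fun_space.dim S = fun_space.dim {x \<in> S. f x = 0} + fun_space.dim (f ` S)"
proof -
  interpret f: Vector_Spaces.linear "(\<lambda>a f x. a * f x) :: 'k \<Rightarrow> ('a \<Rightarrow> 'k) \<Rightarrow> 'a \<Rightarrow> 'k" "\<lambda>a f x. a * f x" f by (rule f)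
  let ?K = "{x \<in> S. f x = 0}"
  have K: "fun_space.subspace ?K"
    using S by (auto simp: fun_space.subspace_def f.add f.scale fun_eq_iff)
  have I: "fun_space.subspace (f ` S)" using S by (rule f.subspace_image)
  have "quotient_dim (\<lambda>a f x. a * f x) S ?K = quotient_dim (\<lambda>a f x. a * f x) (f ` S) {0}"
  proof (rule quotient_dim_cong[where \<pi> = f])
    fix X :: "('a \<Rightarrow> 'k) set" and u assume "finite X" "X \<subseteq> S"
    then show "(\<Sum>x\<in>X. (\<lambda>y. u x * x y)) \<in> S"
      using S by (intro fun_space.subspace_sum fun_space.subspace_scale) auto
    show "f (\<Sum>x\<in>X. (\<lambda>y. u x * x y)) = (\<Sum>x\<in>X. (\<lambda>y. u x * f x y))" by (simp add: f.sum f.scale)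
  qed (auto intro: fun_space.vector_space_axioms)
  moreover have "?K \<subseteq> S" "{0} \<subseteq> f ` S" using S f.zero by (auto simp: fun_space.subspace_0 intro!: image_eqI[of _ _ 0])
  ultimately have "fun_space.dim S - fun_space.dim ?K = fun_space.dim (f ` S) - fun_space.dim ({0} :: ('b \<Rightarrow> 'k) set)"
    and "fun_space.dim ?K \<le> fun_space.dim S"
    using finite_fun_space.quotient_dim_eq_dim[OF K S] finite_fun_space.quotient_dim_eq_dim(1)[OF fun_space.subspace_single_0 I]
    by auto
  then show ?thesis by simp
qed

section \<open>From homology of links to cohomology of stars\<close>

section \<open>Duality and the Euler characteristic\<close>

lemma fun_linear_functional:
  fixes B :: "('a::finite \<Rightarrow> 'k::field) \<Rightarrow> 'b \<Rightarrow> 'k"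
  assumes "fun_linear B"
  shows "B h y = (\<Sum>x\<in>UNIV. h x * B (delta x) y)"
proof -
  interpret B: Vector_Spaces.linear "(\<lambda>a f x. a * f x) :: 'k \<Rightarrow> ('a \<Rightarrow> 'k) \<Rightarrow> 'a \<Rightarrow> 'k" "\<lambda>a f x. a * f x" B by (rule assms)
  have "B h = B (\<Sum>x\<in>UNIV. (\<lambda>y. h x * delta x y))" using delta_expansion[of h] by simp
  then show ?thesis by (simp add: B.sum B.scale sum_fun_apply)
qed

text \<open>For a right inverse g of f on its image, z and \<open>g (f z)\<close> differ by an
  element of the kernel of f, so c factors through f via g. In other words, the annihilator of the
  kernel is the image of the transpose.\<close>

lemma linear_functional_factors:
  fixes f :: "('a::finite \<Rightarrow> 'k::field) \<Rightarrow> 'b::finite \<Rightarrow> 'k" and c :: "'a \<Rightarrow> 'k"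
  assumes f: "fun_linear f" and ker: "\<And>z. f z = 0 \<Longrightarrow> (\<Sum>x\<in>UNIV. c x * z x) = 0"
  obtains b where "\<And>z. (\<Sum>x\<in>UNIV. c x * z x) = (\<Sum>y\<in>UNIV. b y * f z y)"
proof -
  interpret f: Vector_Spaces.linear "(\<lambda>a f x. a * f x) :: 'k \<Rightarrow> ('a \<Rightarrow> 'k) \<Rightarrow> 'a \<Rightarrow> 'k" "\<lambda>a f x. a * f x" f by (rule f)
  obtain g where g: "fun_linear g" and gf: "\<And>z. f (g (f z)) = f z"
    using fun_space_pair.linear_exists_right_inverse_on[OF f fun_space.subspace_UNIV] by auto
  define c' :: "('a \<Rightarrow> 'k) \<Rightarrow> 'k" where "c' z = (\<Sum>x\<in>UNIV. c x * z x)" for z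
  define b where "b y = c' (g (delta y))" for y
  have c'_diff: "c' (z - w) = c' z - c' w" for z w by (simp add: c'_def algebra_simps sum_subtractf)
  have "c' z = (\<Sum>y\<in>UNIV. b y * f z y)" for z
  proof -
    have "f (z - g (f z)) = 0" by (simp add: f.diff gf)
    then have "c' (z - g (f z)) = 0" using ker unfolding c'_def by blast
    then have "c' z = c' (g (f z))" using c'_diff by simp
    also have "\<dots> = (\<Sum>x\<in>UNIV. c x * (\<Sum>y\<in>UNIV. f z y * g (delta y) x))"
      unfolding c'_def fun_linear_functional[OF g, of "f z"] by simp
    also have "\<dots> = (\<Sum>x\<in>UNIV. \<Sum>y\<in>UNIV. c x * g (delta y) x * f z y)"
      by (simp add: sum_distrib_left algebra_simps)
    also have "\<dots> = (\<Sum>y\<in>UNIV. \<Sum>x\<in>UNIV. c x * g (delta y) x * f z y)" by (rule sum.swap)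
    finally show ?thesis by (simp add: b_def c'_def sum_distrib_right)
  qed
  then show ?thesis using that unfolding c'_def by blast
qed

text \<open>Both sides sum over pairs of a set and one of its elements: F with v outside corresponds
  to T = \<open>insert v F\<close> with v inside.\<close>

lemma boundary_adjoint:
  fixes c w :: "'v::{finite,linorder} set \<Rightarrow> 'k::field"
  shows "(\<Sum>F\<in>UNIV. c F * boundary w F) =
    (\<Sum>T\<in>UNIV. (\<Sum>v\<in>T. incidence_sign v T * c (T - {v})) * w T)"
proof -
  have "(\<Sum>F\<in>UNIV. c F * boundary w F) =
      (\<Sum>(F,v)\<in>Sigma UNIV (\<lambda>F. - F). incidence_sign v (insert v F) * c F * w (insert v F))"
    by (simp add: boundary_def sum_distrib_left sum.Sigma[symmetric] algebra_simps)
  also have "\<dots> = (\<Sum>(T,v)\<in>Sigma UNIV (\<lambda>T. T). incidence_sign v T * c (T - {v}) * w T)"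
    by (rule sum.reindex_bij_witness[of _ "\<lambda>(T,v). (T - {v}, v)" "\<lambda>(F,v). (insert v F, v)"])
       (auto simp: insert_absorb)
  finally show ?thesis by (simp add: sum_distrib_right sum.Sigma[symmetric])
qed

text \<open>Duality over a field: a cocycle is a functional on chains that vanishes on boundaries,
  hence by hypothesis on cycles, hence it factors through the boundary map, and the factor is a
  primitive. Homology in dimension i lives on faces of cardinality i + 1.\<close>

lemma homology_vanishing_imp_acyclic:
  fixes L :: "'v::{finite,linorder} set set"
  assumes L: "\<And>F G. F \<in> L \<Longrightarrow> G \<subseteq> F \<Longrightarrow> G \<in> L"
    and H: "reduced_homology_vanishes TYPE('k::field) L i"
  shows "acyclic_at TYPE('k) L (i + 1)"
proof (rule acyclic_atI)
  fix c :: "'v set \<Rightarrow> 'k" assume c: "c \<in> cochains L (i + 1)" "coboundary L c = 0"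
  \<comment> \<open>Truncating to the i-dimensional faces of L first makes \<open>f\<close> a linear
    map on all functions, and elements of its kernel truncate to cycles.\<close>
  define cut :: "('v set \<Rightarrow> 'k) \<Rightarrow> 'v set \<Rightarrow> 'k"
    where "cut z = restrict_to {F \<in> L. int (card F) = i + 1} z" for z
  define f :: "('v set \<Rightarrow> 'k) \<Rightarrow> 'v set \<Rightarrow> 'k" where "f z = boundary (cut z)" for z
  have cut_chain: "cut z \<in> chains L i" for z
    by (auto simp: cut_def restrict_to_def chains_def face_dim_def)
  have f: "fun_linear f"
    by (rule fun_linearI)
      (auto simp: f_def cut_def restrict_to_def boundary_def fun_eq_iff sum_distrib_left
        sum.distrib[symmetric] algebra_simps intro!: sum.cong)
  have pair_cut: "(\<Sum>x\<in>UNIV. c x * cut z x) = (\<Sum>x\<in>UNIV. c x * z x)" for z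
    using cochains_zero[OF c(1)] cochains_card[OF c(1)]
    by (intro sum.cong) (auto simp: cut_def restrict_to_def)
  have ker: "(\<Sum>x\<in>UNIV. c x * z x) = 0" if "f z = 0" for z
  proof -
    have "cut z \<in> {z \<in> chains L i. boundary z = (\<lambda>_. 0)}"
      using that cut_chain by (auto simp: f_def fun_eq_iff)
    then obtain w where w: "w \<in> chains L (i + 1)" "cut z = boundary w"
      using H unfolding reduced_homology_vanishes_def by blast
    have "(\<Sum>x\<in>UNIV. c x * z x) = (\<Sum>x\<in>UNIV. c x * boundary w x)"
      using pair_cut[of z] w(2) by simp
    also have "\<dots> = (\<Sum>T\<in>UNIV. coboundary L c T * w T)"
      unfolding boundary_adjoint
      by (rule sum.cong) (use w(1) in \<open>auto simp: coboundary_def chains_def\<close>)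
    finally show ?thesis using c(2) by simp
  qed
  obtain b where b: "\<And>z. (\<Sum>x\<in>UNIV. c x * z x) = (\<Sum>y\<in>UNIV. b y * f z y)"
    using linear_functional_factors[OF f ker] by blast
  define b' where "b' = restrict_to {F \<in> L. int (card F) = i} b"
  have b': "b' \<in> cochains L (i + 1 - 1)"
    by (auto simp: b'_def cochains_def restrict_to_def)
  have cut_delta: "cut (delta F) = delta F" if "F \<in> L" "int (card F) = i + 1" for F
    using that by (auto simp: cut_def restrict_to_def delta_def fun_eq_iff)
  have "coboundary L b' F = c F" for F
  proof (cases "F \<in> L \<and> int (card F) = i + 1")
    case True
    have "c F = (\<Sum>x\<in>UNIV. c x * delta F x)" by (simp add: delta_def if_distrib cong: if_cong)
    also have "\<dots> = (\<Sum>y\<in>UNIV. b y * boundary (delta F) y)"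
      unfolding b f_def using True cut_delta by simp
    also have "\<dots> = (\<Sum>v\<in>F. incidence_sign v F * b (F - {v}))"
      unfolding boundary_adjoint by (simp add: delta_def if_distrib cong: if_cong)
    also have "\<dots> = (\<Sum>v\<in>F. incidence_sign v F * b' (F - {v}))"
    proof (rule sum.cong[OF refl])
      fix v assume "v \<in> F"
      moreover have "card F = Suc (card (F - {v}))" by (rule card.remove[OF finite]) fact
      ultimately have "int (card (F - {v})) = i" using True by linarith
      moreover have "F - {v} \<in> L" using True L by blast
      ultimately
      show "incidence_sign v F * b (F - {v}) = incidence_sign v F * b' (F - {v})"
        by (simp add: b'_def restrict_to_def)
    qed
    finally show ?thesis using True by (simp add: coboundary_def)
  next
    case False
    have "c F = 0" using False cochains_zero[OF c(1)] cochains_card[OF c(1)] by blast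
    moreover have "coboundary L b' \<in> cochains L (i + 1)" using coboundary_cochains[OF b'] by simp
    then have "coboundary L b' F = 0" using False unfolding cochains_def by blast
    ultimately show ?thesis by simp
  qed
  then show "\<exists>b \<in> cochains L (i + 1 - 1). coboundary L b = c" using b' by blast
qed

text \<open>The star of F is the link of F with F adjoined to each face. The bound on j leaves out
  just the top degree, as the shift by \<open>card F\<close> turns it into the strict bound of the
  Buchsbaum condition.\<close>

lemma buchsbaum_star_acyclic:
  fixes \<Delta> :: "'v::{finite,linorder} set set"
  assumes \<Delta>: "simplicial_complex \<Delta>" and B: "buchsbaum TYPE('k::field) \<Delta>"
    and F: "F \<in> \<Delta>" "F \<noteq> {}" and j: "j \<le> complex_dim \<Delta>"
  shows "acyclic_at TYPE('k) {G \<in> \<Delta>. F \<subseteq> G} j"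
proof (cases "j < int (card F)")
  case True
  show ?thesis
  proof (rule acyclic_at_no_faces)
    fix G assume "G \<in> {G \<in> \<Delta>. F \<subseteq> G}"
    then have "card F \<le> card G" by (simp add: card_mono)
    then show "int (card G) \<noteq> j" using True by simp
  qed
next
  case False
  define i where "i = j - int (card F)"
  have sub: "\<And>F G. F \<in> \<Delta> \<Longrightarrow> G \<subseteq> F \<Longrightarrow> G \<in> \<Delta>" using \<Delta> by (simp add: simplicial_complex_def)
  \<comment> \<open>Purity makes a facet T through F full-dimensional, so T - F bounds the dimension
    of the link from below.\<close>
  obtain T where T: "T \<in> \<Delta>" "F \<subseteq> T" "\<And>G. G \<in> \<Delta> \<Longrightarrow> T \<subseteq> G \<Longrightarrow> T = G"
    using finite_has_maximal2[of \<Delta> F] F by auto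
  then have "facet \<Delta> T" by (auto simp: facet_def)
  then have dimT: "face_dim T = complex_dim \<Delta>" using B by (simp add: buchsbaum_def pure_complex_def)
  have "T - F \<in> link \<Delta> F" using T by (auto simp: link_def Un_absorb1)
  then have "face_dim (T - F) \<le> complex_dim (link \<Delta> F)"
    unfolding complex_dim_def by (intro Max_ge) auto
  moreover have "card (T - F) + card F = card T" using T(2) by (simp add: card_Diff_subset card_mono)
  ultimately have "i - 1 < complex_dim (link \<Delta> F)"
    using j dimT unfolding i_def face_dim_def by linarith
  then have "reduced_homology_vanishes TYPE('k) (link \<Delta> F) (i - 1)"
    using B F by (auto simp: buchsbaum_def)
  then have "acyclic_at TYPE('k) (link \<Delta> F) (i - 1 + 1)"
  proof (rule homology_vanishing_imp_acyclic[rotated])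
    fix G H assume "G \<in> link \<Delta> F" "H \<subseteq> G"
    then show "H \<in> link \<Delta> F" using sub[of "F \<union> G" "F \<union> H"] by (auto simp: link_def)
  qed
  moreover have "{G \<in> \<Delta>. F \<subseteq> G} = (\<lambda>G. id ` G \<union> F) ` link \<Delta> F"
  proof (intro equalityI subsetI)
    fix G assume "G \<in> {G \<in> \<Delta>. F \<subseteq> G}"
    then show "G \<in> (\<lambda>G. id ` G \<union> F) ` link \<Delta> F"
      by (intro image_eqI[of _ _ "G - F"]) (auto simp: link_def Un_absorb1)
  qed (auto simp: link_def Un_commute)
  ultimately have "acyclic_at TYPE('k) {G \<in> \<Delta>. F \<subseteq> G} (i + int (card F))"
    by (subst acyclic_translate[where f = id and Y = "link \<Delta> F" and G = F])
      (auto simp: strict_mono_def link_def)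
  then show ?thesis by (simp add: i_def)
qed

section \<open>Dimension of cohomology and the Euler characteristic\<close>

definition cocycles :: "'a::{finite,linorder} set set \<Rightarrow> int \<Rightarrow> ('a set \<Rightarrow> 'k::field) set" where
  "cocycles X i = {c \<in> cochains X i. coboundary X c = 0}"

definition cohomology_dim :: "'k::field itself \<Rightarrow> 'a::{finite,linorder} set set \<Rightarrow> int \<Rightarrow> enat" where
  "cohomology_dim _ X i = quotient_dim (\<lambda>a f x. a * f x)
     (cocycles X i) (coboundary X ` (cochains X (i - 1) :: ('a set \<Rightarrow> 'k) set))"

lemma subspace_cochains: "fun_space.subspace (cochains X i :: ('a set \<Rightarrow> 'k::field) set)"
  unfolding fun_space.subspace_def by (auto intro: cochains_add) (auto simp: cochains_def)

lemma coboundary_linear: "fun_linear (coboundary X :: ('a::{finite,linorder} set \<Rightarrow> 'k::field) \<Rightarrow> _)"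
  by (rule fun_linearI) (auto simp: coboundary_add coboundary_def fun_eq_iff sum_distrib_left algebra_simps)

lemma dim_cochains:
  fixes X :: "'a::finite set set"
  shows "fun_space.dim (cochains X i :: ('a set \<Rightarrow> 'k::field) set) = card {F \<in> X. int (card F) = i}"
proof -
  let ?B = "(delta :: 'a set \<Rightarrow> 'a set \<Rightarrow> 'k) ` {F \<in> X. int (card F) = i}"
  have inj: "inj (delta :: 'a set \<Rightarrow> 'a set \<Rightarrow> 'k)"
    by (rule injI) (metis delta_def one_neq_zero)
  have "card ?B = fun_space.dim (cochains X i :: ('a set \<Rightarrow> 'k) set)"
  proof (rule fun_space.basis_card_eq_dim)
    show "?B \<subseteq> cochains X i" by (auto simp: cochains_def delta_def split: if_splits)
    show "fun_space.independent ?B"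
      by (rule fun_space.independent_mono[OF finite_fun_space.independent_Basis]) auto
    show "cochains X i \<subseteq> fun_space.span ?B"
    proof
      fix f :: "'a set \<Rightarrow> 'k" assume f: "f \<in> cochains X i"
      have "(\<lambda>y. f x * delta x y) \<in> fun_space.span ?B" for x
      proof (cases "f x = 0")
        case True
        then have eq: "(\<lambda>y. f x * delta x y) = 0" by auto
        show ?thesis unfolding eq by (rule fun_space.span_zero)
      next
        case False
        then show ?thesis using f
          by (intro fun_space.span_scale fun_space.span_base) (auto simp: cochains_def)
      qed
      then have "(\<Sum>x\<in>UNIV. (\<lambda>y. f x * delta x y)) \<in> fun_space.span ?B"
        by (intro fun_space.span_sum)
      then show "f \<in> fun_space.span ?B" using delta_expansion[of f] by simp
    qed
  qed
  then show ?thesis using card_image[OF inj_on_subset[OF inj subset_UNIV]] by metis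
qed

text \<open>Each face count is the dimension of the cocycles in its degree plus that of the
  coboundaries in the next, and the alternating sum telescopes to cohomology dimensions. With a
  single exceptional degree m the sign of the result is known.\<close>

lemma euler_characteristic:
  fixes X :: "'a::{finite,linorder} set set"
  assumes X: "convex_family X"
    and ex: "\<And>i. i \<noteq> m \<Longrightarrow> acyclic_at TYPE('k::field) X (int i)"
  obtains h where "cohomology_dim TYPE('k) X (int m) = enat h"
    and "(\<Sum>F\<in>X. (-1) ^ card F) = (-1) ^ m * int h"
proof -
  let ?\<delta> = "coboundary X :: ('a set \<Rightarrow> 'k) \<Rightarrow> 'a set \<Rightarrow> 'k"
  define Z where "Z i = (cocycles X i :: ('a set \<Rightarrow> 'k) set)" for i
  define B where "B i = ?\<delta> ` cochains X (i - 1)" for i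
  have BZ: "B i \<subseteq> Z i" for i
    using coboundary_coboundary[OF X] coboundary_cochains by (fastforce simp: B_def Z_def cocycles_def)
  interpret L: Vector_Spaces.linear "(\<lambda>a f x. a * f x) :: 'k \<Rightarrow> ('a set \<Rightarrow> 'k) \<Rightarrow> 'a set \<Rightarrow> 'k" "\<lambda>a f x. a * f x" ?\<delta>
    by (rule coboundary_linear)
  have subB: "fun_space.subspace (B i)" for i
    unfolding B_def by (rule L.subspace_image[OF subspace_cochains])
  have subZ: "fun_space.subspace (Z i)" for i
    using subspace_cochains[of X i] unfolding Z_def cocycles_def fun_space.subspace_def
    by (auto simp: coboundary_add L.scale fun_eq_iff)
  note dims = finite_fun_space.quotient_dim_eq_dim[OF subB subZ BZ]
  define C where "C n = int (card {F \<in> X. card F = n})" for n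
  have rank: "C n = int (fun_space.dim (Z (int n))) + int (fun_space.dim (B (int n + 1)))" for n
  proof -
    have "card {F \<in> X. int (card F) = int n} = fun_space.dim (Z (int n)) + fun_space.dim (B (int n + 1))"
      using rank_nullity[OF coboundary_linear[of X, where 'k='k] subspace_cochains[of X "int n"]] dim_cochains[of X "int n", where 'k='k]
      unfolding Z_def B_def cocycles_def by simp
    then show ?thesis unfolding C_def by simp
  qed
  have tele: "(\<Sum>i\<le>n. (-1) ^ i * C i) =
      (\<Sum>i\<le>n. (-1) ^ i * (int (fun_space.dim (Z (int i))) - int (fun_space.dim (B (int i)))))
      + (-1) ^ n * int (fun_space.dim (B (int n + 1)))" for n
  proof (induction n)
    case 0
    have "cochains X (- 1) = {0 :: 'a set \<Rightarrow> 'k}" by (auto simp: cochains_def fun_eq_iff)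
    then have "B 0 = {0}" by (simp add: B_def)
    then show ?case using rank[of 0] by (simp add: finite_fun_space.dim_eq_0[THEN iffD2])
  next
    case (Suc n)
    then show ?case using rank[of "Suc n"] by (simp add: algebra_simps)
  qed
  \<comment> \<open>Large enough that no set has N + 1 elements; adding m keeps m itself in the
    range.\<close>
  define N where "N = CARD('a) + m"
  have "cochains X (int N + 1) = {0 :: 'a set \<Rightarrow> 'k}"
  proof -
    have "int (card F) \<noteq> int N + 1" for F :: "'a set"
      using card_mono[of UNIV F] by (simp add: N_def)
    then show ?thesis by (auto simp: cochains_def fun_eq_iff)
  qed
  then have "B (int N + 1) \<subseteq> {0}" using BZ[of "int N + 1"] by (auto simp: Z_def cocycles_def)
  then have BN: "fun_space.dim (B (int N + 1)) = 0" by simp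
  have ZB: "Z (int i) = B (int i)" if "i \<noteq> m" for i
    using ex[OF that] BZ[of "int i"] unfolding acyclic_at_def Z_def B_def cocycles_def by blast
  define h where "h = fun_space.dim (Z (int m)) - fun_space.dim (B (int m))"
  have h1: "cohomology_dim TYPE('k) X (int m) = enat h"
    unfolding cohomology_dim_def h_def using dims(1)[of "int m"] unfolding Z_def B_def .
  have h2: "int h = int (fun_space.dim (Z (int m))) - int (fun_space.dim (B (int m)))"
    using dims(2)[of "int m"] unfolding h_def by simp
  have "(\<Sum>F\<in>X. (-1) ^ card F) = (\<Sum>i\<le>N. \<Sum>F\<in>{F \<in> X. card F = i}. (-1) ^ card F)"
  proof (rule sum.group[symmetric])
    show "card ` X \<subseteq> {..N}" using card_mono[OF finite subset_UNIV] by (fastforce simp: N_def intro: le_trans trans_le_add1)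
  qed auto
  also have "\<dots> = (\<Sum>i\<le>N. (-1) ^ i * C i)"
    by (rule sum.cong) (auto simp: C_def)
  also have "\<dots> = (\<Sum>i\<le>N. if i = m then (-1) ^ m * int h else 0)"
    unfolding tele BN by (simp only: mult_zero_right of_nat_0 add_0_right, rule sum.cong) (auto simp: ZB h2)
  also have "\<dots> = (-1) ^ m * int h" by (simp add: N_def)
  finally show thesis using that h1 by blast
qed

section \<open>Acyclicity of stars restricted to vertex subsets\<close>

section \<open>Vanishing for links and deletions\<close>

lemma convex_interval_family:
  assumes "\<And>F G. F \<in> \<Delta> \<Longrightarrow> G \<subseteq> F \<Longrightarrow> G \<in> \<Delta>"
  shows "convex_family {\<sigma> \<in> \<Delta>. F \<subseteq> \<sigma> \<and> \<sigma> \<subseteq> W}"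
  unfolding convex_family_def using assms by blast

text \<open>Cutting by membership of v makes the star of a larger set the upper part and the
  deletion of v the lower part.\<close>

lemma cut_interval_family:
  fixes \<Delta> :: "'v::{finite,linorder} set set"
  assumes "\<And>F G. F \<in> \<Delta> \<Longrightarrow> G \<subseteq> F \<Longrightarrow> G \<in> \<Delta>" and "v \<notin> F"
  shows "cut_family {\<sigma> \<in> \<Delta>. F \<subseteq> \<sigma> \<and> \<sigma> \<subseteq> W} {\<sigma> \<in> \<Delta>. insert v F \<subseteq> \<sigma> \<and> \<sigma> \<subseteq> W}
    {\<sigma> \<in> \<Delta>. F \<subseteq> \<sigma> \<and> \<sigma> \<subseteq> W - {v}}"
proof
  show "convex_family {\<sigma> \<in> \<Delta>. F \<subseteq> \<sigma> \<and> \<sigma> \<subseteq> W}" using assms(1) by (rule convex_interval_family)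
qed (use assms(2) in auto)

text \<open>Deleting v is controlled by the family before deletion in degree i and by the star of
  \<open>insert v F\<close> in degree i + 1, so every deleted vertex costs one degree.\<close>

lemma buchsbaum_deletion_acyclic:
  fixes \<Delta> :: "'v::{finite,linorder} set set"
  assumes \<Delta>: "simplicial_complex \<Delta>" and B: "buchsbaum TYPE('k::field) \<Delta>"
    and F: "F \<noteq> {}" and i: "i \<le> complex_dim \<Delta> - int (card (- W))"
  shows "acyclic_at TYPE('k) {\<sigma> \<in> \<Delta>. F \<subseteq> \<sigma> \<and> \<sigma> \<subseteq> W} i"
  using F i
proof (induction "card (- W)" arbitrary: W F i)
  case 0
  then have W: "W = UNIV" by auto
  show ?case
  proof (cases "F \<in> \<Delta>")
    case True
    then show ?thesis using buchsbaum_star_acyclic[OF \<Delta> B True 0(2)] 0 W by simp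
  next
    case False
    then have e: "{\<sigma> \<in> \<Delta>. F \<subseteq> \<sigma> \<and> \<sigma> \<subseteq> W} = {}" using \<Delta> unfolding simplicial_complex_def by blast
    show ?thesis unfolding e by (intro acyclic_at_no_faces) simp
  qed
next
  case (Suc n)
  then have "- W \<noteq> {}" by auto
  then obtain v where v: "v \<notin> W" by blast
  have W: "- W = insert v (- insert v W)" using v by auto
  then have n: "n = card (- insert v W)" using Suc.hyps(2) by simp
  show ?case
  proof (cases "v \<in> F")
    case True
    then have e: "{\<sigma> \<in> \<Delta>. F \<subseteq> \<sigma> \<and> \<sigma> \<subseteq> W} = {}" using v by auto
    show ?thesis unfolding e by (intro acyclic_at_no_faces) simp
  next
    case False
    interpret cut_family "{\<sigma> \<in> \<Delta>. F \<subseteq> \<sigma> \<and> \<sigma> \<subseteq> insert v W}" "{\<sigma> \<in> \<Delta>. insert v F \<subseteq> \<sigma> \<and> \<sigma> \<subseteq> insert v W}"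
      "{\<sigma> \<in> \<Delta>. F \<subseteq> \<sigma> \<and> \<sigma> \<subseteq> insert v W - {v}}"
      by (rule cut_interval_family[OF _ False]) (use \<Delta> in \<open>auto simp: simplicial_complex_def\<close>)
    have "acyclic_at TYPE('k) {\<sigma> \<in> \<Delta>. F \<subseteq> \<sigma> \<and> \<sigma> \<subseteq> insert v W} i"
      by (rule Suc.hyps(1)[OF n Suc.prems(1)]) (use Suc.prems(2) Suc.hyps(2) n in linarith)
    moreover have "acyclic_at TYPE('k) {\<sigma> \<in> \<Delta>. insert v F \<subseteq> \<sigma> \<and> \<sigma> \<subseteq> insert v W} (i + 1)"
      by (rule Suc.hyps(1)[OF n]) (use Suc.prems(2) Suc.hyps(2) n in \<open>simp, linarith\<close>)
    ultimately have "acyclic_at TYPE('k) {\<sigma> \<in> \<Delta>. F \<subseteq> \<sigma> \<and> \<sigma> \<subseteq> insert v W - {v}} i"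
      by (rule acyclic_lower)
    moreover have "insert v W - {v} = W" using v by auto
    ultimately show ?thesis by simp
  qed
qed

text \<open>The star of v in W is the upper part over the restriction to W - {v}. Degree i needs the
  whole in degree i and the deletion in degree i - 1, whence the strict bound.\<close>

lemma vertex_star_acyclic:
  fixes \<Delta> :: "'v::{finite,linorder} set set"
  assumes \<Delta>: "simplicial_complex \<Delta>"
    and lin: "\<And>W j. q \<le> j \<Longrightarrow> acyclic_at TYPE('k::field) {\<sigma> \<in> \<Delta>. \<sigma> \<subseteq> W} j" and i: "q < i"
  shows "acyclic_at TYPE('k) {\<sigma> \<in> \<Delta>. {v} \<subseteq> \<sigma> \<and> \<sigma> \<subseteq> W} i"
proof -
  interpret cut_family "{\<sigma> \<in> \<Delta>. {} \<subseteq> \<sigma> \<and> \<sigma> \<subseteq> W}" "{\<sigma> \<in> \<Delta>. insert v {} \<subseteq> \<sigma> \<and> \<sigma> \<subseteq> W}"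
    "{\<sigma> \<in> \<Delta>. {} \<subseteq> \<sigma> \<and> \<sigma> \<subseteq> W - {v}}"
    by (rule cut_interval_family) (use \<Delta> in \<open>auto simp: simplicial_complex_def\<close>)
  show ?thesis by (rule acyclic_upper) (use lin[of i W] lin[of "i - 1" "W - {v}"] i in auto)
qed

text \<open>A cochain of degree below q - 1, its coboundary and its primitives meet only sets with
  fewer than q elements, so \<Delta> cannot be told apart from the full simplex, which is a
  cone.\<close>

lemma skeleton_acyclic:
  fixes \<Delta> :: "'v::{finite,linorder} set set"
  assumes skel: "\<And>F. card F < q \<Longrightarrow> F \<in> \<Delta>" and i: "i + 1 < int q"
  shows "acyclic_at TYPE('k::field) \<Delta> i"
proof (rule acyclic_atI)
  fix c :: "'v set \<Rightarrow> 'k" assume c: "c \<in> cochains \<Delta> i" "coboundary \<Delta> c = 0"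
  have cU: "c \<in> cochains UNIV i" using c(1) by (auto simp: cochains_def)
  have "coboundary UNIV c T = 0" for T
  proof (rule ccontr)
    assume nz: "coboundary UNIV c T \<noteq> 0"
    have "int (card T) = i + 1" using cochains_card[OF coboundary_cochains[OF cU] nz] .
    then have "T \<in> \<Delta>" using skel i by simp
    then have "coboundary UNIV c T = coboundary \<Delta> c T" by (simp add: coboundary_def)
    then show False using c(2) nz by simp
  qed
  then have "coboundary UNIV c = 0" by auto
  moreover have "acyclic_at TYPE('k) (UNIV :: 'v set set) i"
    by (rule acyclic_cone[where v = undefined]) simp
  ultimately obtain b :: "'v set \<Rightarrow> 'k" where b: "b \<in> cochains UNIV (i - 1)" "coboundary UNIV b = c"
    using acyclic_atD cU by metis
  have b\<Delta>: "b \<in> cochains \<Delta> (i - 1)"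
    using b(1) skel i by (auto simp: cochains_def)
  have "coboundary \<Delta> b = c"
  proof
    fix T
    show "coboundary \<Delta> b T = c T"
    proof (cases "T \<in> \<Delta>")
      case True
      then have "coboundary \<Delta> b T = coboundary UNIV b T" by (simp add: coboundary_def)
      then show ?thesis using b(2) by simp
    qed (simp add: coboundary_def cochains_zero[OF c(1)])
  qed
  then show "\<exists>b\<in>cochains \<Delta> (i - 1). coboundary \<Delta> b = c" using b\<Delta> by blast
qed

section \<open>The h-polynomial as a formal power series\<close>

unbundle fps_syntax

lemma one_minus_X_mult_nth: "((1 - fps_X) * f :: rat fps) $ k = f $ k - (if k = 0 then 0 else f $ (k - 1))"
  by (simp add: ring_distribs fps_sub_nth)

lemma one_minus_X_power_nth:
  shows "((1 - fps_X) ^ b :: rat fps) $ k \<in> \<int>"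
    and "b < k \<Longrightarrow> ((1 - fps_X) ^ b :: rat fps) $ k = 0"
    and "((1 - fps_X) ^ b :: rat fps) $ b = (-1) ^ b"
proof -
  have 1: "((1 - fps_X) ^ b :: rat fps) $ k \<in> \<int>" for k
  proof (induction b arbitrary: k)
    case (Suc b)
    then show ?case unfolding power_Suc one_minus_X_mult_nth by simp
  qed (simp add: fps_one_nth)
  have 2: "b < k \<Longrightarrow> ((1 - fps_X) ^ b :: rat fps) $ k = 0" for b k
  proof (induction b arbitrary: k)
    case (Suc b)
    then show ?case unfolding power_Suc one_minus_X_mult_nth by simp
  qed (simp add: fps_one_nth)
  have 3: "((1 - fps_X) ^ b :: rat fps) $ b = (-1) ^ b"
  proof (induction b)
    case (Suc b)
    then show ?case unfolding power_Suc one_minus_X_mult_nth using 2[of b "Suc b"] by simp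
  qed simp
  show "((1 - fps_X) ^ b :: rat fps) $ k \<in> \<int>" by (rule 1)
  show "b < k \<Longrightarrow> ((1 - fps_X) ^ b :: rat fps) $ k = 0" by (rule 2)
  show "((1 - fps_X) ^ b :: rat fps) $ b = (-1) ^ b" by (rule 3)
qed

text \<open>Leading coefficients multiply, and that of (1-X)^c is (-1)^c.\<close>

lemma mult_one_minus_X_power_top:
  fixes f :: "rat fps"
  assumes "\<And>i. r < i \<Longrightarrow> f $ i = 0"
  shows "(f * (1 - fps_X) ^ c) $ (c + r) = (-1) ^ c * f $ r"
proof -
  have "(\<forall>i>c + r. (f * (1 - fps_X) ^ c) $ i = 0) \<and> (f * (1 - fps_X) ^ c) $ (c + r) = (-1) ^ c * f $ r"
  proof (induction c)
    case 0
    then show ?case using assms by simp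
  next
    case (Suc c)
    have eq: "f * (1 - fps_X) ^ Suc c = (1 - fps_X) * (f * (1 - fps_X) ^ c)" by (simp add: mult_ac)
    show ?case unfolding eq one_minus_X_mult_nth using Suc by simp
  qed
  then show ?thesis by blast
qed

lemma sum_over_subsets:
  fixes x y :: "'a::comm_semiring_1"
  assumes "finite A"
  shows "(\<Sum>S\<in>Pow A. x ^ card S * y ^ card (A - S)) = (x + y) ^ card A"
  using prod_add[OF assms, of "\<lambda>_. x" "\<lambda>_. y"] by simp

text \<open>The left side of the identity that defines the h-vector, multiplied by (1-t)^d and
  summed face by face.\<close>

definition h_series :: "'v::finite set set \<Rightarrow> nat \<Rightarrow> rat fps" where
  "h_series \<Delta> d = (\<Sum>F\<in>\<Delta>. fps_X ^ card F * (1 - fps_X) ^ (d - card F))"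

text \<open>Since 1-X is a unit, the defining identity can be cleared of denominators; comparing
  coefficients then gives existence and uniqueness for the definite description.\<close>

lemma h_vector_eq_h_series:
  fixes \<Delta> :: "'v::finite set set"
  assumes d: "complex_dim \<Delta> = int d - 1"
  shows "of_int (h_vector \<Delta> p) = h_series \<Delta> d $ p"
proof -
  have le: "card F \<le> d" if "F \<in> \<Delta>" for F
  proof -
    have "face_dim F \<le> complex_dim \<Delta>" unfolding complex_dim_def using that by (intro Max_ge) auto
    then show ?thesis using d by (simp add: face_dim_def)
  qed
  let ?u = "(1 - fps_X) ^ d :: rat fps"
  have unit: "((1 - fps_X) ^ i :: rat fps) $ 0 \<noteq> 0" for i by (simp add: fps_power_zeroth)
  have coeff: "h_series \<Delta> d $ p \<in> \<int>" "d < p \<Longrightarrow> h_series \<Delta> d $ p = 0" for p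
  proof -
    have "(fps_X ^ card F * (1 - fps_X) ^ (d - card F) :: rat fps) $ p \<in> \<int>" for F :: "'v set"
      by (simp add: fps_X_power_mult_nth one_minus_X_power_nth)
    then show "h_series \<Delta> d $ p \<in> \<int>" unfolding h_series_def fps_sum_nth by (intro Ints_sum) blast
    assume "d < p"
    then show "h_series \<Delta> d $ p = 0" unfolding h_series_def fps_sum_nth
      using le by (intro sum.neutral) (auto simp: fps_X_power_mult_nth intro!: one_minus_X_power_nth diff_less_mono)
  qed
  have lhs: "(\<Sum>i\<le>d. of_nat (f_number \<Delta> (int i - 1)) * fps_X ^ i / (1 - fps_X) ^ i :: rat fps) * ?u = h_series \<Delta> d"
  proof -
    have "(\<Sum>i\<le>d. of_nat (f_number \<Delta> (int i - 1)) * fps_X ^ i / (1 - fps_X) ^ i :: rat fps) * ?u =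
        (\<Sum>i\<le>d. of_nat (f_number \<Delta> (int i - 1)) * (fps_X ^ i * (1 - fps_X) ^ (d - i)))"
      unfolding sum_distrib_right
    proof (rule sum.cong[OF refl])
      fix i assume "i \<in> {..d}"
      then have "?u = (1 - fps_X) ^ i * (1 - fps_X) ^ (d - i)" by (simp flip: power_add)
      then have "of_nat (f_number \<Delta> (int i - 1)) * fps_X ^ i / (1 - fps_X) ^ i * ?u =
          of_nat (f_number \<Delta> (int i - 1)) * fps_X ^ i * (inverse ((1 - fps_X) ^ i) * (1 - fps_X) ^ i) * (1 - fps_X) ^ (d - i)"
        by (simp only: fps_divide_unit[OF unit] mult_ac)
      also have "inverse ((1 - fps_X) ^ i) * (1 - fps_X) ^ i = (1 :: rat fps)" using unit by (rule inverse_mult_eq_1)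
      finally show "of_nat (f_number \<Delta> (int i - 1)) * fps_X ^ i / (1 - fps_X) ^ i * ?u =
          of_nat (f_number \<Delta> (int i - 1)) * (fps_X ^ i * (1 - fps_X) ^ (d - i))" by (simp only: mult_ac mult_1_right mult_1_left)
    qed
    also have "\<dots> = (\<Sum>i\<le>d. \<Sum>F\<in>{F \<in> \<Delta>. card F = i}. fps_X ^ card F * (1 - fps_X) ^ (d - card F))"
      by (intro sum.cong refl) (simp add: f_number_def face_dim_def)
    also have "\<dots> = h_series \<Delta> d"
      unfolding h_series_def by (rule sum.group) (use le in auto)
    finally show ?thesis .
  qed
  \<comment> \<open>The coefficients are rational by type but integral, so the floor recovers
    them.\<close>
  define hh :: "nat \<Rightarrow> int" where "hh p = (if p \<le> d then \<lfloor>h_series \<Delta> d $ p\<rfloor> else 0)" for p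
  have hh: "of_int (hh p) = h_series \<Delta> d $ p" for p
    using coeff[of p] by (auto simp: hh_def floor_of_int elim!: Ints_cases)
  have poly: "(\<Sum>i\<le>d. of_int (h i) * fps_X ^ i :: rat fps) $ p = (if p \<le> d then of_int (h p) else 0)" for h :: "nat \<Rightarrow> int" and p
  proof -
    have "(\<Sum>i\<le>d. of_int (h i) * fps_X ^ i :: rat fps) $ p = (\<Sum>i\<le>d. if i = p then of_int (h p) else 0)"
      unfolding fps_sum_nth by (intro sum.cong refl) (simp add: fps_X_power_nth flip: fps_of_int)
    then show ?thesis by simp
  qed
  have iff: "(\<Sum>i\<le>d. of_nat (f_number \<Delta> (int i - 1)) * fps_X ^ i / (1 - fps_X) ^ i)
         = (\<Sum>i\<le>d. of_int (h i) * fps_X ^ i) / (1 - fps_X :: rat fps) ^ d \<longleftrightarrow>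
       h_series \<Delta> d = (\<Sum>i\<le>d. of_int (h i) * fps_X ^ i)" for h :: "nat \<Rightarrow> int"
  proof -
    have *: "g / ?u * ?u = g" for g :: "rat fps"
      using unit[of d] by (simp add: fps_divide_unit inverse_mult_eq_1 mult.assoc)
    have "?u \<noteq> 0" using unit[of d] by auto
    then have cancel: "a = b \<longleftrightarrow> a * ?u = b * ?u" for a b :: "rat fps" by simp
    show ?thesis by (subst cancel) (simp only: lhs *)
  qed
  have "h_vector \<Delta> = hh"
    unfolding h_vector_def Let_def d
  proof (simp only: diff_add_cancel nat_int iff, rule the_equality)
    show "(\<forall>p>d. hh p = 0) \<and> h_series \<Delta> d = (\<Sum>i\<le>d. of_int (hh i) * fps_X ^ i)"
    proof
      show "\<forall>p>d. hh p = 0" unfolding hh_def by auto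
      show "h_series \<Delta> d = (\<Sum>i\<le>d. of_int (hh i) * fps_X ^ i)"
      proof (rule fps_ext)
        fix p
        show "h_series \<Delta> d $ p = (\<Sum>i\<le>d. of_int (hh i) * fps_X ^ i) $ p"
          unfolding poly hh using coeff(2)[of p] by auto
      qed
    qed
    fix h assume h: "(\<forall>p>d. h p = 0) \<and> h_series \<Delta> d = (\<Sum>i\<le>d. of_int (h i) * fps_X ^ i)"
    show "h = hh"
    proof
      fix p
      show "h p = hh p"
      proof (cases "p \<le> d")
        case True
        then have "of_int (h p) = (of_int (hh p) :: rat)" unfolding hh using h poly[of h p] by simp
        then show ?thesis by simp
      qed (use h in \<open>simp add: hh_def\<close>)
    qed
  qed
  then show ?thesis using hh by simp
qed

section \<open>Link polynomials, the derivative identity and the closed form of the h-vector\<close>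

section \<open>The h-vector\<close>

lemma card_add_card_Compl: "card F + card (- F) = CARD('v)" for F :: "'v::finite set"
  using card_Un_disjoint[of F "- F"] by simp

lemma one_minus_X_power_eq_sum:
  fixes A :: "'v::finite set"
  shows "(1 - fps_X :: rat fps) ^ card A = (\<Sum>S\<in>Pow A. (- fps_X) ^ card S)"
  using sum_over_subsets[of A "- fps_X :: rat fps" 1] by simp

text \<open>The h-polynomial of the link of v, taken with respect to dimension d - 2: the exponents
  are the cardinality of F - {v} and its complement to d - 1.\<close>

definition star_series :: "'v::finite set set \<Rightarrow> nat \<Rightarrow> 'v \<Rightarrow> rat fps" where
  "star_series \<Delta> d v = (\<Sum>F | F \<in> \<Delta> \<and> v \<in> F. fps_X ^ (card F - 1) * (1 - fps_X) ^ (d - card F))"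

text \<open>Expanding the power of 1-X over subsets S of the complement of F and putting W = F
  \<union> S indexes the terms by vertex sets containing F.\<close>

lemma star_term_nth:
  fixes F :: "'v::finite set"
  assumes "F \<noteq> {}"
  shows "(fps_X ^ (card F - 1) * (1 - fps_X) ^ card (- F) :: rat fps) $ j =
    (\<Sum>W | F \<subseteq> W \<and> card W = Suc j. (-1) ^ (Suc j + card F))"
proof -
  have pos: "0 < card F" using assms by (simp add: card_gt_0_iff)
  have "(fps_X ^ (card F - 1) * (1 - fps_X) ^ card (- F) :: rat fps) $ j =
      (\<Sum>S\<in>Pow (- F). (fps_X ^ (card F - 1) * (- fps_X) ^ card S :: rat fps) $ j)"
    by (simp add: one_minus_X_power_eq_sum sum_distrib_left fps_sum_nth)
  also have "\<dots> = (\<Sum>S\<in>Pow (- F). if card F + card S = Suc j then (-1) ^ card S else 0)"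
  proof (rule sum.cong[OF refl])
    fix S
    have "(- fps_X) ^ card S = (fps_const ((-1) ^ card S) * fps_X ^ card S :: rat fps)"
      by (cases "even (card S)") (simp_all flip: fps_const_neg)
    then have "fps_X ^ (card F - 1) * (- fps_X) ^ card S = (fps_const ((-1) ^ card S) * fps_X ^ (card F - 1 + card S) :: rat fps)"
      by (simp add: power_add mult_ac)
    then show "(fps_X ^ (card F - 1) * (- fps_X) ^ card S :: rat fps) $ j =
        (if card F + card S = Suc j then (-1) ^ card S else 0)"
      using pos by (simp add: fps_X_power_nth)
  qed
  also have "\<dots> = (\<Sum>S | S \<subseteq> - F \<and> card F + card S = Suc j. (-1) ^ card S)"
    by (simp add: sum.inter_filter[symmetric] Pow_def Collect_conj_eq)
  also have "\<dots> = (\<Sum>W | F \<subseteq> W \<and> card W = Suc j. (-1) ^ (Suc j + card F))"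
  proof (rule sum.reindex_bij_witness[of _ "\<lambda>W. W - F" "\<lambda>S. F \<union> S"])
    fix W assume W: "W \<in> {W. F \<subseteq> W \<and> card W = Suc j}"
    then have "card (W - F) = card W - card F" by (intro card_Diff_subset) auto
    moreover have "card F \<le> card W" using W by (intro card_mono) auto
    ultimately show "W - F \<in> {S. S \<subseteq> - F \<and> card F + card S = Suc j}" using W by auto
    show "F \<union> (W - F) = W" using W by auto
  next
    fix S assume S: "S \<in> {S. S \<subseteq> - F \<and> card F + card S = Suc j}"
    then have "card (F \<union> S) = card F + card S" by (intro card_Un_disjoint) auto
    then show "F \<union> S \<in> {W. F \<subseteq> W \<and> card W = Suc j}" using S by auto
    show "F \<union> S - F = S" using S by auto
    have "Suc j + card F = card S + 2 * card F" using S by simp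
    then show "(-1) ^ (Suc j + card F) = ((-1) ^ card S :: rat)" by (simp only: power_add power_mult) simp
  qed
  finally show ?thesis .
qed

text \<open>Multiplying by (1-X)^c replaces d - \<open>card F\<close> by \<open>card (- F)\<close>.
  Expanding over W and exchanging sums leaves, for each W, the Euler characteristic of the star of v
  in W: Hochster's formula at the level of Euler characteristics.\<close>

lemma star_series_mult_nth:
  fixes \<Delta> :: "'v::finite set set"
  assumes d: "\<And>F. F \<in> \<Delta> \<Longrightarrow> card F \<le> d" and n: "CARD('v) = d + c"
  shows "(star_series \<Delta> d v * (1 - fps_X) ^ c) $ j =
    (\<Sum>W | card W = Suc j. (-1) ^ Suc j * of_int (\<Sum>F\<in>{F \<in> \<Delta>. {v} \<subseteq> F \<and> F \<subseteq> W}. (-1) ^ card F))"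
proof -
  have eq: "star_series \<Delta> d v * (1 - fps_X) ^ c = (\<Sum>F | F \<in> \<Delta> \<and> v \<in> F. fps_X ^ (card F - 1) * (1 - fps_X) ^ card (- F))"
    unfolding star_series_def sum_distrib_right
  proof (rule sum.cong[OF refl])
    fix F assume "F \<in> {F. F \<in> \<Delta> \<and> v \<in> F}"
    then have "card (- F) = d - card F + c" using d[of F] n card_add_card_Compl[of F] by simp
    then show "fps_X ^ (card F - 1) * (1 - fps_X) ^ (d - card F) * (1 - fps_X) ^ c =
        (fps_X ^ (card F - 1) * (1 - fps_X) ^ card (- F) :: rat fps)"
      by (simp add: power_add mult.assoc)
  qed
  have "(star_series \<Delta> d v * (1 - fps_X) ^ c) $ j =
      (\<Sum>F | F \<in> \<Delta> \<and> v \<in> F. \<Sum>W | F \<subseteq> W \<and> card W = Suc j. (-1) ^ (Suc j + card F))"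
    unfolding eq fps_sum_nth by (rule sum.cong[OF refl], rule star_term_nth) auto
  also have "\<dots> = (\<Sum>W | card W = Suc j. \<Sum>F\<in>{F \<in> \<Delta>. {v} \<subseteq> F \<and> F \<subseteq> W}. (-1) ^ (Suc j + card F))"
    unfolding sum.Sigma[OF finite ballI[OF finite]]
    by (rule sum.reindex_bij_witness[of _ prod.swap prod.swap]) auto
  also have "\<dots> = (\<Sum>W | card W = Suc j. (-1) ^ Suc j * of_int (\<Sum>F\<in>{F \<in> \<Delta>. {v} \<subseteq> F \<and> F \<subseteq> W}. (-1) ^ card F))"
    by (simp only: power_add sum_distrib_left of_int_sum of_int_power of_int_minus of_int_1)
  finally show ?thesis .
qed

text \<open>The factor \<open>card F\<close> produced by differentiating the power of X counts the
  vertices of F; exchanging the sums over F and v gives the star series.\<close>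

lemma h_series_deriv:
  fixes \<Delta> :: "'v::finite set set"
  assumes d: "\<And>F. F \<in> \<Delta> \<Longrightarrow> card F \<le> d"
  shows "of_nat (Suc p) * h_series \<Delta> d $ Suc p + (of_nat d - of_nat p) * h_series \<Delta> d $ p =
    (\<Sum>v\<in>UNIV. star_series \<Delta> d v $ p)"
proof -
  have per_face: "(1 - fps_X) * fps_deriv (fps_X ^ a * (1 - fps_X) ^ b) + of_nat (a + b) * (fps_X ^ a * (1 - fps_X) ^ b) =
      (of_nat a * (fps_X ^ (a - 1) * (1 - fps_X) ^ b) :: rat fps)" for a b
  proof -
    \<comment> \<open>At a = 0 the truncated exponent a - 1 is harmless, because the factor
      \<open>of_nat a\<close> vanishes.\<close>
    have A: "fps_X * (of_nat a * fps_X ^ (a - 1)) = (of_nat a * fps_X ^ a :: rat fps)"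
      by (cases a) (simp_all add: mult_ac)
    have B: "(1 - fps_X) * (of_nat b * (1 - fps_X) ^ (b - 1)) = (of_nat b * (1 - fps_X) ^ b :: rat fps)"
      by (cases b) (simp_all add: mult_ac)
    have D: "fps_deriv (fps_X ^ a * (1 - fps_X) ^ b) =
        of_nat a * fps_X ^ (a - 1) * (1 - fps_X) ^ b - fps_X ^ a * (of_nat b * (1 - fps_X) ^ (b - 1) :: rat fps)"
      by (simp add: fps_deriv_power' algebra_simps)
    have eq: "(1 - fps_X) * fps_deriv (fps_X ^ a * (1 - fps_X) ^ b) =
        of_nat a * fps_X ^ (a - 1) * (1 - fps_X) ^ b - (fps_X * (of_nat a * fps_X ^ (a - 1))) * (1 - fps_X) ^ b
        - fps_X ^ a * ((1 - fps_X) * (of_nat b * (1 - fps_X) ^ (b - 1)) :: rat fps)"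
      unfolding D by (simp add: algebra_simps)
    show ?thesis unfolding eq A B by (simp add: algebra_simps)
  qed
  have "(1 - fps_X) * fps_deriv (h_series \<Delta> d) + of_nat d * h_series \<Delta> d =
      (\<Sum>F\<in>\<Delta>. of_nat (card F) * (fps_X ^ (card F - 1) * (1 - fps_X) ^ (d - card F)))"
    unfolding h_series_def fps_deriv_sum sum_distrib_left sum.distrib[symmetric]
  proof (rule sum.cong[OF refl])
    fix F assume "F \<in> \<Delta>"
    then have "d = card F + (d - card F)" using d by simp
    then show "(1 - fps_X) * fps_deriv (fps_X ^ card F * (1 - fps_X) ^ (d - card F)) +
        of_nat d * (fps_X ^ card F * (1 - fps_X) ^ (d - card F)) =
        (of_nat (card F) * (fps_X ^ (card F - 1) * (1 - fps_X) ^ (d - card F)) :: rat fps)"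
      using per_face[of "card F" "d - card F"] by simp
  qed
  also have "\<dots> = (\<Sum>F\<in>\<Delta>. \<Sum>v\<in>F. fps_X ^ (card F - 1) * (1 - fps_X) ^ (d - card F))" by simp
  also have "\<dots> = (\<Sum>v\<in>UNIV. star_series \<Delta> d v)"
    unfolding star_series_def sum.Sigma[OF finite ballI[OF finite]]
    by (rule sum.reindex_bij_witness[of _ prod.swap prod.swap]) auto
  finally have eq: "(1 - fps_X) * fps_deriv (h_series \<Delta> d) + of_nat d * h_series \<Delta> d = (\<Sum>v\<in>UNIV. star_series \<Delta> d v)" .
  have "((1 - fps_X) * fps_deriv (h_series \<Delta> d) + of_nat d * h_series \<Delta> d) $ p = (\<Sum>v\<in>UNIV. star_series \<Delta> d v $ p)"
    unfolding eq fps_sum_nth ..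
  moreover have "(of_nat d * h_series \<Delta> d) $ p = of_nat d * h_series \<Delta> d $ p"
    by (simp flip: fps_of_nat)
  ultimately show ?thesis
    unfolding fps_add_nth one_minus_X_mult_nth by (cases p) (simp_all add: algebra_simps)
qed

text \<open>Summed over all subsets of the vertex set the terms give 1 by the binomial theorem, and
  nonfaces have at least q elements. So the product with (1-X)^c agrees with 1 below degree q, where
  the coefficients are therefore those of (1-X)^(-c).\<close>

lemma h_series_low:
  fixes \<Delta> :: "'v::finite set set"
  assumes d: "\<And>F. F \<in> \<Delta> \<Longrightarrow> card F \<le> d" and n: "CARD('v) = d + c" and c: "0 < c"
    and skel: "\<And>F. card F < q \<Longrightarrow> F \<in> \<Delta>" and p: "p < q"
  shows "h_series \<Delta> d $ p = of_nat ((c + p - 1) choose p)"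
proof -
  define N :: "rat fps" where "N = (\<Sum>F\<in>- \<Delta>. fps_X ^ card F * (1 - fps_X) ^ card (- F))"
  let ?u = "(1 - fps_X) ^ c :: rat fps"
  have "h_series \<Delta> d * ?u = (\<Sum>F\<in>\<Delta>. fps_X ^ card F * (1 - fps_X) ^ card (- F))"
    unfolding h_series_def sum_distrib_right
  proof (rule sum.cong[OF refl])
    fix F assume "F \<in> \<Delta>"
    then have "card (- F) = d - card F + c" using d[of F] n card_add_card_Compl[of F] by simp
    then show "fps_X ^ card F * (1 - fps_X) ^ (d - card F) * ?u = fps_X ^ card F * (1 - fps_X) ^ card (- F)"
      by (simp add: power_add mult.assoc)
  qed
  also have "\<dots> = (\<Sum>F\<in>(UNIV :: 'v set set). fps_X ^ card F * (1 - fps_X) ^ card (- F)) - N"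
  proof -
    have "(\<Sum>F\<in>(UNIV :: 'v set set). fps_X ^ card F * (1 - fps_X) ^ card (- F) :: rat fps) = (\<Sum>F\<in>(UNIV :: 'v set set) - \<Delta>. fps_X ^ card F * (1 - fps_X) ^ card (- F))
        + (\<Sum>F\<in>\<Delta>. fps_X ^ card F * (1 - fps_X) ^ card (- F))" by (rule sum.subset_diff) auto
    then show ?thesis unfolding N_def Compl_eq_Diff_UNIV by simp
  qed
  also have "(\<Sum>F\<in>(UNIV :: 'v set set). fps_X ^ card F * (1 - fps_X) ^ card (- F)) = (1 :: rat fps)"
    using sum_over_subsets[of "UNIV :: 'v set" "fps_X :: rat fps" "1 - fps_X"] by (simp add: Compl_eq_Diff_UNIV)
  finally have eq: "h_series \<Delta> d * ?u = 1 - N" .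
  have u: "?u $ 0 \<noteq> 0" by (simp add: fps_power_zeroth)
  have "h_series \<Delta> d = h_series \<Delta> d * ?u * inverse ?u"
    using inverse_mult_eq_1[OF u] by (simp add: mult.assoc mult.commute[of ?u])
  also have "\<dots> = inverse ?u - N * inverse ?u" unfolding eq by (simp add: left_diff_distrib)
  finally have h: "h_series \<Delta> d $ p = inverse ?u $ p - (N * inverse ?u) $ p" by (metis fps_sub_nth)
  have Ni: "N $ i = 0" if "i < q" for i
    unfolding N_def fps_sum_nth
  proof (rule sum.neutral, intro ballI)
    fix F assume "F \<in> - \<Delta>"
    then have "q \<le> card F" using skel by (metis ComplD not_le)
    then show "(fps_X ^ card F * (1 - fps_X) ^ card (- F) :: rat fps) $ i = 0" using that by (simp add: fps_X_power_mult_nth)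
  qed
  have "(N * inverse ?u) $ p = 0"
    unfolding fps_mult_nth using Ni p by (intro sum.neutral) auto
  moreover have "inverse ?u = Abs_fps (\<lambda>k. of_nat ((c + k - 1) choose k) * 1 ^ k)"
    using one_minus_const_fps_X_neg_power'[OF c, of "1::rat"] by simp
  ultimately show ?thesis using h by simp
qed

text \<open>The coefficient of X^d in the summand of F is (-1)^(d - card F).\<close>

lemma h_series_top:
  fixes \<Delta> :: "'v::finite set set"
  assumes d: "\<And>F. F \<in> \<Delta> \<Longrightarrow> card F \<le> d"
  shows "h_series \<Delta> d $ d = (-1) ^ d * of_int (\<Sum>F\<in>\<Delta>. (-1) ^ card F)"
proof -
  have "(fps_X ^ card F * (1 - fps_X) ^ (d - card F) :: rat fps) $ d = (-1) ^ d * (-1) ^ card F" if F: "F \<in> \<Delta>" for F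
  proof -
    obtain k where k: "d = card F + k" using d[OF F] le_Suc_ex by blast
    have "(-1) ^ k = (-1 :: rat) ^ k * ((-1) ^ card F * (-1) ^ card F)" by (simp flip: power_add)
    then have "(-1) ^ (d - card F) = (-1 :: rat) ^ d * (-1) ^ card F" unfolding k by (simp add: power_add mult_ac)
    then show ?thesis using d[OF F] by (simp add: fps_X_power_mult_nth one_minus_X_power_nth(3))
  qed
  then show ?thesis unfolding h_series_def fps_sum_nth by (simp add: sum_distrib_left)
qed

text \<open>The combinatorial core, with the linear resolution replaced by its two consequences
  \<open>skel\<close> and \<open>lin\<close>.\<close>

theorem h_vector_buchsbaum_linear:
  fixes \<Delta> :: "'v::{finite,linorder} set set"
  assumes \<Delta>: "simplicial_complex \<Delta>" and B: "buchsbaum TYPE('k::field) \<Delta>"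
    and dim: "complex_dim \<Delta> = int d - 1" and n: "CARD('v) = d + c" and c: "1 \<le> c" and q: "2 \<le> q" "q \<le> d"
    and skel: "\<And>F. card F < q \<Longrightarrow> F \<in> \<Delta>"
    and lin: "\<And>W j. int q \<le> j \<Longrightarrow> acyclic_at TYPE('k) {F \<in> \<Delta>. F \<subseteq> W} j"
  obtains h where "cohomology_dim TYPE('k) \<Delta> (int q - 1) = enat h"
    and "\<And>p. p < q \<Longrightarrow> h_vector \<Delta> p = int ((c + p - 1) choose p)"
    and "\<And>p. q \<le> p \<Longrightarrow> p \<le> d \<Longrightarrow> h_vector \<Delta> p = (-1) ^ (p - q + 1) * int (d choose p) * int h"
    and "(d choose (q - 1)) * h \<le> (c + q - 2) choose (q - 1)"
proof -
  have le: "card F \<le> d" if "F \<in> \<Delta>" for F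
  proof -
    have "face_dim F \<le> complex_dim \<Delta>" unfolding complex_dim_def using that by (intro Max_ge) auto
    then show ?thesis using dim by (simp add: face_dim_def)
  qed
  have down: "\<And>F G. F \<in> \<Delta> \<Longrightarrow> G \<subseteq> F \<Longrightarrow> G \<in> \<Delta>" using \<Delta> by (simp add: simplicial_complex_def)
  note hs = h_vector_eq_h_series[OF dim]
  define \<chi> where "\<chi> v W = (\<Sum>F\<in>{F \<in> \<Delta>. {v} \<subseteq> F \<and> F \<subseteq> W}. (-1::int) ^ card F)" for v W
  \<comment> \<open>The complement of W has d + c - \<open>card W\<close> elements, so deletion
    reaches degree \<open>card W\<close> - c - 1, which is at least q - 1, and at least q once
    \<open>card W\<close> > c + q. Degrees above q come from \<open>lin\<close>.\<close>
  have acyc: "acyclic_at TYPE('k) {F \<in> \<Delta>. {v} \<subseteq> F \<and> F \<subseteq> W} (int i)"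
    if i: "card W \<ge> c + q" "i \<noteq> q \<or> card W > c + q" for v W i
  proof (cases "q < i")
    case True
    then show ?thesis by (intro vertex_star_acyclic[OF \<Delta> lin, of "int q"]) auto
  next
    case False
    have "card W + card (- W) = d + c" using n card_Un_disjoint[of W "- W"] by simp
    then have "int i \<le> complex_dim \<Delta> - int (card (- W))" using i False dim by linarith
    then show ?thesis by (intro buchsbaum_deletion_acyclic[OF \<Delta> B]) auto
  qed
  have euler: "\<exists>h. \<chi> v W = (-1) ^ m * int h"
    if "\<And>i. i \<noteq> m \<Longrightarrow> acyclic_at TYPE('k) {F \<in> \<Delta>. {v} \<subseteq> F \<and> F \<subseteq> W} (int i)" for m v W
  proof (rule euler_characteristic[OF convex_interval_family[OF down] that])
    fix h assume "(\<Sum>F\<in>{F \<in> \<Delta>. {v} \<subseteq> F \<and> F \<subseteq> W}. (-1) ^ card F) = (-1) ^ m * int h"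
    then show ?thesis unfolding \<chi>_def by blast
  qed
  \<comment> \<open>A star acyclic in all degrees allows any exceptional degree; m = 0 and m = 1
    give opposite signs, so the value is 0.\<close>
  have \<chi>0: "\<chi> v W = 0" if W: "card W > c + q" for v W
  proof -
    have "acyclic_at TYPE('k) {F \<in> \<Delta>. {v} \<subseteq> F \<and> F \<subseteq> W} (int i)" for i using acyc[of W i v] W by simp
    then obtain h0 h1 where "\<chi> v W = (-1) ^ 0 * int h0" "\<chi> v W = (-1) ^ 1 * int h1"
      using euler[of 0 v W] euler[of 1 v W] by blast
    then show ?thesis by simp
  qed
  have \<chi>q: "0 \<le> (-1) ^ q * \<chi> v W" if W: "card W = c + q" for v W
  proof -
    have "acyclic_at TYPE('k) {F \<in> \<Delta>. {v} \<subseteq> F \<and> F \<subseteq> W} (int i)" if "i \<noteq> q" for i using acyc[of W i v] W that by simp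
    then obtain h where "\<chi> v W = (-1) ^ q * int h" using euler[of q v W] by blast
    then show ?thesis by (simp flip: power_add mult.assoc)
  qed
  have M: "(star_series \<Delta> d v * (1 - fps_X) ^ c) $ j = (\<Sum>W | card W = Suc j. (-1) ^ Suc j * of_int (\<chi> v W))" for v j
    unfolding \<chi>_def by (rule star_series_mult_nth[OF le n])
  \<comment> \<open>A leading coefficient in degree r \<ge> q would be, up to sign, a sum over sets
    W with c + r + 1 > c + q elements, where \<chi> vanishes.\<close>
  have star0: "star_series \<Delta> d v $ p = 0" if p: "q \<le> p" for v p
  proof (rule ccontr)
    assume nz: "star_series \<Delta> d v $ p \<noteq> 0"
    define S where "S = {p. star_series \<Delta> d v $ p \<noteq> 0}"
    have "star_series \<Delta> d v $ r = 0" if "d < r" for r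
      unfolding star_series_def fps_sum_nth
    proof (intro sum.neutral ballI)
      fix F assume F: "F \<in> {F. F \<in> \<Delta> \<and> v \<in> F}"
      then have "0 < card F" by (auto simp: card_gt_0_iff)
      then have "d - card F < r - (card F - 1)" using le[of F] F that by auto
      then show "(fps_X ^ (card F - 1) * (1 - fps_X) ^ (d - card F) :: rat fps) $ r = 0"
        by (simp add: fps_X_power_mult_nth one_minus_X_power_nth(2))
    qed
    then have "S \<subseteq> {..d}" unfolding S_def by (force simp: not_le[symmetric])
    then have S: "finite S" "p \<in> S" using nz by (auto simp: S_def finite_subset)
    define r where "r = Max S"
    have r: "r \<in> S" "p \<le> r" unfolding r_def using S by (auto intro: Max_in Max_ge)
    have above: "star_series \<Delta> d v $ i = 0" if "r < i" for i
    proof (rule ccontr)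
      assume "star_series \<Delta> d v $ i \<noteq> 0"
      then have "i \<le> r" unfolding r_def by (intro Max_ge[OF S(1)]) (simp add: S_def)
      with that show False by simp
    qed
    have "(-1) ^ c * star_series \<Delta> d v $ r = (\<Sum>W | card W = Suc (c + r). (-1) ^ Suc (c + r) * of_int (\<chi> v W))"
      unfolding M[symmetric] by (rule mult_one_minus_X_power_top[OF above, symmetric])
    also have "\<dots> = 0" using \<chi>0 p r(2) by (intro sum.neutral) auto
    finally show False using r(1) by (simp add: S_def)
  qed
  \<comment> \<open>In degree q - 1 the sets W have exactly c + q elements. The signs (-1)^c on both
    sides cancel, and the remaining (-1)^q is the one in \<open>\<chi>q\<close>.\<close>
  have starq: "0 \<le> star_series \<Delta> d v $ (q - 1)" for v
  proof -
    have "(-1) ^ c * star_series \<Delta> d v $ (q - 1) = (\<Sum>W | card W = Suc (c + (q - 1)). (-1) ^ Suc (c + (q - 1)) * of_int (\<chi> v W))"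
      unfolding M[symmetric] by (rule mult_one_minus_X_power_top[symmetric]) (use star0 q in auto)
    moreover have "Suc (c + (q - 1)) = c + q" using q by simp
    ultimately have "(-1) ^ c * star_series \<Delta> d v $ (q - 1) = (-1) ^ c * of_int (\<Sum>W | card W = c + q. (-1) ^ q * \<chi> v W)"
      by (simp add: power_add sum_distrib_left mult.assoc)
    then have "star_series \<Delta> d v $ (q - 1) = of_int (\<Sum>W | card W = c + q. (-1) ^ q * \<chi> v W)" by simp
    also have "\<dots> \<ge> 0" unfolding of_int_0_le_iff using \<chi>q by (intro sum_nonneg) auto
    finally show ?thesis .
  qed
  \<comment> \<open>Below degree q - 1 the complete skeleton suffices, from q on linearity with W =
    UNIV; only degree q - 1 can carry cohomology.\<close>
  have acyc_all: "acyclic_at TYPE('k) \<Delta> (int i)" if "i \<noteq> q - 1" for i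
  proof (cases "i < q - 1")
    case True
    then show ?thesis by (intro skeleton_acyclic[OF skel]) auto
  next
    case False
    then have "int q \<le> int i" using that by linarith
    then show ?thesis using lin[of "int i" UNIV] by simp
  qed
  have convex: "convex_family \<Delta>" unfolding convex_family_def using down by blast
  obtain h where h: "cohomology_dim TYPE('k) \<Delta> (int (q - 1)) = enat h"
    "(\<Sum>F\<in>\<Delta>. (-1) ^ card F) = (-1) ^ (q - 1) * int h"
    by (rule euler_characteristic[OF convex acyc_all])
  have low: "h_vector \<Delta> p = int ((c + p - 1) choose p)" if "p < q" for p
  proof -
    have "of_int (h_vector \<Delta> p) = (of_int (int ((c + p - 1) choose p)) :: rat)"
      unfolding hs using h_series_low[OF le n _ skel that] c by simp
    then show ?thesis by (simp only: of_int_eq_iff)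
  qed
  have rec: "int (Suc p) * h_vector \<Delta> (Suc p) + (int d - int p) * h_vector \<Delta> p = 0" if "q \<le> p" for p
  proof -
    have "(of_int (int (Suc p) * h_vector \<Delta> (Suc p) + (int d - int p) * h_vector \<Delta> p) :: rat) = 0"
      using h_series_deriv[OF le, where p = p] star0[OF that] by (simp add: hs)
    then show ?thesis by (simp only: of_int_eq_0_iff)
  qed
  have top: "h_vector \<Delta> d = (-1) ^ (d - q + 1) * int h"
  proof -
    have ht: "h_series \<Delta> d $ d = (-1) ^ d * of_int (\<Sum>F\<in>\<Delta>. (-1) ^ card F)"
      using le by (rule h_series_top)
    have "of_int (h_vector \<Delta> d) = (of_int ((-1) ^ d * ((-1) ^ (q - 1) * int h)) :: rat)"
      unfolding hs ht h(2) by simp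
    then have "h_vector \<Delta> d = (-1) ^ d * ((-1) ^ (q - 1) * int h)" by (simp only: of_int_eq_iff)
    moreover have "d + (q - 1) = (d - q + 1) + 2 * (q - 1)" using q by simp
    then have "(-1 :: int) ^ d * (-1) ^ (q - 1) = (-1) ^ (d - q + 1)"
      unfolding power_add[symmetric] by (simp only: power_add power_mult) simp
    ultimately show ?thesis by (simp add: mult.assoc[symmetric])
  qed
  \<comment> \<open>The recursion starts at p = d, where the value is h up to sign, and runs
    downwards; p < d makes the factor d - p cancellable.\<close>
  have high: "h_vector \<Delta> p = (-1) ^ (p - q + 1) * int (d choose p) * int h" if "q \<le> p" "p \<le> d" for p
    using that(2,1)
  proof (induction rule: inc_induct)
    case base
    then show ?case using top by simp
  next
    case (step p)
    have e: "Suc p - q + 1 = Suc (p - q + 1)" using step by simp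
    have IH: "h_vector \<Delta> (Suc p) = - ((-1) ^ (p - q + 1) * int (d choose Suc p) * int h)"
      using step unfolding e by simp
    have "(d - p) * (d choose p) = Suc p * (d choose Suc p)"
      using step binomial_absorb_comp[of d p] binomial_absorption[of p d] by (metis Suc_times_binomial_eq add_diff_cancel_right' binomial_absorption)
    then have b: "int (Suc p) * int (d choose Suc p) = (int d - int p) * int (d choose p)"
      using step by (metis less_imp_le_nat of_nat_diff of_nat_mult)
    have "(int d - int p) * h_vector \<Delta> p = - (int (Suc p) * h_vector \<Delta> (Suc p))"
      using rec[of p] step by linarith
    also have "\<dots> = (-1) ^ (p - q + 1) * (int (Suc p) * int (d choose Suc p)) * int h" unfolding IH by (simp add: mult_ac)
    also have "\<dots> = (int d - int p) * ((-1) ^ (p - q + 1) * int (d choose p) * int h)" unfolding b by (simp add: mult_ac)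
    finally have eq: "(int d - int p) * h_vector \<Delta> p =
        (int d - int p) * ((-1) ^ (p - q + 1) * int (d choose p) * int h)" .
    have "int d - int p \<noteq> 0" using step by simp
    then show ?case by (rule mult_left_cancel[THEN iffD1, OF _ eq])
  qed
  \<comment> \<open>The derivative identity in degree q - 1 equates a combination of h_q and h_(q-1)
    with a nonnegative number. Rewriting q (d choose q) as (d - q + 1) (d choose (q - 1)) brings out
    the positive factor d - q + 1, which is cancelled.\<close>
  have bound: "(d choose (q - 1)) * h \<le> (c + q - 2) choose (q - 1)"
  proof -
    have "(of_int (int q * h_vector \<Delta> q + (int d - int (q - 1)) * h_vector \<Delta> (q - 1)) :: rat) = (\<Sum>v\<in>UNIV. star_series \<Delta> d v $ (q - 1))"
      using h_series_deriv[OF le, where p = "q - 1"] q by (simp add: hs)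
    also have "\<dots> \<ge> 0" using starq by (intro sum_nonneg) auto
    finally have "0 \<le> int q * h_vector \<Delta> q + (int d - int (q - 1)) * h_vector \<Delta> (q - 1)" by (simp only: of_int_0_le_iff)
    moreover have "h_vector \<Delta> q = - (int (d choose q) * int h)" using high[of q] q by simp
    moreover have "h_vector \<Delta> (q - 1) = int ((c + q - 2) choose (q - 1))" using low[of "q - 1"] q by (simp add: numeral_2_eq_2)
    moreover have "int q * int (d choose q) = (int d - int (q - 1)) * int (d choose (q - 1))"
    proof -
      obtain p where p: "q = Suc p" using q by (cases q) auto
      have "(d - p) * (d choose p) = Suc p * (d choose Suc p)"
        using binomial_absorb_comp[of d p] binomial_absorption[of p d] by (metis Suc_times_binomial_eq add_diff_cancel_right' binomial_absorption)
      then show ?thesis using q unfolding p by (metis Suc_leD diff_Suc_1 of_nat_diff of_nat_mult)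
    qed
    ultimately have "0 \<le> (int d - int (q - 1)) * (int ((c + q - 2) choose (q - 1)) - int (d choose (q - 1)) * int h)"
      by (simp add: algebra_simps)
    moreover have "0 < int d - int (q - 1)" using q by simp
    ultimately have "0 \<le> int ((c + q - 2) choose (q - 1)) - int (d choose (q - 1)) * int h"
      using zero_le_mult_iff[of "int d - int (q - 1)"] by simp
    then have "int ((d choose (q - 1)) * h) \<le> int ((c + q - 2) choose (q - 1))" by simp
    then show ?thesis by (simp only: of_nat_le_iff)
  qed
  have "int (q - 1) = int q - 1" using q by simp
  then show thesis using that[OF _ low high bound] h(1) by simp
qed

lemma complex_dim_eq:
  fixes \<Delta> :: "'v::finite set set"
  assumes "{} \<in> \<Delta>"
  shows "complex_dim \<Delta> = int (Max (card ` \<Delta>)) - 1"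
  unfolding complex_dim_def
proof (rule Max_eqI)
  fix y assume "y \<in> face_dim ` \<Delta>"
  then obtain F where F: "F \<in> \<Delta>" "y = face_dim F" by blast
  have "card F \<le> Max (card ` \<Delta>)" using F(1) by (intro Max_ge) auto
  then show "y \<le> int (Max (card ` \<Delta>)) - 1" by (simp add: F(2) face_dim_def)
next
  have "Max (card ` \<Delta>) \<in> card ` \<Delta>" using assms by (intro Max_in) auto
  then obtain F where "F \<in> \<Delta>" "Max (card ` \<Delta>) = card F" by blast
  then show "int (Max (card ` \<Delta>)) - 1 \<in> face_dim ` \<Delta>" by (auto simp: face_dim_def)
qed simp

text \<open>Multiplying binomials by \<open>fact m\<close> yields the falling and, in
  \<open>prod_rising\<close>, the rising product of the stated bound; the factorial cancels in the
  quotient.\<close>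

lemma prod_falling: "(\<Prod>i<m. d - i) = fact m * (d choose m)" for d m :: nat
proof (induction m)
  case (Suc m)
  have "(\<Prod>i<Suc m. d - i) = fact m * ((d - m) * (d choose m))"
    using Suc by (simp add: mult_ac)
  also have "(d - m) * (d choose m) = Suc m * (d choose Suc m)"
    by (metis Suc_times_binomial_eq add_diff_cancel_right' binomial_absorb_comp binomial_absorption)
  finally show ?case by (simp only: fact_Suc of_nat_id mult_ac)
qed simp

lemma prod_rising: "0 < c \<Longrightarrow> (\<Prod>i<m. c + i) = fact m * ((c + m - 1) choose m)" for c m :: nat
proof (induction m)
  case (Suc m)
  then obtain n where n: "c + m = Suc n" by (cases "c + m") auto
  have "(\<Prod>i<Suc m. c + i) = fact m * ((c + m) * ((c + m - 1) choose m))"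
    using Suc by (simp add: mult_ac)
  also have "(c + m) * ((c + m - 1) choose m) = Suc m * ((c + Suc m - 1) choose Suc m)"
    using Suc_times_binomial_eq[of n m] n by (simp add: mult.commute)
  finally show ?case by (simp only: fact_Suc of_nat_id mult_ac)
qed simp

unbundle no fps_syntax

section \<open>Monomial criteria for the Stanley-Reisner ideal and its localizations\<close>

section \<open>Stanley--Reisner ideals and their localizations\<close>

lemma poly_mapping_expansion:
  "f = (\<Sum>u\<in>Poly_Mapping.keys f. Poly_Mapping.single u (Poly_Mapping.lookup f u))"
proof (rule poly_mapping_eqI)
  fix k
  have "Poly_Mapping.lookup (\<Sum>u\<in>Poly_Mapping.keys f. Poly_Mapping.single u (Poly_Mapping.lookup f u)) k
      = (\<Sum>u\<in>Poly_Mapping.keys f. if u = k then Poly_Mapping.lookup f u else 0)"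
    by (simp add: lookup_sum lookup_single when_def)
  then show "Poly_Mapping.lookup f k =
      Poly_Mapping.lookup (\<Sum>u\<in>Poly_Mapping.keys f. Poly_Mapping.single u (Poly_Mapping.lookup f u)) k"
    by (simp add: in_keys_iff)
qed

lemma lookup_single_times:
  fixes f :: "'a::cancel_comm_monoid_add \<Rightarrow>\<^sub>0 'b::comm_ring_1"
  shows "Poly_Mapping.lookup (Poly_Mapping.single s c * f) (s + u) = c * Poly_Mapping.lookup f u"
    and "(\<And>u. t \<noteq> s + u) \<Longrightarrow> Poly_Mapping.lookup (Poly_Mapping.single s c * f) t = 0"
proof -
  have eq: "Poly_Mapping.single s c * f =
      (\<Sum>u\<in>Poly_Mapping.keys f. Poly_Mapping.single (s + u) (c * Poly_Mapping.lookup f u))"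
    by (subst (1) poly_mapping_expansion[of f]) (simp add: sum_distrib_left mult_single)
  have "Poly_Mapping.lookup (Poly_Mapping.single s c * f) (s + u) =
     (\<Sum>w\<in>Poly_Mapping.keys f. if w = u then c * Poly_Mapping.lookup f u else 0)"
    unfolding eq lookup_sum lookup_single by (rule sum.cong) (auto simp: when_def)
  then show "Poly_Mapping.lookup (Poly_Mapping.single s c * f) (s + u) = c * Poly_Mapping.lookup f u"
    by (simp add: in_keys_iff)
  assume "\<And>u. t \<noteq> s + u"
  then show "Poly_Mapping.lookup (Poly_Mapping.single s c * f) t = 0"
    unfolding eq lookup_sum lookup_single by (intro sum.neutral) (metis when_def)
qed

lemma lookup_scalar_times:
  fixes f :: "'a::cancel_comm_monoid_add \<Rightarrow>\<^sub>0 'b::comm_ring_1"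
  shows "Poly_Mapping.lookup (Poly_Mapping.single 0 c * f) u = c * Poly_Mapping.lookup f u"
  using lookup_single_times(1)[of 0 c f u] by simp

lemma lookup_sign_times:
  fixes f :: "'a::cancel_comm_monoid_add \<Rightarrow>\<^sub>0 'b::comm_ring_1"
  shows "Poly_Mapping.lookup ((-1) ^ n * f) u = (-1) ^ n * Poly_Mapping.lookup f u"
  by (cases "even n") simp_all

lemma keys_plus_nat: "Poly_Mapping.keys (s + t :: 'v \<Rightarrow>\<^sub>0 nat) = Poly_Mapping.keys s \<union> Poly_Mapping.keys t"
  by (auto simp: in_keys_iff lookup_add)

definition indicator_exp :: "'v set \<Rightarrow> 'v \<Rightarrow>\<^sub>0 nat" where
  "indicator_exp F = (\<Sum>v\<in>F. Poly_Mapping.single v 1)"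

lemma lookup_indicator_exp:
  fixes F :: "'v::finite set"
  shows "Poly_Mapping.lookup (indicator_exp F) v = (if v \<in> F then 1 else 0)"
  by (simp add: indicator_exp_def lookup_sum lookup_single when_def)

lemma keys_indicator_exp [simp]:
  fixes F :: "'v::finite set"
  shows "Poly_Mapping.keys (indicator_exp F) = F"
  by (auto simp: in_keys_iff lookup_indicator_exp split: if_splits)

lemma squarefree_monomial_eq: "squarefree_monomial F = Poly_Mapping.single (indicator_exp F) 1"
  by (simp add: squarefree_monomial_def indicator_exp_def)

interpretation ring_module: module "(*) :: 'a::comm_ring_1 \<Rightarrow> 'a \<Rightarrow> 'a"
  by standard (auto simp: algebra_simps)

lemma keys_times_subset:
  fixes f g :: "'a::cancel_comm_monoid_add \<Rightarrow>\<^sub>0 'b::comm_ring_1"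
  assumes "t \<in> Poly_Mapping.keys (f * g)"
  obtains s u where "s \<in> Poly_Mapping.keys f" "u \<in> Poly_Mapping.keys g" "t = s + u"
  using keys_mult[of f g] assms by blast

text \<open>Supports grow under multiplication and nonfaces are closed under supersets, so the
  condition defines an ideal. Conversely every monomial is a multiple of the squarefree monomial of
  its support.\<close>

lemma stanley_reisner_ideal_iff:
  fixes \<Delta> :: "'v::finite set set" and f :: "('v, 'k::field) mpoly"
  assumes "simplicial_complex \<Delta>"
  shows "f \<in> stanley_reisner_ideal \<Delta> \<longleftrightarrow> (\<forall>t\<in>Poly_Mapping.keys f. Poly_Mapping.keys t \<notin> \<Delta>)"
proof
  let ?J = "{f :: ('v, 'k) mpoly. \<forall>t\<in>Poly_Mapping.keys f. Poly_Mapping.keys t \<notin> \<Delta>}"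
  have "ring_module.span {squarefree_monomial F | F. F \<notin> \<Delta>} \<subseteq> ?J"
  proof (rule ring_module.span_minimal)
    show "{squarefree_monomial F | F. F \<notin> \<Delta>} \<subseteq> ?J" by (auto simp: squarefree_monomial_eq)
    show "ring_module.subspace ?J"
    proof (rule ring_module.subspaceI)
      fix c x :: "('v, 'k) mpoly" assume x: "x \<in> ?J"
      show "c * x \<in> ?J"
      proof (intro CollectI ballI)
        fix t assume "t \<in> Poly_Mapping.keys (c * x)"
        then obtain s u where t: "s \<in> Poly_Mapping.keys c" "u \<in> Poly_Mapping.keys x" "t = s + u"
          by (rule keys_times_subset)
        then show "Poly_Mapping.keys t \<notin> \<Delta>" using x assms
          unfolding simplicial_complex_def by (auto simp: keys_plus_nat)
      qed
    qed (use keys_add in \<open>fastforce+\<close>)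
  qed
  then show "f \<in> stanley_reisner_ideal \<Delta> \<Longrightarrow> \<forall>t\<in>Poly_Mapping.keys f. Poly_Mapping.keys t \<notin> \<Delta>"
    by (auto simp: stanley_reisner_ideal_def)
next
  assume f: "\<forall>t\<in>Poly_Mapping.keys f. Poly_Mapping.keys t \<notin> \<Delta>"
  have "(\<Sum>u\<in>Poly_Mapping.keys f. Poly_Mapping.single u (Poly_Mapping.lookup f u)) \<in> stanley_reisner_ideal \<Delta>"
    unfolding stanley_reisner_ideal_def
  proof (rule ring_module.span_sum)
    fix u assume u: "u \<in> Poly_Mapping.keys f"
    \<comment> \<open>The truncated difference is exact: every vertex in the support has exponent at
      least 1.\<close>
    define r where "r = u - indicator_exp (Poly_Mapping.keys u)"
    have "r + indicator_exp (Poly_Mapping.keys u) = u"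
      by (rule poly_mapping_eqI)
        (auto simp: r_def lookup_add lookup_minus lookup_indicator_exp in_keys_iff)
    then have eq: "Poly_Mapping.single u (Poly_Mapping.lookup f u) =
        Poly_Mapping.single r (Poly_Mapping.lookup f u) * squarefree_monomial (Poly_Mapping.keys u)"
      by (simp add: squarefree_monomial_eq mult_single)
    show "Poly_Mapping.single u (Poly_Mapping.lookup f u) \<in> ring_module.span {squarefree_monomial F | F. F \<notin> \<Delta>}"
      unfolding eq using f u by (intro ring_module.span_scale ring_module.span_base) auto
  qed
  then show "f \<in> stanley_reisner_ideal \<Delta>" using poly_mapping_expansion[of f] by simp
qed

definition negative_part :: "('v \<Rightarrow>\<^sub>0 int) \<Rightarrow> 'v set" where
  "negative_part \<alpha> = {v. Poly_Mapping.lookup \<alpha> v < 0}"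

definition positive_part :: "('v \<Rightarrow>\<^sub>0 int) \<Rightarrow> 'v set" where
  "positive_part \<alpha> = {v. 0 < Poly_Mapping.lookup \<alpha> v}"

lemma lookup_map_int: "Poly_Mapping.lookup (Poly_Mapping.map int t) v = int (Poly_Mapping.lookup t v)"
  by (simp add: Poly_Mapping.map.rep_eq when_def)

lemma inj_map_int: "inj (Poly_Mapping.map int :: ('v \<Rightarrow>\<^sub>0 nat) \<Rightarrow> _)"
  by (rule injI, rule poly_mapping_eqI) (metis lookup_map_int of_nat_eq_iff)

lemma lookup_to_laurent:
  fixes g :: "('v, 'k::field) mpoly"
  shows "Poly_Mapping.lookup (to_laurent g) (Poly_Mapping.map int t) = Poly_Mapping.lookup g t"
    and "\<beta> \<notin> range (Poly_Mapping.map int) \<Longrightarrow> Poly_Mapping.lookup (to_laurent g) \<beta> = 0"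
proof -
  have "Poly_Mapping.lookup (to_laurent g) (Poly_Mapping.map int t) =
      (\<Sum>s\<in>Poly_Mapping.keys g. if s = t then Poly_Mapping.lookup g t else 0)"
    unfolding to_laurent_def lookup_sum lookup_single
    by (rule sum.cong) (auto simp: when_def inj_map_int[THEN inj_eq])
  then show "Poly_Mapping.lookup (to_laurent g) (Poly_Mapping.map int t) = Poly_Mapping.lookup g t"
    by (simp add: in_keys_iff)
  assume "\<beta> \<notin> range (Poly_Mapping.map int)"
  then show "Poly_Mapping.lookup (to_laurent g) \<beta> = 0"
    unfolding to_laurent_def lookup_sum lookup_single by (intro sum.neutral) (auto simp: when_def)
qed

lemma map_int_nat:
  fixes \<beta> :: "'v::finite \<Rightarrow>\<^sub>0 int"
  assumes "\<And>v. 0 \<le> Poly_Mapping.lookup \<beta> v"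
  obtains t where "\<beta> = Poly_Mapping.map int t"
proof
  show "\<beta> = Poly_Mapping.map int (Poly_Mapping.map nat \<beta>)"
  proof (rule poly_mapping_eqI)
    fix k
    show "Poly_Mapping.lookup \<beta> k = Poly_Mapping.lookup (Poly_Mapping.map int (Poly_Mapping.map nat \<beta>)) k"
      using assms[of k] by (simp add: lookup_map_int Poly_Mapping.map.rep_eq when_def)
  qed
qed

lemma to_laurent_surj:
  fixes h :: "('v::finite, 'k::field) laurent"
  assumes "\<And>\<beta> v. \<beta> \<in> Poly_Mapping.keys h \<Longrightarrow> 0 \<le> Poly_Mapping.lookup \<beta> v"
  obtains g where "to_laurent g = h" and "\<And>t. t \<in> Poly_Mapping.keys g \<longleftrightarrow> Poly_Mapping.map int t \<in> Poly_Mapping.keys h"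
proof -
  define g where "g = Abs_poly_mapping (\<lambda>t. Poly_Mapping.lookup h (Poly_Mapping.map int t))"
  have "finite {t. Poly_Mapping.lookup h (Poly_Mapping.map int t) \<noteq> 0}"
  proof -
    have "{t. Poly_Mapping.lookup h (Poly_Mapping.map int t) \<noteq> 0} = Poly_Mapping.map int -` Poly_Mapping.keys h"
      by (auto simp: in_keys_iff)
    then show ?thesis using finite_vimageI[OF finite_keys inj_map_int] by metis
  qed
  then have g: "Poly_Mapping.lookup g t = Poly_Mapping.lookup h (Poly_Mapping.map int t)" for t
    by (simp add: g_def)
  have "to_laurent g = h"
  proof (rule poly_mapping_eqI)
    fix \<beta>
    show "Poly_Mapping.lookup (to_laurent g) \<beta> = Poly_Mapping.lookup h \<beta>"
    proof (cases "\<beta> \<in> range (Poly_Mapping.map int)")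
      case True
      then show ?thesis by (auto simp: lookup_to_laurent g)
    next
      case False
      then have "\<beta> \<notin> Poly_Mapping.keys h" using assms map_int_nat by blast
      then show ?thesis using False by (simp add: lookup_to_laurent in_keys_iff)
    qed
  qed
  then show thesis using that g by (simp add: in_keys_iff)
qed

lemma lookup_laurent_power_exp:
  fixes \<sigma> :: "'v::finite set"
  shows "Poly_Mapping.lookup (\<Sum>v\<in>\<sigma>. Poly_Mapping.single v (int N)) w = (if w \<in> \<sigma> then int N else 0)"
  by (simp add: lookup_sum lookup_single when_def)

lemma localizeE:
  fixes f :: "('v::finite, 'k::field) laurent"
  assumes "f \<in> localize \<sigma> M" "\<alpha> \<in> Poly_Mapping.keys f"
  obtains g t N where "g \<in> M" "t \<in> Poly_Mapping.keys g"
    "\<forall>v. int (Poly_Mapping.lookup t v) = Poly_Mapping.lookup \<alpha> v + (if v \<in> \<sigma> then int N else 0)"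
proof -
  obtain N g where g: "g \<in> M" "laurent_power \<sigma> N * f = to_laurent g"
    using assms(1) by (auto simp: localize_def)
  define e where "e = (\<Sum>v\<in>\<sigma>. Poly_Mapping.single v (int N))"
  have "Poly_Mapping.lookup (to_laurent g) (e + \<alpha>) = Poly_Mapping.lookup f \<alpha>"
    unfolding g(2)[symmetric] laurent_power_def e_def[symmetric] by (simp add: lookup_single_times)
  then have nz: "Poly_Mapping.lookup (to_laurent g) (e + \<alpha>) \<noteq> 0" using assms(2) by (simp add: in_keys_iff)
  then obtain t where t: "e + \<alpha> = Poly_Mapping.map int t" using lookup_to_laurent(2) by blast
  have "t \<in> Poly_Mapping.keys g" using nz unfolding t lookup_to_laurent(1) by (simp add: in_keys_iff)
  moreover have "int (Poly_Mapping.lookup t v) = Poly_Mapping.lookup \<alpha> v + (if v \<in> \<sigma> then int N else 0)" for v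
    unfolding lookup_map_int[symmetric] t[symmetric] lookup_add by (simp add: e_def lookup_laurent_power_exp)
  ultimately show thesis using that g(1) by blast
qed

text \<open>After multiplication by a high power of x_\<sigma> all exponents are nonnegative and
  those in \<sigma> positive, so the supports are exactly \<sigma> \<union>
  \<open>positive_part \<alpha>\<close>. Membership in M is asked of polynomials with such supports,
  which suits the unit ideal and the Stanley-Reisner ideal alike.\<close>

lemma localizeI:
  fixes f :: "('v::finite, 'k::field) laurent"
  assumes neg: "\<And>\<alpha>. \<alpha> \<in> Poly_Mapping.keys f \<Longrightarrow> negative_part \<alpha> \<subseteq> \<sigma>"
    and M: "\<And>g. (\<And>t. t \<in> Poly_Mapping.keys g \<Longrightarrow>
      \<exists>\<alpha>\<in>Poly_Mapping.keys f. Poly_Mapping.keys t = \<sigma> \<union> positive_part \<alpha>) \<Longrightarrow> g \<in> M"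
  shows "f \<in> localize \<sigma> M"
proof -
  define K where "K = (\<lambda>(\<alpha>, v). nat \<bar>Poly_Mapping.lookup \<alpha> v\<bar>) ` (Poly_Mapping.keys f \<times> (UNIV :: 'v set))"
  have finK: "finite K" by (simp add: K_def)
  \<comment> \<open>The successor makes N strictly larger than every exponent in absolute value, so
    that the vertices of \<sigma> really enter the support.\<close>
  define N where "N = Suc (Max (insert 0 K))"
  have N: "- Poly_Mapping.lookup \<alpha> v < int N" if "\<alpha> \<in> Poly_Mapping.keys f" for \<alpha> v
  proof -
    have "nat \<bar>Poly_Mapping.lookup \<alpha> v\<bar> \<in> insert 0 K" using that by (auto simp: K_def)
    then have "nat \<bar>Poly_Mapping.lookup \<alpha> v\<bar> < N" unfolding N_def using finK by (intro le_imp_less_Suc Max_ge) auto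
    then show ?thesis by linarith
  qed
  define e where "e = (\<Sum>v\<in>\<sigma>. Poly_Mapping.single v (int N))"
  have e: "Poly_Mapping.lookup e v = (if v \<in> \<sigma> then int N else 0)" for v
    unfolding e_def by (rule lookup_laurent_power_exp)
  define h where "h = laurent_power \<sigma> N * f"
  have h: "\<exists>\<alpha>\<in>Poly_Mapping.keys f. \<beta> = e + \<alpha>" if "\<beta> \<in> Poly_Mapping.keys h" for \<beta>
    using that unfolding h_def laurent_power_def e_def[symmetric]
    by (elim keys_times_subset) auto
  have nonneg: "0 \<le> Poly_Mapping.lookup \<beta> v" if \<beta>: "\<beta> \<in> Poly_Mapping.keys h" for \<beta> v
  proof -
    obtain \<alpha> where \<alpha>: "\<alpha> \<in> Poly_Mapping.keys f" "\<beta> = e + \<alpha>" using h \<beta> by blast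
    show ?thesis using N[OF \<alpha>(1), of v] neg[OF \<alpha>(1)] unfolding \<alpha>(2) lookup_add e negative_part_def
      by (cases "v \<in> \<sigma>") force+
  qed
  obtain g where g: "to_laurent g = h" "\<And>t. t \<in> Poly_Mapping.keys g \<longleftrightarrow> Poly_Mapping.map int t \<in> Poly_Mapping.keys h"
    using to_laurent_surj nonneg by blast
  have "g \<in> M"
  proof (rule M)
    fix t assume "t \<in> Poly_Mapping.keys g"
    then obtain \<alpha> where \<alpha>: "\<alpha> \<in> Poly_Mapping.keys f" "Poly_Mapping.map int t = e + \<alpha>" using h g by blast
    have *: "int (Poly_Mapping.lookup t v) = (if v \<in> \<sigma> then int N else 0) + Poly_Mapping.lookup \<alpha> v" for v
      unfolding lookup_map_int[symmetric] \<alpha>(2) lookup_add e ..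
    have "v \<in> Poly_Mapping.keys t \<longleftrightarrow> v \<in> \<sigma> \<union> positive_part \<alpha>" for v
      using *[of v] N[OF \<alpha>(1), of v] by (auto simp: in_keys_iff positive_part_def split: if_splits)
    then show "\<exists>\<alpha>\<in>Poly_Mapping.keys f. Poly_Mapping.keys t = \<sigma> \<union> positive_part \<alpha>" using \<alpha>(1) by blast
  qed
  then show ?thesis using g(1) unfolding localize_def h_def by (metis (mono_tags, lifting) mem_Collect_eq)
qed

lemma localize_UNIV_iff:
  fixes f :: "('v::finite, 'k::field) laurent"
  shows "f \<in> localize \<sigma> UNIV \<longleftrightarrow> (\<forall>\<alpha>\<in>Poly_Mapping.keys f. negative_part \<alpha> \<subseteq> \<sigma>)"
proof
  assume f: "f \<in> localize \<sigma> UNIV"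
  show "\<forall>\<alpha>\<in>Poly_Mapping.keys f. negative_part \<alpha> \<subseteq> \<sigma>"
  proof (intro ballI subsetI)
    fix \<alpha> v assume \<alpha>: "\<alpha> \<in> Poly_Mapping.keys f" and v: "v \<in> negative_part \<alpha>"
    obtain g :: "('v, 'k) mpoly" and t N where "g \<in> UNIV" "t \<in> Poly_Mapping.keys g"
      "\<forall>v. int (Poly_Mapping.lookup t v) = Poly_Mapping.lookup \<alpha> v + (if v \<in> \<sigma> then int N else 0)"
      by (rule localizeE[OF f \<alpha>])
    from this(3)[rule_format, of v] v show "v \<in> \<sigma>" by (auto simp: negative_part_def split: if_splits)
  qed
qed (auto intro: localizeI)

text \<open>Up to a power of x_\<sigma>, a Laurent monomial has support \<sigma> \<union>
  \<open>positive_part \<alpha>\<close>, and its numerator lies in the ideal when this is not a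
  face.\<close>

lemma localize_stanley_reisner_iff:
  fixes f :: "('v::finite, 'k::field) laurent"
  assumes \<Delta>: "simplicial_complex \<Delta>"
  shows "f \<in> localize \<sigma> (stanley_reisner_ideal \<Delta>) \<longleftrightarrow>
    (\<forall>\<alpha>\<in>Poly_Mapping.keys f. negative_part \<alpha> \<subseteq> \<sigma> \<and> \<sigma> \<union> positive_part \<alpha> \<notin> \<Delta>)"
proof
  assume f: "f \<in> localize \<sigma> (stanley_reisner_ideal \<Delta>)"
  show "\<forall>\<alpha>\<in>Poly_Mapping.keys f. negative_part \<alpha> \<subseteq> \<sigma> \<and> \<sigma> \<union> positive_part \<alpha> \<notin> \<Delta>"
  proof
    fix \<alpha> assume \<alpha>: "\<alpha> \<in> Poly_Mapping.keys f"
    obtain g :: "('v, 'k) mpoly" and t N where g: "g \<in> stanley_reisner_ideal \<Delta>" "t \<in> Poly_Mapping.keys g"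
      and t: "\<forall>v. int (Poly_Mapping.lookup t v) = Poly_Mapping.lookup \<alpha> v + (if v \<in> \<sigma> then int N else 0)"
      by (rule localizeE[OF f \<alpha>])
    have neg: "negative_part \<alpha> \<subseteq> \<sigma>"
    proof
      fix v assume "v \<in> negative_part \<alpha>"
      with t[rule_format, of v] show "v \<in> \<sigma>" by (auto simp: negative_part_def split: if_splits)
    qed
    have "Poly_Mapping.keys t \<subseteq> \<sigma> \<union> positive_part \<alpha>"
    proof
      fix v assume "v \<in> Poly_Mapping.keys t"
      with t[rule_format, of v] show "v \<in> \<sigma> \<union> positive_part \<alpha>" by (auto simp: in_keys_iff positive_part_def split: if_splits)
    qed
    then show "negative_part \<alpha> \<subseteq> \<sigma> \<and> \<sigma> \<union> positive_part \<alpha> \<notin> \<Delta>"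
      using neg g \<Delta> stanley_reisner_ideal_iff[OF \<Delta>] unfolding simplicial_complex_def by blast
  qed
next
  assume *: "\<forall>\<alpha>\<in>Poly_Mapping.keys f. negative_part \<alpha> \<subseteq> \<sigma> \<and> \<sigma> \<union> positive_part \<alpha> \<notin> \<Delta>"
  show "f \<in> localize \<sigma> (stanley_reisner_ideal \<Delta>)"
  proof (rule localizeI)
    fix g :: "('v, 'k) mpoly"
    assume "\<And>t. t \<in> Poly_Mapping.keys g \<Longrightarrow> \<exists>\<alpha>\<in>Poly_Mapping.keys f. Poly_Mapping.keys t = \<sigma> \<union> positive_part \<alpha>"
    then show "g \<in> stanley_reisner_ideal \<Delta>" using * unfolding stanley_reisner_ideal_iff[OF \<Delta>] by metis
  qed (use * in blast)
qed

section \<open>The multigraded strands of the Cech complex\<close>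

section \<open>Local cohomology\<close>

text \<open>The faces indexing the degree \<open>\<alpha>\<close> part of the Cech complex of \<open>k[\<Delta>]\<close>.\<close>

definition cech_faces :: "'v set set \<Rightarrow> ('v \<Rightarrow>\<^sub>0 int) \<Rightarrow> 'v set set" where
  "cech_faces \<Delta> \<alpha> = {\<sigma>. negative_part \<alpha> \<subseteq> \<sigma> \<and> \<sigma> \<union> positive_part \<alpha> \<in> \<Delta>}"

text \<open>For a cochain, coefficients at sets outside \<open>cech_faces \<Delta> \<alpha>\<close>
  vanish or belong to the localized ideal; dropping them passes from lifts over S to the strand of
  degree \<alpha> over k[\<Delta>].\<close>

definition cech_component ::
    "'v set set \<Rightarrow> ('v \<Rightarrow>\<^sub>0 int) \<Rightarrow> ('v set \<Rightarrow> ('v, 'k::field) laurent) \<Rightarrow> 'v set \<Rightarrow> 'k" where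
  "cech_component \<Delta> \<alpha> c = restrict_to (cech_faces \<Delta> \<alpha>) (\<lambda>\<sigma>. Poly_Mapping.lookup (c \<sigma>) \<alpha>)"

lemma cech_component_add: "cech_component \<Delta> \<alpha> (c + d) = cech_component \<Delta> \<alpha> c + cech_component \<Delta> \<alpha> d"
  by (auto simp: cech_component_def restrict_to_def lookup_add)

lemma cech_component_diff: "cech_component \<Delta> \<alpha> (c - d) = cech_component \<Delta> \<alpha> c - cech_component \<Delta> \<alpha> d"
  by (auto simp: cech_component_def restrict_to_def lookup_minus)

lemma cech_component_scale:
  "cech_component \<Delta> \<alpha> (\<lambda>\<sigma>. Poly_Mapping.single 0 a * c \<sigma>) = (\<lambda>\<sigma>. a * cech_component \<Delta> \<alpha> c \<sigma>)"
  by (auto simp: cech_component_def restrict_to_def lookup_scalar_times fun_eq_iff)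

lemma lookup_incidence_sign_times:
  fixes f :: "('v::{finite,linorder}, 'k::field) laurent"
  shows "Poly_Mapping.lookup (incidence_sign v F * f) \<alpha> = incidence_sign v F * Poly_Mapping.lookup f \<alpha>"
  unfolding incidence_sign_def by (rule lookup_sign_times)

context
  fixes \<Delta> :: "'v::{finite,linorder} set set"
  assumes \<Delta>: "simplicial_complex \<Delta>"
begin

lemma face_subset: "F \<in> \<Delta> \<Longrightarrow> G \<subseteq> F \<Longrightarrow> G \<in> \<Delta>"
  using \<Delta> by (simp add: simplicial_complex_def)

lemma cech_cochains_UNIV_iff:
  "(c :: 'v set \<Rightarrow> ('v, 'k::field) laurent) \<in> cech_cochains UNIV i \<longleftrightarrow>
   (\<forall>\<sigma> \<alpha>. Poly_Mapping.lookup (c \<sigma>) \<alpha> \<noteq> 0 \<longrightarrow> int (card \<sigma>) = i \<and> negative_part \<alpha> \<subseteq> \<sigma>)"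
proof -
  have "c \<sigma> = 0 \<longleftrightarrow> (\<forall>\<alpha>. Poly_Mapping.lookup (c \<sigma>) \<alpha> = 0)" for \<sigma>
    by (metis lookup_zero poly_mapping_eqI)
  then show ?thesis
    unfolding cech_cochains_def localize_UNIV_iff by (simp add: Ball_def in_keys_iff) blast
qed

lemma cech_cochains_ideal_iff:
  "(c :: 'v set \<Rightarrow> ('v, 'k::field) laurent) \<in> cech_cochains (stanley_reisner_ideal \<Delta>) i \<longleftrightarrow>
   c \<in> cech_cochains UNIV i \<and> (\<forall>\<alpha>. cech_component \<Delta> \<alpha> c = 0)"
proof -
  have z: "c \<sigma> = 0 \<longleftrightarrow> (\<forall>\<alpha>. Poly_Mapping.lookup (c \<sigma>) \<alpha> = 0)" for \<sigma>
    by (metis lookup_zero poly_mapping_eqI)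
  show ?thesis
    unfolding cech_cochains_UNIV_iff
    unfolding cech_cochains_def localize_stanley_reisner_iff[OF \<Delta>] cech_component_def
      restrict_to_def cech_faces_def fun_eq_iff
    using z by (simp add: Ball_def in_keys_iff) blast
qed

lemma cech_component_cochain:
  assumes "(c :: 'v set \<Rightarrow> ('v, 'k::field) laurent) \<in> cech_cochains UNIV i"
  shows "cech_component \<Delta> \<alpha> c \<in> cochains (cech_faces \<Delta> \<alpha>) i"
  using assms unfolding cech_cochains_UNIV_iff cochains_def cech_component_def restrict_to_def by auto

lemma cech_cochains_add:
  "(c :: 'v set \<Rightarrow> ('v, 'k::field) laurent) \<in> cech_cochains UNIV i \<Longrightarrow> d \<in> cech_cochains UNIV i
    \<Longrightarrow> c + d \<in> cech_cochains UNIV i"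
  unfolding cech_cochains_UNIV_iff by (simp add: lookup_add) (metis add.right_neutral)

lemma cech_cochains_diff:
  "(c :: 'v set \<Rightarrow> ('v, 'k::field) laurent) \<in> cech_cochains UNIV i \<Longrightarrow> d \<in> cech_cochains UNIV i
    \<Longrightarrow> c - d \<in> cech_cochains UNIV i"
  unfolding cech_cochains_UNIV_iff by (simp add: lookup_minus) (metis diff_zero)

lemma cech_cochains_scale:
  "(c :: 'v set \<Rightarrow> ('v, 'k::field) laurent) \<in> cech_cochains UNIV i
    \<Longrightarrow> (\<lambda>\<sigma>. Poly_Mapping.single 0 a * c \<sigma>) \<in> cech_cochains UNIV i"
  unfolding cech_cochains_UNIV_iff by (auto simp: lookup_scalar_times)

lemma cech_diff_cochain:
  assumes "(c :: 'v set \<Rightarrow> ('v, 'k::field) laurent) \<in> cech_cochains UNIV i"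
  shows "cech_diff c \<in> cech_cochains UNIV (i + 1)"
  unfolding cech_cochains_UNIV_iff
proof (intro allI impI)
  fix \<tau> \<alpha> assume "Poly_Mapping.lookup (cech_diff c \<tau>) \<alpha> \<noteq> 0"
  then obtain v where v: "v \<in> \<tau>" "Poly_Mapping.lookup (c (\<tau> - {v})) \<alpha> \<noteq> 0"
    unfolding cech_diff_def lookup_sum lookup_incidence_sign_times
    by (metis (no_types, lifting) mult_zero_right sum.not_neutral_contains_not_neutral)
  with assms have "int (card (\<tau> - {v})) = i \<and> negative_part \<alpha> \<subseteq> \<tau> - {v}"
    unfolding cech_cochains_UNIV_iff by blast
  moreover have "card \<tau> = Suc (card (\<tau> - {v}))" using v(1) by (rule card.remove[OF finite])
  ultimately show "int (card \<tau>) = i + 1 \<and> negative_part \<alpha> \<subseteq> \<tau>" by auto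
qed

lemma cech_component_cech_diff:
  assumes c: "(c :: 'v set \<Rightarrow> ('v, 'k::field) laurent) \<in> cech_cochains UNIV i"
  shows "cech_component \<Delta> \<alpha> (cech_diff c) = coboundary (cech_faces \<Delta> \<alpha>) (cech_component \<Delta> \<alpha> c)"
proof
  fix \<tau>
  have "Poly_Mapping.lookup (c (\<tau> - {v})) \<alpha> = cech_component \<Delta> \<alpha> c (\<tau> - {v})"
    if "\<tau> \<in> cech_faces \<Delta> \<alpha>" for v
  proof (cases "\<tau> - {v} \<in> cech_faces \<Delta> \<alpha>")
    case False
    \<comment> \<open>Removing v keeps the union with the positive part in \<Delta>, so the strand
      can only be left by losing a negative vertex, and there c has no coefficient at
      \<alpha>.\<close>
    have "(\<tau> - {v}) \<union> positive_part \<alpha> \<in> \<Delta>"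
      using that face_subset[of "\<tau> \<union> positive_part \<alpha>" "\<tau> - {v} \<union> positive_part \<alpha>"]
      by (auto simp: cech_faces_def)
    with False have "\<not> negative_part \<alpha> \<subseteq> \<tau> - {v}" by (auto simp: cech_faces_def)
    then have "Poly_Mapping.lookup (c (\<tau> - {v})) \<alpha> = 0" using c unfolding cech_cochains_UNIV_iff by blast
    then show ?thesis using False by (simp add: cech_component_def restrict_to_def)
  qed (simp add: cech_component_def restrict_to_def)
  then show "cech_component \<Delta> \<alpha> (cech_diff c) \<tau> = coboundary (cech_faces \<Delta> \<alpha>) (cech_component \<Delta> \<alpha> c) \<tau>"
    unfolding coboundary_def cech_component_def[of \<Delta> \<alpha> "cech_diff c"] restrict_to_def cech_diff_def
      lookup_sum lookup_incidence_sign_times by simp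
qed

lemma cech_cocycles_iff:
  "(c :: 'v set \<Rightarrow> ('v, 'k::field) laurent) \<in> cech_cocycles (stanley_reisner_ideal \<Delta>) i \<longleftrightarrow>
   c \<in> cech_cochains UNIV i \<and> (\<forall>\<alpha>. coboundary (cech_faces \<Delta> \<alpha>) (cech_component \<Delta> \<alpha> c) = 0)"
  unfolding cech_cocycles_def mem_Collect_eq cech_cochains_ideal_iff
  using cech_diff_cochain[of c i] cech_component_cech_diff[of c i] by auto

text \<open>A cocycle splits into its strands, and every strand but \<alpha> = 0 can be solved by
  acyclicity, so degree 0 alone decides.\<close>

lemma cech_coboundaries_iff:
  assumes acyclic: "\<And>\<alpha>. \<alpha> \<noteq> 0 \<Longrightarrow> acyclic_at TYPE('k::field) (cech_faces \<Delta> \<alpha>) i"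
    and c: "(c :: 'v set \<Rightarrow> ('v, 'k) laurent) \<in> cech_cocycles (stanley_reisner_ideal \<Delta>) i"
  shows "c \<in> cech_coboundaries (stanley_reisner_ideal \<Delta>) i \<longleftrightarrow>
    cech_component \<Delta> 0 c \<in> coboundary (cech_faces \<Delta> 0) ` cochains (cech_faces \<Delta> 0) (i - 1)"
proof
  assume "c \<in> cech_coboundaries (stanley_reisner_ideal \<Delta>) i"
  then obtain b :: "'v set \<Rightarrow> ('v, 'k) laurent" where b: "b \<in> cech_cochains UNIV (i - 1)"
    and "c - cech_diff b \<in> cech_cochains (stanley_reisner_ideal \<Delta>) i"
    by (auto simp: cech_coboundaries_def)
  then have "cech_component \<Delta> 0 (c - cech_diff b) = 0" by (simp add: cech_cochains_ideal_iff)
  then have "cech_component \<Delta> 0 c = coboundary (cech_faces \<Delta> 0) (cech_component \<Delta> 0 b)"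
    unfolding cech_component_diff cech_component_cech_diff[OF b] by simp
  then show "cech_component \<Delta> 0 c \<in> coboundary (cech_faces \<Delta> 0) ` cochains (cech_faces \<Delta> 0) (i - 1)"
    using cech_component_cochain[OF b] by blast
next
  assume zero: "cech_component \<Delta> 0 c \<in> coboundary (cech_faces \<Delta> 0) ` cochains (cech_faces \<Delta> 0) (i - 1)"
  have cc: "c \<in> cech_cochains UNIV i" and closed: "\<And>\<alpha>. coboundary (cech_faces \<Delta> \<alpha>) (cech_component \<Delta> \<alpha> c) = 0"
    using c by (auto simp: cech_cocycles_iff)
  \<comment> \<open>The last clause makes the chosen primitives zero outside the finitely many
    degrees occurring in c, so that they assemble to Laurent polynomials.\<close>
  have "\<exists>b. b \<in> cochains (cech_faces \<Delta> \<alpha>) (i - 1) \<and> coboundary (cech_faces \<Delta> \<alpha>) b = cech_component \<Delta> \<alpha> c \<and>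
      (cech_component \<Delta> \<alpha> c = 0 \<longrightarrow> b = 0)" for \<alpha>
  proof (cases "cech_component \<Delta> \<alpha> c = 0")
    case False
    show ?thesis
    proof (cases "\<alpha> = 0")
      case True
      then show ?thesis using zero False by auto
    next
      case \<alpha>: False
      show ?thesis using acyclic_atD[OF acyclic[OF \<alpha>] cech_component_cochain[OF cc] closed] False by metis
    qed
  qed (auto intro: exI[of _ 0])
  then obtain b where b: "\<And>\<alpha>. b \<alpha> \<in> cochains (cech_faces \<Delta> \<alpha>) (i - 1)"
    "\<And>\<alpha>. coboundary (cech_faces \<Delta> \<alpha>) (b \<alpha>) = cech_component \<Delta> \<alpha> c"
    "\<And>\<alpha>. cech_component \<Delta> \<alpha> c = 0 \<Longrightarrow> b \<alpha> = 0" by metis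
  define S where "S = (\<Union>\<sigma>. Poly_Mapping.keys (c \<sigma>))"
  have S: "finite S" by (simp add: S_def)
  have bS: "b \<alpha> = 0" if "\<alpha> \<notin> S" for \<alpha>
    using that by (intro b(3)) (auto simp: S_def cech_component_def restrict_to_def fun_eq_iff in_keys_iff)
  define B where "B \<sigma> = (\<Sum>\<alpha>\<in>S. Poly_Mapping.single \<alpha> (b \<alpha> \<sigma>))" for \<sigma>
  have lookup_B: "Poly_Mapping.lookup (B \<sigma>) \<alpha> = b \<alpha> \<sigma>" for \<sigma> \<alpha>
  proof -
    have "Poly_Mapping.lookup (B \<sigma>) \<alpha> = (\<Sum>\<beta>\<in>S. if \<beta> = \<alpha> then b \<alpha> \<sigma> else 0)"
      unfolding B_def lookup_sum lookup_single by (rule sum.cong) (auto simp: when_def)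
    then show ?thesis using S bS[of \<alpha>] by auto
  qed
  have B: "B \<in> cech_cochains UNIV (i - 1)"
    unfolding cech_cochains_UNIV_iff lookup_B using b(1) by (fastforce simp: cochains_def cech_faces_def)
  have comp_B: "cech_component \<Delta> \<alpha> B = b \<alpha>" for \<alpha>
    using cochains_zero[OF b(1)] by (auto simp: cech_component_def restrict_to_def lookup_B fun_eq_iff)
  have "cech_diff B \<in> cech_cochains UNIV i" using cech_diff_cochain[OF B] by simp
  then have "c - cech_diff B \<in> cech_cochains (stanley_reisner_ideal \<Delta>) i"
    unfolding cech_cochains_ideal_iff cech_component_diff cech_component_cech_diff[OF B] comp_B b(2)
    using cech_cochains_diff[OF cc] by simp
  then show "c \<in> cech_coboundaries (stanley_reisner_ideal \<Delta>) i"
    using cc B by (auto simp: cech_coboundaries_def)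
qed

lemma cech_faces_zero: "cech_faces \<Delta> 0 = \<Delta>"
  by (auto simp: cech_faces_def negative_part_def positive_part_def)

text \<open>A vertex with positive exponent can be toggled freely, which gives a cone. Without such
  a vertex the strand is the star of the negative part, nonempty since \<alpha> \<noteq> 0, and the
  Buchsbaum condition applies.\<close>

lemma cech_faces_acyclic:
  assumes B: "buchsbaum TYPE('k::field) \<Delta>" and i: "i \<le> complex_dim \<Delta>" and \<alpha>: "\<alpha> \<noteq> 0"
  shows "acyclic_at TYPE('k) (cech_faces \<Delta> \<alpha>) i"
proof (cases "positive_part \<alpha> = {}")
  case False
  then obtain v where v: "v \<in> positive_part \<alpha>" by blast
  have vn: "v \<notin> negative_part \<alpha>" using v by (auto simp: positive_part_def negative_part_def)
  show ?thesis
  proof (rule acyclic_cone[where v = v])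
    fix F assume F: "F \<in> cech_faces \<Delta> \<alpha>"
    have "insert v F \<union> positive_part \<alpha> = F \<union> positive_part \<alpha>" "(F - {v}) \<union> positive_part \<alpha> = F \<union> positive_part \<alpha>"
      using v by auto
    then show "insert v F \<in> cech_faces \<Delta> \<alpha> \<and> F - {v} \<in> cech_faces \<Delta> \<alpha>"
      using F vn by (auto simp: cech_faces_def)
  qed
next
  case True
  have ne: "negative_part \<alpha> \<noteq> {}"
  proof
    assume "negative_part \<alpha> = {}"
    with True have "Poly_Mapping.lookup \<alpha> v = 0" for v
      by (force simp: positive_part_def negative_part_def not_less intro: antisym)
    then have "\<alpha> = 0" by (intro poly_mapping_eqI) simp
    with \<alpha> show False ..
  qed
  have eq: "cech_faces \<Delta> \<alpha> = {G \<in> \<Delta>. negative_part \<alpha> \<subseteq> G}" using True by (auto simp: cech_faces_def)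
  show ?thesis
  proof (cases "negative_part \<alpha> \<in> \<Delta>")
    case True
    then show ?thesis unfolding eq using buchsbaum_star_acyclic[OF \<Delta> B _ ne i] by simp
  next
    case False
    then have "cech_faces \<Delta> \<alpha> = {}" unfolding eq using face_subset by blast
    then show ?thesis by (intro acyclic_at_no_faces) simp
  qed
qed

text \<open>The strand of degree 0 is the cochain complex of \<Delta> itself, and projecting to it
  identifies the two quotients. As degree i means cardinality i, this is the classical shift to
  reduced cohomology in dimension i - 1.\<close>

theorem local_cohomology_dim_eq:
  assumes B: "buchsbaum TYPE('k::field) \<Delta>" and i: "i \<le> complex_dim \<Delta>"
  shows "local_cohomology_dim (stanley_reisner_ideal \<Delta> :: ('v, 'k) mpoly set) i = cohomology_dim TYPE('k) \<Delta> i"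
proof -
  let ?I = "stanley_reisner_ideal \<Delta> :: ('v, 'k) mpoly set"
  let ?scale = "(\<lambda>a c \<sigma>. Poly_Mapping.single 0 a * c \<sigma>) :: 'k \<Rightarrow> ('v set \<Rightarrow> ('v, 'k) laurent) \<Rightarrow> _"
  have closed: "(\<Sum>x\<in>X. ?scale (u x) x) \<in> cech_cocycles ?I i \<and>
      cech_component \<Delta> \<alpha> (\<Sum>x\<in>X. ?scale (u x) x) = (\<Sum>x\<in>X. (\<lambda>\<sigma>. u x * cech_component \<Delta> \<alpha> x \<sigma>))"
    if "finite X" "X \<subseteq> cech_cocycles ?I i" for X u \<alpha>
    using that
  proof (induction X)
    case empty
    then show ?case
      by (auto simp: cech_cocycles_iff cech_cochains_UNIV_iff cech_component_def restrict_to_def coboundary_def fun_eq_iff)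
  next
    case (insert x X)
    have lin: "coboundary X' (\<lambda>\<sigma>. a * f \<sigma>) = 0" if "coboundary X' f = 0" for X' and a :: 'k and f :: "'v set \<Rightarrow> 'k"
    proof -
      interpret L: Vector_Spaces.linear "(\<lambda>a f x. a * f x) :: 'k \<Rightarrow> ('v set \<Rightarrow> 'k) \<Rightarrow> 'v set \<Rightarrow> 'k"
        "\<lambda>a f x. a * f x" "coboundary X'"
        by (rule coboundary_linear)
      show ?thesis unfolding L.scale that by auto
    qed
    have x: "x \<in> cech_cocycles ?I i" using insert.prems by simp
    have sx: "?scale (u x) x \<in> cech_cocycles ?I i"
      using x unfolding cech_cocycles_iff cech_component_scale by (auto intro: cech_cochains_scale lin)
    have IH: "(\<Sum>x\<in>X. ?scale (u x) x) \<in> cech_cocycles ?I i"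
      "cech_component \<Delta> \<alpha> (\<Sum>x\<in>X. ?scale (u x) x) = (\<Sum>x\<in>X. (\<lambda>\<sigma>. u x * cech_component \<Delta> \<alpha> x \<sigma>))"
      using insert by auto
    have "?scale (u x) x + (\<Sum>x\<in>X. ?scale (u x) x) \<in> cech_cocycles ?I i"
      using sx IH(1) unfolding cech_cocycles_iff cech_component_add coboundary_add by (auto intro: cech_cochains_add)
    then show ?case
      unfolding sum.insert[OF insert.hyps] cech_component_add cech_component_scale IH(2)
      by - (intro conjI refl, assumption)
  qed
  have "quotient_dim ?scale (cech_cocycles ?I i) (cech_coboundaries ?I i) =
      quotient_dim (\<lambda>a f x. a * f x) (cocycles \<Delta> i) (coboundary \<Delta> ` (cochains \<Delta> (i - 1) :: ('v set \<Rightarrow> 'k) set))"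
  proof (rule quotient_dim_cong[where \<pi> = "cech_component \<Delta> 0"])
    show "vector_space ((\<lambda>a f x. a * f x) :: 'k \<Rightarrow> ('v set \<Rightarrow> 'k) \<Rightarrow> 'v set \<Rightarrow> 'k)"
      by (rule fun_space.vector_space_axioms)
    show "cech_component \<Delta> 0 ` cech_cocycles ?I i = cocycles \<Delta> i"
    proof (intro equalityI subsetI)
      fix z :: "'v set \<Rightarrow> 'k" assume z: "z \<in> cocycles \<Delta> i"
      \<comment> \<open>A cocycle of \<Delta> is lifted by constants, that is, placed in multidegree
        0.\<close>
      define c where "c \<sigma> = Poly_Mapping.single (0 :: 'v \<Rightarrow>\<^sub>0 int) (z \<sigma>)" for \<sigma>
      have c: "c \<in> cech_cochains UNIV i"
        using z unfolding cech_cochains_UNIV_iff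
        by (auto simp: c_def lookup_single when_def cocycles_def cochains_def negative_part_def)
      have "cech_component \<Delta> \<alpha> c = (if \<alpha> = 0 then z else 0)" for \<alpha>
        using z cech_faces_zero
        by (auto simp: cech_component_def restrict_to_def c_def lookup_single when_def fun_eq_iff cocycles_def cochains_zero)
      then show "z \<in> cech_component \<Delta> 0 ` cech_cocycles ?I i"
        using z c cech_faces_zero by (intro image_eqI[of _ _ c]) (auto simp: cech_cocycles_iff cocycles_def)
    next
      fix z assume "z \<in> cech_component \<Delta> 0 ` cech_cocycles ?I i"
      then obtain c where c: "c \<in> cech_cocycles ?I i" "z = cech_component \<Delta> 0 c" by blast
      then have "c \<in> cech_cochains UNIV i" "coboundary \<Delta> z = 0"
        unfolding cech_cocycles_iff using cech_faces_zero by metis+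
      then show "z \<in> cocycles \<Delta> i"
        using cech_component_cochain[of c i 0] c(2) cech_faces_zero by (simp add: cocycles_def)
    qed
    show "cech_component \<Delta> 0 z \<in> coboundary \<Delta> ` cochains \<Delta> (i - 1) \<longleftrightarrow> z \<in> cech_coboundaries ?I i"
      if "z \<in> cech_cocycles ?I i" for z
      using cech_coboundaries_iff[OF cech_faces_acyclic[OF B i] that] unfolding cech_faces_zero by blast
    show "0 \<in> coboundary \<Delta> ` (cochains \<Delta> (i - 1) :: ('v set \<Rightarrow> 'k) set)"
      by (rule image_eqI[of _ _ 0]) auto
  qed (use closed in blast)+
  then show ?thesis by (simp add: local_cohomology_dim_def cohomology_dim_def)
qed

end

section \<open>Chain maps and homotopies between arbitrary graded free resolutions\<close>

section \<open>Comparison of graded free resolutions\<close>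

lemma mdegree_add: "mdegree (s + t) = mdegree s + mdegree t"
  by (simp add: mdegree_def lookup_add sum.distrib)

lemma mdegree_0 [simp]: "mdegree 0 = 0"
  by (simp add: mdegree_def)

text \<open>The component of degree s - r. Here r is the degree of a basis vector and s that of the
  module element whose coefficient is g; the additive form avoids subtraction.\<close>

definition graded_part :: "nat \<Rightarrow> nat \<Rightarrow> ('v::finite, 'k::field) mpoly \<Rightarrow> ('v, 'k) mpoly" where
  "graded_part r s g =
     (\<Sum>u | u \<in> Poly_Mapping.keys g \<and> r + mdegree u = s. Poly_Mapping.single u (Poly_Mapping.lookup g u))"

lemma lookup_graded_part:
  "Poly_Mapping.lookup (graded_part r s g) t = (if r + mdegree t = s then Poly_Mapping.lookup g t else 0)"
proof -
  have "Poly_Mapping.lookup (graded_part r s g) t =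
      (\<Sum>u | u \<in> Poly_Mapping.keys g \<and> r + mdegree u = s. if u = t then Poly_Mapping.lookup g t else 0)"
    unfolding graded_part_def lookup_sum lookup_single by (rule sum.cong) (auto simp: when_def)
  then show ?thesis by (auto simp: in_keys_iff)
qed

text \<open>f is homogeneous of degree r - p, so multiplication by it commutes with taking
  components once the reference degree moves from r to p.\<close>

lemma graded_part_times:
  fixes f g :: "('v::finite, 'k::field) mpoly"
  assumes f: "\<And>x. x \<in> Poly_Mapping.keys f \<Longrightarrow> p + mdegree x = r"
  shows "f * graded_part r s g = graded_part p s (f * g)"
proof (rule poly_mapping_eqI)
  fix t
  have *: "Poly_Mapping.lookup (Poly_Mapping.single x c * graded_part r s g) t =
      (if p + mdegree t = s then Poly_Mapping.lookup (Poly_Mapping.single x c * g) t else 0)"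
    if "x \<in> Poly_Mapping.keys f" for x c
  proof (cases "\<exists>u. t = x + u")
    case True
    then obtain u where u: "t = x + u" by blast
    have "p + mdegree t = r + mdegree u" unfolding u mdegree_add using f[OF that] by simp
    then show ?thesis unfolding u lookup_single_times(1) lookup_graded_part by simp
  next
    case False
    then show ?thesis by (simp add: lookup_single_times(2))
  qed
  have "Poly_Mapping.lookup (f * graded_part r s g) t =
      (\<Sum>x\<in>Poly_Mapping.keys f. Poly_Mapping.lookup (Poly_Mapping.single x (Poly_Mapping.lookup f x) * graded_part r s g) t)"
    by (subst (1) poly_mapping_expansion[of f]) (simp add: sum_distrib_right lookup_sum)
  also have "\<dots> = (\<Sum>x\<in>Poly_Mapping.keys f. if p + mdegree t = s then
      Poly_Mapping.lookup (Poly_Mapping.single x (Poly_Mapping.lookup f x) * g) t else 0)"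
    by (rule sum.cong[OF refl]) (rule *)
  also have "\<dots> = (if p + mdegree t = s then Poly_Mapping.lookup (f * g) t else 0)"
    by (subst (3) poly_mapping_expansion[of f]) (simp add: sum_distrib_right lookup_sum)
  finally show "Poly_Mapping.lookup (f * graded_part r s g) t = Poly_Mapping.lookup (graded_part p s (f * g)) t"
    by (simp add: lookup_graded_part)
qed

lemma graded_part_sum: "graded_part r s (\<Sum>x\<in>X. f x) = (\<Sum>x\<in>X. graded_part r s (f x))"
  by (rule poly_mapping_eqI) (simp add: lookup_graded_part lookup_sum)

lemma graded_part_diff: "graded_part r s (f - g) = graded_part r s f - graded_part r s g"
  by (rule poly_mapping_eqI) (simp add: lookup_graded_part lookup_minus)

lemma graded_part_id:
  assumes "\<And>x. x \<in> Poly_Mapping.keys f \<Longrightarrow> r + mdegree x = s"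
  shows "graded_part r s f = f"
  by (rule poly_mapping_eqI) (use assms in \<open>auto simp: lookup_graded_part in_keys_iff\<close>)

text \<open>Maps of free modules are given by columns: \<open>\<phi> b\<close> is the image of the
  b-th basis vector. Composition becomes \<open>lin_lin\<close>, and lifting a map means choosing
  its columns one by one.\<close>

definition lin :: "nat \<Rightarrow> (nat \<Rightarrow> nat \<Rightarrow> 'a::comm_ring_1) \<Rightarrow> (nat \<Rightarrow> 'a) \<Rightarrow> nat \<Rightarrow> 'a" where
  "lin n \<phi> u = (\<lambda>a. \<Sum>b<n. u b * \<phi> b a)"

definition unit_vec :: "nat \<Rightarrow> nat \<Rightarrow> 'a::comm_ring_1" where
  "unit_vec b a = (if a = b then 1 else 0)"

lemma lin_lin: "lin m \<psi> (lin n \<phi> u) = lin n (\<lambda>b. lin m \<psi> (\<phi> b)) u"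
proof
  fix a
  have "lin m \<psi> (lin n \<phi> u) a = (\<Sum>b<m. \<Sum>c<n. u c * \<phi> c b * \<psi> b a)"
    by (simp add: lin_def sum_distrib_right)
  also have "\<dots> = (\<Sum>c<n. \<Sum>b<m. u c * \<phi> c b * \<psi> b a)" by (rule sum.swap)
  finally show "lin m \<psi> (lin n \<phi> u) a = lin n (\<lambda>b. lin m \<psi> (\<phi> b)) u a"
    unfolding lin_def sum_distrib_left mult.assoc .
qed

lemma lin_unit_vec: "b < n \<Longrightarrow> lin n \<phi> (unit_vec b) = \<phi> b"
  by (simp add: lin_def unit_vec_def if_distrib[of "\<lambda>x. x * _"] cong: if_cong)

lemma lin_diff: "lin n \<phi> (u - w) = lin n \<phi> u - lin n \<phi> w"
  by (auto simp: lin_def algebra_simps sum_subtractf)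

lemma lin_diff_columns: "lin n (\<lambda>b. \<phi> b - \<psi> b) u = lin n \<phi> u - lin n \<psi> u"
  by (auto simp: lin_def algebra_simps sum_subtractf)

lemma lin_0 [simp]: "lin n \<phi> 0 = 0"
  by (auto simp: lin_def)

lemma lin_cong: "(\<And>b. b < n \<Longrightarrow> \<phi> b = \<psi> b) \<Longrightarrow> lin n \<phi> u = lin n \<psi> u"
  by (auto simp: lin_def)

lemma lin_identity: "(\<And>b. b \<ge> n \<Longrightarrow> u b = 0) \<Longrightarrow> lin n unit_vec u = u"
proof
  fix a assume u: "\<And>b. b \<ge> n \<Longrightarrow> u b = 0"
  have "(\<Sum>b<n. u b * unit_vec b a) = (\<Sum>b<n. if b = a then u b else 0)"
    by (rule sum.cong) (auto simp: unit_vec_def)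
  then show "lin n unit_vec u a = u a" using u[of a] by (auto simp: lin_def)
qed

text \<open>Columns are cut off at the rank, since the entries of \<open>diff\<close> beyond it are
  arbitrary.\<close>

definition diff_column :: "('v, 'k::field) mpoly free_complex \<Rightarrow> nat \<Rightarrow> nat \<Rightarrow> nat \<Rightarrow> ('v, 'k) mpoly" where
  "diff_column R i b a = (if a < rank R i then diff R i a b else 0)"

lemma diff_map_eq: "diff_map R i u = lin (rank R (Suc i)) (diff_column R i) u"
  by (auto simp: diff_map_def lin_def diff_column_def fun_eq_iff mult.commute intro!: sum.cong)

definition graded_elem ::
    "('v::finite, 'k::field) mpoly free_complex \<Rightarrow> nat \<Rightarrow> nat \<Rightarrow> (nat \<Rightarrow> ('v, 'k) mpoly) \<Rightarrow> bool" where
  "graded_elem R i s u \<longleftrightarrow> u \<in> free_module R i \<and>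
     (\<forall>a. \<forall>t\<in>Poly_Mapping.keys (u a). shift R i a + mdegree t = s)"

text \<open>Treats the augmentation modulo I as the differential out of degree 0, so that exactness
  reads the same in all degrees.\<close>

definition resolution_cycle ::
    "('v, 'k::field) mpoly set \<Rightarrow> ('v, 'k) mpoly free_complex \<Rightarrow> nat \<Rightarrow> (nat \<Rightarrow> ('v, 'k) mpoly) \<Rightarrow> bool" where
  "resolution_cycle I R i u \<longleftrightarrow> (case i of 0 \<Rightarrow> aug_map R u \<in> I | Suc i' \<Rightarrow> diff_map R i' u = 0)"

definition graded_columns ::
    "('v::finite, 'k::field) mpoly free_complex \<Rightarrow> nat \<Rightarrow> ('v, 'k) mpoly free_complex \<Rightarrow> nat \<Rightarrow>
      (nat \<Rightarrow> nat \<Rightarrow> ('v, 'k) mpoly) \<Rightarrow> bool" where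
  "graded_columns R i R' i' \<phi> \<longleftrightarrow> (\<forall>b<rank R' i'. graded_elem R i (shift R' i' b) (\<phi> b))"

lemma graded_elem_diff: "graded_elem R i s u \<Longrightarrow> graded_elem R i s w \<Longrightarrow> graded_elem R i s (u - w)"
  unfolding graded_elem_def free_module_def in_keys_iff Ball_def
  by (auto simp: lookup_minus) (metis diff_zero)

lemma graded_elem_lin:
  assumes \<phi>: "graded_columns R i R' i' \<phi>" and u: "graded_elem R' i' s u"
  shows "graded_elem R i s (lin (rank R' i') \<phi> u)"
  unfolding graded_elem_def
proof (intro conjI allI ballI)
  show "lin (rank R' i') \<phi> u \<in> free_module R i"
    using \<phi> by (auto simp: graded_columns_def graded_elem_def free_module_def lin_def intro!: sum.neutral)
  fix a t assume "t \<in> Poly_Mapping.keys (lin (rank R' i') \<phi> u a)"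
  then obtain b where b: "b < rank R' i'" "t \<in> Poly_Mapping.keys (u b * \<phi> b a)"
    unfolding lin_def in_keys_iff lookup_sum by (metis (no_types, lifting) lessThan_iff sum.not_neutral_contains_not_neutral)
  then obtain x y where "x \<in> Poly_Mapping.keys (u b)" "y \<in> Poly_Mapping.keys (\<phi> b a)" "t = x + y"
    by (elim keys_times_subset)
  then show "shift R i a + mdegree t = s"
    using \<phi> u b(1) unfolding graded_columns_def graded_elem_def by (fastforce simp: mdegree_add)
qed

lemma graded_elem_graded_part:
  assumes "u \<in> free_module R i"
  shows "graded_elem R i s (\<lambda>b. graded_part (shift R i b) s (u b))"
proof -
  have "graded_part (shift R i b) s (u b) = 0" if "rank R i \<le> b" for b
    using assms that by (simp add: free_module_def graded_part_def)
  moreover have "shift R i b + mdegree t = s" if "t \<in> Poly_Mapping.keys (graded_part (shift R i b) s (u b))" for b t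
    using that unfolding in_keys_iff lookup_graded_part by argo
  ultimately show ?thesis by (auto simp: graded_elem_def free_module_def)
qed

lemma graded_elem_unit_vec: "b < rank R i \<Longrightarrow> graded_elem R i (shift R i b) (unit_vec b)"
  by (auto simp: graded_elem_def free_module_def unit_vec_def)

context
  fixes I :: "('v::finite, 'k::field) mpoly set" and R :: "('v, 'k) mpoly free_complex"
  assumes R: "graded_free_resolution I R"
begin

lemma diff_keys:
  "a < rank R i \<Longrightarrow> b < rank R (Suc i) \<Longrightarrow> t \<in> Poly_Mapping.keys (diff R i a b) \<Longrightarrow>
    shift R i a + mdegree t = shift R (Suc i) b"
  using R by (simp add: graded_free_resolution_def)

lemma graded_diff_column: "graded_columns R i R (Suc i) (diff_column R i)"
  using diff_keys by (auto simp: graded_columns_def graded_elem_def free_module_def diff_column_def split: if_splits)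

lemma resolution_cycles_eq: "{u \<in> free_module R i. resolution_cycle I R i u} = diff_map R i ` free_module R (Suc i)"
  using R by (cases i) (simp_all add: graded_free_resolution_def resolution_cycle_def zero_fun_def)

lemma diff_column_cycle: "b < rank R (Suc i) \<Longrightarrow> resolution_cycle I R i (diff_column R i b)"
proof -
  assume b: "b < rank R (Suc i)"
  have "unit_vec b \<in> free_module R (Suc i)" using graded_elem_unit_vec[OF b] by (simp add: graded_elem_def)
  then have "diff_map R i (unit_vec b) \<in> {u \<in> free_module R i. resolution_cycle I R i u}"
    unfolding resolution_cycles_eq by blast
  then show ?thesis unfolding diff_map_eq lin_unit_vec[OF b] by simp
qed

text \<open>Any preimage may be replaced by its component of degree s, as the differential preserves
  degrees and u is homogeneous of degree s.\<close>

lemma graded_preimage: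
  assumes u: "graded_elem R i s u" "resolution_cycle I R i u"
  obtains w where "graded_elem R (Suc i) s w" "diff_map R i w = u"
proof -
  have "u \<in> {u \<in> free_module R i. resolution_cycle I R i u}" using u by (simp add: graded_elem_def)
  then obtain w where w: "w \<in> free_module R (Suc i)" "diff_map R i w = u"
    unfolding resolution_cycles_eq by blast
  define w' where "w' b = graded_part (shift R (Suc i) b) s (w b)" for b
  have "graded_elem R (Suc i) s w'"
    unfolding w'_def using w(1) by (rule graded_elem_graded_part)
  moreover have "diff_map R i w' = u"
  proof
    fix a
    have "diff_map R i w' a = (if a < rank R i then
        \<Sum>b<rank R (Suc i). graded_part (shift R i a) s (diff R i a b * w b) else 0)"
      unfolding diff_map_def w'_def using diff_keys by (auto intro!: sum.cong graded_part_times)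
    also have "\<dots> = (if a < rank R i then graded_part (shift R i a) s (diff_map R i w a) else 0)"
      by (simp add: diff_map_def graded_part_sum)
    also have "\<dots> = u a"
      unfolding w(2) using u(1) by (auto simp: graded_elem_def free_module_def intro: graded_part_id)
    finally show "diff_map R i w' a = u a" .
  qed
  ultimately show thesis using that by blast
qed

end

locale resolution_pair =
  fixes I :: "('v::finite, 'k::field) mpoly set" and R R' :: "('v, 'k) mpoly free_complex"
  assumes ideal: "ring_module.subspace I"
    and graded: "\<And>f s. f \<in> I \<Longrightarrow> graded_part 0 s f \<in> I"
    and R: "graded_free_resolution I R" and R': "graded_free_resolution I R'"
begin

definition chain_map :: "(nat \<Rightarrow> nat \<Rightarrow> nat \<Rightarrow> ('v, 'k) mpoly) \<Rightarrow> bool" where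
  "chain_map \<phi> \<longleftrightarrow> (\<forall>i. graded_columns R i R' i (\<phi> i)) \<and>
     (\<forall>u. aug_map R (lin (rank R' 0) (\<phi> 0) u) - aug_map R' u \<in> I) \<and>
     (\<forall>i u. diff_map R i (lin (rank R' (Suc i)) (\<phi> (Suc i)) u) = lin (rank R' i) (\<phi> i) (diff_map R' i u))"

text \<open>The lifting half of the comparison theorem. The invariant \<open>P\<close> carries along
  that cycles go to cycles, which is what the next lifting step needs.\<close>

lemma chain_map_exists: "\<exists>\<phi>. chain_map \<phi>"
proof -
  define P where "P n \<phi> \<longleftrightarrow> graded_columns R n R' n \<phi> \<and>
      (\<forall>u. resolution_cycle I R' n u \<longrightarrow> resolution_cycle I R n (lin (rank R' n) \<phi> u)) \<and>
      (n = 0 \<longrightarrow> (\<forall>u. aug_map R (lin (rank R' 0) \<phi> u) - aug_map R' u \<in> I))" for n \<phi>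
  define Q where "Q n \<phi> \<psi> \<longleftrightarrow>
      (\<forall>u. diff_map R n (lin (rank R' (Suc n)) \<psi> u) = lin (rank R' n) \<phi> (diff_map R' n u))" for n \<phi> \<psi>
  have "\<exists>\<phi>. \<forall>n. P n (\<phi> n) \<and> Q n (\<phi> n) (\<phi> (Suc n))"
  proof (rule dependent_nat_choice)
    have "\<exists>u. graded_elem R 0 (shift R' 0 b) u \<and> aug_map R u - aug R' b \<in> I" if b: "b < rank R' 0" for b
    proof -
      let ?s = "shift R' 0 b"
      obtain u where u: "u \<in> free_module R 0" "aug R' b - aug_map R u \<in> I"
      proof -
        have "\<forall>f. \<exists>u\<in>free_module R 0. f - aug_map R u \<in> I" using R unfolding graded_free_resolution_def by (elim conjE)
        then show thesis using that by blast
      qed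
      define w where "w c = graded_part (shift R 0 c) ?s (u c)" for c
      have aug: "homogeneous (shift R 0 c) (aug R c)" if "c < rank R 0" for c
        using R that by (simp add: graded_free_resolution_def)
      have augw: "aug_map R w = graded_part 0 ?s (aug_map R u)"
        unfolding aug_map_def w_def graded_part_sum using aug
        by (intro sum.cong graded_part_times) (auto simp: homogeneous_def)
      have "homogeneous ?s (aug R' b)" using R' b by (simp add: graded_free_resolution_def)
      then have "graded_part 0 ?s (aug R' b) = aug R' b" by (intro graded_part_id) (simp add: homogeneous_def)
      then have "graded_part 0 ?s (aug R' b - aug_map R u) = aug R' b - aug_map R w"
        unfolding graded_part_diff augw by simp
      then have "aug R' b - aug_map R w \<in> I" using graded[OF u(2), of ?s] by simp
      then have "aug_map R w - aug R' b \<in> I" using ring_module.subspace_neg[OF ideal] by fastforce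
      moreover have "graded_elem R 0 ?s w"
        unfolding w_def using u(1) by (rule graded_elem_graded_part)
      ultimately show ?thesis by blast
    qed
    then obtain \<phi> where \<phi>: "\<And>b. b < rank R' 0 \<Longrightarrow> graded_elem R 0 (shift R' 0 b) (\<phi> b) \<and> aug_map R (\<phi> b) - aug R' b \<in> I"
      by metis
    have aug: "aug_map R (lin (rank R' 0) \<phi> u) - aug_map R' u \<in> I" for u
    proof -
      have "aug_map R (lin (rank R' 0) \<phi> u) = (\<Sum>c<rank R 0. \<Sum>b<rank R' 0. u b * (aug R c * \<phi> b c))"
        unfolding aug_map_def lin_def sum_distrib_left by (intro sum.cong refl mult.left_commute)
      also have "\<dots> = (\<Sum>b<rank R' 0. u b * aug_map R (\<phi> b))"
        unfolding aug_map_def sum_distrib_left by (rule sum.swap)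
      finally have "aug_map R (lin (rank R' 0) \<phi> u) - aug_map R' u = (\<Sum>b<rank R' 0. u b * (aug_map R (\<phi> b) - aug R' b))"
        by (simp add: aug_map_def[of R'] algebra_simps sum_subtractf)
      also have "\<dots> \<in> I" using \<phi> by (intro ring_module.subspace_sum[OF ideal] ring_module.subspace_scale[OF ideal]) auto
      finally show ?thesis .
    qed
    have "resolution_cycle I R 0 (lin (rank R' 0) \<phi> u)" if "resolution_cycle I R' 0 u" for u
    proof -
      have "aug_map R (lin (rank R' 0) \<phi> u) = (aug_map R (lin (rank R' 0) \<phi> u) - aug_map R' u) + aug_map R' u" by simp
      also have "\<dots> \<in> I"
        by (rule ring_module.subspace_add[OF ideal aug]) (use that in \<open>simp add: resolution_cycle_def\<close>)
      finally show ?thesis by (simp add: resolution_cycle_def)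
    qed
    then have "P 0 \<phi>" using \<phi> aug by (auto simp: P_def graded_columns_def)
    then show "\<exists>\<phi>. P 0 \<phi>" by blast
  next
    fix \<phi> n assume P: "P n \<phi>"
    have "\<exists>w. graded_elem R (Suc n) (shift R' (Suc n) b) w \<and> diff_map R n w = lin (rank R' n) \<phi> (diff_column R' n b)"
      if b: "b < rank R' (Suc n)" for b
    proof -
      have "graded_elem R n (shift R' (Suc n) b) (lin (rank R' n) \<phi> (diff_column R' n b))"
        using P graded_diff_column[OF R'] b unfolding P_def by (intro graded_elem_lin) (auto simp: graded_columns_def)
      moreover have "resolution_cycle I R n (lin (rank R' n) \<phi> (diff_column R' n b))"
        using P diff_column_cycle[OF R' b] unfolding P_def by blast
      ultimately show ?thesis using graded_preimage[OF R] by metis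
    qed
    then obtain \<psi> where \<psi>: "\<And>b. b < rank R' (Suc n) \<Longrightarrow> graded_elem R (Suc n) (shift R' (Suc n) b) (\<psi> b) \<and>
        diff_map R n (\<psi> b) = lin (rank R' n) \<phi> (diff_column R' n b)" by metis
    have Q: "Q n \<phi> \<psi>"
      unfolding Q_def diff_map_eq lin_lin using \<psi> by (auto intro!: lin_cong simp: diff_map_eq[symmetric])
    moreover have "P (Suc n) \<psi>"
      using \<psi> Q unfolding P_def Q_def graded_columns_def by (auto simp: resolution_cycle_def)
    ultimately show "\<exists>\<psi>. P (Suc n) \<psi> \<and> Q n \<phi> \<psi>" by blast
  qed
  then obtain \<phi> where \<phi>: "\<And>n. P n (\<phi> n)" "\<And>n. Q n (\<phi> n) (\<phi> (Suc n))" by blast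
  have "chain_map \<phi>"
    unfolding chain_map_def
  proof (intro conjI allI)
    show "graded_columns R i R' i (\<phi> i)" for i using \<phi>(1)[of i] by (simp add: P_def)
    show "aug_map R (lin (rank R' 0) (\<phi> 0) u) - aug_map R' u \<in> I" for u
      using \<phi>(1)[of 0] by (simp add: P_def)
    show "diff_map R i (lin (rank R' (Suc i)) (\<phi> (Suc i)) u) = lin (rank R' i) (\<phi> i) (diff_map R' i u)" for i u
      using \<phi>(2)[of i] by (simp add: Q_def)
  qed
  then show ?thesis by blast
qed

end

text \<open>The uniqueness half, for a self-map lifting the identity of S/I: \<chi> - id is
  null-homotopic.\<close>

lemma chain_homotopy_exists:
  fixes I :: "('v::finite, 'k::field) mpoly set"
  assumes I: "ring_module.subspace I" and R: "graded_free_resolution I R"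
    and \<chi>: "\<And>i. graded_columns R i R i (\<chi> i)"
    and aug: "\<And>u. aug_map R (lin (rank R 0) (\<chi> 0) u) - aug_map R u \<in> I"
    and comm: "\<And>i u. diff_map R i (lin (rank R (Suc i)) (\<chi> (Suc i)) u) = lin (rank R i) (\<chi> i) (diff_map R i u)"
  shows "\<exists>h. (\<forall>i. graded_columns R (Suc i) R i (h i)) \<and>
    (\<forall>u\<in>free_module R 0. diff_map R 0 (lin (rank R 0) (h 0) u) = lin (rank R 0) (\<chi> 0) u - u) \<and>
    (\<forall>i. \<forall>u\<in>free_module R (Suc i). diff_map R (Suc i) (lin (rank R (Suc i)) (h (Suc i)) u) =
      lin (rank R (Suc i)) (\<chi> (Suc i)) u - u - lin (rank R i) (h i) (diff_map R i u))"
proof -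
  \<comment> \<open>In positive degrees the identity is claimed on cycles, where the term through
    the previous homotopy drops out; that is what the next step uses, while \<open>Q\<close> records
    the full identity.\<close>
  define P where "P n h \<longleftrightarrow> graded_columns R (Suc n) R n h \<and>
      (\<forall>u\<in>free_module R n. n = 0 \<or> resolution_cycle I R n u \<longrightarrow>
         diff_map R n (lin (rank R n) h u) = lin (rank R n) (\<chi> n) u - u)" for n h
  define Q where "Q n h h' \<longleftrightarrow> (\<forall>u\<in>free_module R (Suc n).
      diff_map R (Suc n) (lin (rank R (Suc n)) h' u) =
      lin (rank R (Suc n)) (\<chi> (Suc n)) u - u - lin (rank R n) h (diff_map R n u))" for n h h'
  have "\<exists>h. \<forall>n. P n (h n) \<and> Q n (h n) (h (Suc n))"
  proof (rule dependent_nat_choice)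
    have "\<exists>w. graded_elem R 1 (shift R 0 b) w \<and> diff_map R 0 w = \<chi> 0 b - unit_vec b" if b: "b < rank R 0" for b
    proof -
      have "graded_elem R 0 (shift R 0 b) (\<chi> 0 b - unit_vec b)"
        using \<chi>[of 0] b by (intro graded_elem_diff graded_elem_unit_vec) (auto simp: graded_columns_def)
      moreover have "aug_map R (\<chi> 0 b - unit_vec b) = aug_map R (lin (rank R 0) (\<chi> 0) (unit_vec b)) - aug_map R (unit_vec b)"
        unfolding lin_unit_vec[OF b] by (simp add: aug_map_def algebra_simps sum_subtractf)
      then have "resolution_cycle I R 0 (\<chi> 0 b - unit_vec b)" using aug by (simp add: resolution_cycle_def)
      ultimately show ?thesis using graded_preimage[OF R] by (metis One_nat_def)
    qed
    then obtain h where h: "\<And>b. b < rank R 0 \<Longrightarrow> graded_elem R 1 (shift R 0 b) (h b) \<and> diff_map R 0 (h b) = \<chi> 0 b - unit_vec b"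
      by metis
    have "diff_map R 0 (lin (rank R 0) h u) = lin (rank R 0) (\<chi> 0) u - u" if "u \<in> free_module R 0" for u
    proof -
      have "diff_map R 0 (lin (rank R 0) h u) = lin (rank R 0) (\<lambda>b. \<chi> 0 b - unit_vec b) u"
        unfolding diff_map_eq lin_lin using h by (auto intro!: lin_cong simp: diff_map_eq[symmetric])
      also have "\<dots> = lin (rank R 0) (\<chi> 0) u - lin (rank R 0) unit_vec u" by (rule lin_diff_columns)
      also have "lin (rank R 0) unit_vec u = u" using that by (intro lin_identity) (simp add: free_module_def)
      finally show ?thesis .
    qed
    then have "P 0 h" using h by (simp add: P_def graded_columns_def)
    then show "\<exists>h. P 0 h" by blast
  next
    fix h n assume P: "P n h"
    let ?col = "\<lambda>b. \<chi> (Suc n) b - unit_vec b - lin (rank R n) h (diff_column R n b)"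
    have "\<exists>w. graded_elem R (Suc (Suc n)) (shift R (Suc n) b) w \<and> diff_map R (Suc n) w = ?col b"
      if b: "b < rank R (Suc n)" for b
    proof -
      have col: "graded_elem R n (shift R (Suc n) b) (diff_column R n b)"
        using graded_diff_column[OF R] b by (simp add: graded_columns_def)
      have "graded_elem R (Suc n) (shift R (Suc n) b) (?col b)"
        using \<chi>[of "Suc n"] b col P unfolding P_def
        by (intro graded_elem_diff graded_elem_unit_vec graded_elem_lin) (auto simp: graded_columns_def)
      moreover have "diff_map R n (?col b) = 0"
      proof -
        have "diff_map R n (?col b) = diff_map R n (\<chi> (Suc n) b) - diff_map R n (unit_vec b)
            - diff_map R n (lin (rank R n) h (diff_column R n b))"
          unfolding diff_map_eq lin_diff ..
        also have "diff_map R n (\<chi> (Suc n) b) = lin (rank R n) (\<chi> n) (diff_column R n b)"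
          using comm[of n "unit_vec b"] unfolding lin_unit_vec[OF b] unfolding diff_map_eq lin_unit_vec[OF b] .
        also have "diff_map R n (unit_vec b) = diff_column R n b" unfolding diff_map_eq lin_unit_vec[OF b] ..
        also have "diff_map R n (lin (rank R n) h (diff_column R n b)) =
            lin (rank R n) (\<chi> n) (diff_column R n b) - diff_column R n b"
          using P diff_column_cycle[OF R b] col unfolding P_def graded_elem_def by blast
        finally show ?thesis by (simp only: diff_self)
      qed
      then have "resolution_cycle I R (Suc n) (?col b)" by (simp only: resolution_cycle_def nat.case)
      ultimately show ?thesis using graded_preimage[OF R] by metis
    qed
    then obtain h' where h': "\<And>b. b < rank R (Suc n) \<Longrightarrow> graded_elem R (Suc (Suc n)) (shift R (Suc n) b) (h' b) \<and>
       diff_map R (Suc n) (h' b) = ?col b" by metis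
    have Q: "Q n h h'"
      unfolding Q_def
    proof
      fix u assume u: "u \<in> free_module R (Suc n)"
      have "diff_map R (Suc n) (lin (rank R (Suc n)) h' u) = lin (rank R (Suc n)) ?col u"
        unfolding diff_map_eq lin_lin using h' by (auto intro!: lin_cong simp: diff_map_eq[symmetric])
      also have "\<dots> = lin (rank R (Suc n)) (\<chi> (Suc n)) u - lin (rank R (Suc n)) unit_vec u
          - lin (rank R n) h (diff_map R n u)"
        unfolding lin_diff_columns diff_map_eq lin_lin ..
      also have "lin (rank R (Suc n)) unit_vec u = u" using u by (intro lin_identity) (simp add: free_module_def)
      finally show "diff_map R (Suc n) (lin (rank R (Suc n)) h' u) =
          lin (rank R (Suc n)) (\<chi> (Suc n)) u - u - lin (rank R n) h (diff_map R n u)" .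
    qed
    moreover have "P (Suc n) h'"
      using h' Q unfolding P_def Q_def graded_columns_def by (auto simp: resolution_cycle_def)
    ultimately show "\<exists>h'. P (Suc n) h' \<and> Q n h h'" by blast
  qed
  then obtain h where h: "\<And>n. P n (h n)" "\<And>n. Q n (h n) (h (Suc n))" by blast
  then show ?thesis unfolding P_def Q_def by blast
qed

section \<open>Reduction of resolutions modulo the maximal ideal\<close>

definition const_part :: "(nat \<Rightarrow> ('v, 'k::field) mpoly) \<Rightarrow> nat \<Rightarrow> 'k" where
  "const_part u a = Poly_Mapping.lookup (u a) 0"

definition const_vec :: "(nat \<Rightarrow> 'k::field) \<Rightarrow> nat \<Rightarrow> ('v, 'k) mpoly" where
  "const_vec u a = Poly_Mapping.single 0 (u a)"

text \<open>Exponents are natural numbers, so only constants multiply to a constant. Hence taking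
  constant terms turns \<open>diff_map\<close> into \<open>tensor_diff\<close>.\<close>

lemma lookup_times_zero:
  fixes f g :: "('v, 'k::field) mpoly"
  shows "Poly_Mapping.lookup (f * g) 0 = Poly_Mapping.lookup f 0 * Poly_Mapping.lookup g 0"
proof -
  have *: "Poly_Mapping.lookup (Poly_Mapping.single x c * g) 0 = (if x = 0 then c * Poly_Mapping.lookup g 0 else 0)" for x c
  proof (cases "x = 0")
    case True
    then show ?thesis by (simp add: lookup_scalar_times)
  next
    case False
    have "0 \<noteq> x + u" for u :: "'v \<Rightarrow>\<^sub>0 nat"
    proof
      assume "0 = x + u"
      then have "Poly_Mapping.keys x \<union> Poly_Mapping.keys u = {}" by (metis keys_plus_nat keys_zero)
      then have "x = 0" by (intro poly_mapping_eqI) (auto simp: in_keys_iff)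
      with False show False ..
    qed
    then show ?thesis using False by (simp add: lookup_single_times(2))
  qed
  have "Poly_Mapping.lookup (f * g) 0 =
      (\<Sum>x\<in>Poly_Mapping.keys f. if x = 0 then Poly_Mapping.lookup f 0 * Poly_Mapping.lookup g 0 else 0)"
    by (subst (1) poly_mapping_expansion[of f]) (auto simp: sum_distrib_right lookup_sum * intro!: sum.cong)
  then show ?thesis by (simp add: in_keys_iff)
qed

lemma const_part_const_vec [simp]: "const_part (const_vec u) = u"
  by (auto simp: const_part_def const_vec_def)

lemma const_part_lin: "const_part (lin n \<phi> u) = lin n (\<lambda>b. const_part (\<phi> b)) (const_part u)"
  by (auto simp: const_part_def lin_def lookup_sum lookup_times_zero)

lemma const_part_diff: "const_part (u - w) = const_part u - const_part w"
  by (auto simp: const_part_def lookup_minus)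

lemma const_part_diff_map: "const_part (diff_map R i u) = tensor_diff R i (const_part u)"
  by (auto simp: const_part_def diff_map_def tensor_diff_def lookup_sum lookup_times_zero fun_eq_iff)

lemma graded_elem_const_vec: "u \<in> tensor_module R i j \<Longrightarrow> graded_elem R i j (const_vec u)"
  unfolding graded_elem_def tensor_module_def free_module_def const_vec_def
  by (auto split: if_splits) (metis leD single_zero)

lemma const_part_tensor_module: "graded_elem R i j u \<Longrightarrow> const_part u \<in> tensor_module R i j"
  unfolding tensor_module_def mem_Collect_eq
proof (intro allI impI)
  fix b assume u: "graded_elem R i j u" and b: "const_part u b \<noteq> 0"
  then have 0: "0 \<in> Poly_Mapping.keys (u b)" by (simp add: const_part_def in_keys_iff)
  with u have "shift R i b + mdegree (0 :: 'a \<Rightarrow>\<^sub>0 nat) = j" unfolding graded_elem_def by blast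
  moreover have "u b = 0" if "rank R i \<le> b" using u that by (simp add: graded_elem_def free_module_def)
  ultimately show "b < rank R i \<and> shift R i b = j" using 0 by fastforce
qed

lemma tensor_module_diff: "u \<in> tensor_module R i j \<Longrightarrow> w \<in> tensor_module R i j \<Longrightarrow> u - w \<in> tensor_module R i j"
  unfolding tensor_module_def mem_Collect_eq minus_apply by (metis diff_zero)

lemma tensor_diff_diff: "tensor_diff R i (u - w) = tensor_diff R i u - tensor_diff R i w"
  by (auto simp: tensor_diff_def fun_eq_iff algebra_simps sum_subtractf)

text \<open>The homotopy equivalence of two resolutions survives tensoring with k, so exactness in a
  single bidegree passes from one to the other.\<close>

theorem tensor_exact_transfer:
  fixes I :: "('v::finite, 'k::field) mpoly set"
  assumes "resolution_pair I R R'"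
    and exact: "tensor_cycles R i j \<subseteq> tensor_boundaries R i j"
  shows "tensor_cycles R' i j \<subseteq> tensor_boundaries R' i j"
proof
  interpret resolution_pair I R R' by (rule assms)
  interpret opp: resolution_pair I R' R using R R' graded ideal by unfold_locales
  obtain \<phi> where \<phi>: "chain_map \<phi>" using chain_map_exists by blast
  obtain \<psi> where \<psi>: "opp.chain_map \<psi>" using opp.chain_map_exists by blast
  note \<phi>D = \<phi>[unfolded chain_map_def] and \<psi>D = \<psi>[unfolded opp.chain_map_def]
  define \<chi> where "\<chi> i b = lin (rank R i) (\<psi> i) (\<phi> i b)" for i b
  have lin_\<chi>: "lin (rank R' i) (\<chi> i) u = lin (rank R i) (\<psi> i) (lin (rank R' i) (\<phi> i) u)" for i u
    unfolding lin_lin \<chi>_def ..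
  have "\<exists>h. (\<forall>i. graded_columns R' (Suc i) R' i (h i)) \<and>
    (\<forall>u\<in>free_module R' 0. diff_map R' 0 (lin (rank R' 0) (h 0) u) = lin (rank R' 0) (\<chi> 0) u - u) \<and>
    (\<forall>i. \<forall>u\<in>free_module R' (Suc i). diff_map R' (Suc i) (lin (rank R' (Suc i)) (h (Suc i)) u) =
      lin (rank R' (Suc i)) (\<chi> (Suc i)) u - u - lin (rank R' i) (h i) (diff_map R' i u))"
  proof (rule chain_homotopy_exists[OF ideal R', of \<chi>])
    show "graded_columns R' i R' i (\<chi> i)" for i
      using \<phi>D \<psi>D unfolding \<chi>_def graded_columns_def by (auto intro!: graded_elem_lin simp: graded_columns_def)
    show "aug_map R' (lin (rank R' 0) (\<chi> 0) u) - aug_map R' u \<in> I" for u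
    proof -
      have "aug_map R' (lin (rank R' 0) (\<chi> 0) u) - aug_map R' u =
         (aug_map R' (lin (rank R 0) (\<psi> 0) (lin (rank R' 0) (\<phi> 0) u)) - aug_map R (lin (rank R' 0) (\<phi> 0) u)) +
         (aug_map R (lin (rank R' 0) (\<phi> 0) u) - aug_map R' u)"
        unfolding lin_\<chi> by simp
      also have "\<dots> \<in> I" using \<phi>D \<psi>D by (intro ring_module.subspace_add[OF ideal]) auto
      finally show ?thesis .
    qed
    show "diff_map R' i (lin (rank R' (Suc i)) (\<chi> (Suc i)) u) = lin (rank R' i) (\<chi> i) (diff_map R' i u)" for i u
      unfolding lin_\<chi> using \<phi>D \<psi>D by simp
  qed
  then obtain h where h: "\<And>i. graded_columns R' (Suc i) R' i (h i)"
    and h0: "\<And>u. u \<in> free_module R' 0 \<Longrightarrow> diff_map R' 0 (lin (rank R' 0) (h 0) u) = lin (rank R' 0) (\<chi> 0) u - u"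
    and hS: "\<And>i u. u \<in> free_module R' (Suc i) \<Longrightarrow> diff_map R' (Suc i) (lin (rank R' (Suc i)) (h (Suc i)) u) =
      lin (rank R' (Suc i)) (\<chi> (Suc i)) u - u - lin (rank R' i) (h i) (diff_map R' i u)"
    by blast
  fix z assume z: "z \<in> tensor_cycles R' i j"
  define \<zeta> :: "nat \<Rightarrow> ('v, 'k) mpoly" where "\<zeta> = const_vec z"
  have cz: "const_part \<zeta> = z" by (simp add: \<zeta>_def)
  have zm: "z \<in> tensor_module R' i j" using z by (cases i) (auto simp: tensor_cycles_def)
  then have \<zeta>: "graded_elem R' i j \<zeta>" "\<zeta> \<in> free_module R' i"
    using graded_elem_const_vec unfolding \<zeta>_def by (auto simp: graded_elem_def)
  \<comment> \<open>The lift \<zeta> of z need not be a cycle of R'. Its differential merely has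
    zero constant part, which every further map preserves.\<close>
  have closed: "const_part (diff_map R' i' \<zeta>) = 0" if "i = Suc i'" for i'
    using z that unfolding const_part_diff_map cz by (simp add: tensor_cycles_def zero_fun_def)
  define x where "x = const_part (lin (rank R' i) (\<phi> i) \<zeta>)"
  have xm: "x \<in> tensor_module R i j"
    unfolding x_def using \<phi>D \<zeta> by (intro const_part_tensor_module graded_elem_lin) auto
  have "x \<in> tensor_cycles R i j"
  proof (cases i)
    case (Suc i')
    have "tensor_diff R i' x = const_part (lin (rank R' i') (\<phi> i') (diff_map R' i' \<zeta>))"
      using \<phi>D unfolding x_def const_part_diff_map[symmetric] Suc by simp
    also have "\<dots> = 0" unfolding const_part_lin closed[OF Suc] by simp
    finally show ?thesis using xm by (simp add: tensor_cycles_def Suc zero_fun_def)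
  qed (use xm in \<open>simp add: tensor_cycles_def\<close>)
  then obtain w where w: "w \<in> tensor_module R (Suc i) j" "x = tensor_diff R i w"
    using exact by (auto simp: tensor_boundaries_def)
  define \<omega> :: "nat \<Rightarrow> ('v, 'k) mpoly" where "\<omega> = const_vec w"
  \<comment> \<open>Modulo the maximal ideal, y1 bounds \<psi>(\<phi> z) and y2 bounds \<psi>(\<phi>
    z) - z by the homotopy, so y1 - y2 bounds z.\<close>
  define y1 where "y1 = const_part (lin (rank R (Suc i)) (\<psi> (Suc i)) \<omega>)"
  define y2 where "y2 = const_part (lin (rank R' i) (h i) \<zeta>)"
  have y1: "y1 \<in> tensor_module R' (Suc i) j"
    unfolding y1_def \<omega>_def using \<psi>D w(1) by (intro const_part_tensor_module graded_elem_lin graded_elem_const_vec) auto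
  have y2: "y2 \<in> tensor_module R' (Suc i) j"
    unfolding y2_def using h \<zeta>(1) by (intro const_part_tensor_module graded_elem_lin) auto
  have "tensor_diff R' i y1 = const_part (lin (rank R i) (\<psi> i) (diff_map R i \<omega>))"
    unfolding y1_def const_part_diff_map[symmetric] using \<psi>D by simp
  also have "\<dots> = const_part (lin (rank R' i) (\<chi> i) \<zeta>)"
    unfolding lin_\<chi> const_part_lin[of _ "\<psi> i"] x_def[symmetric] const_part_diff_map \<omega>_def w(2) by simp
  finally have 1: "tensor_diff R' i y1 = const_part (lin (rank R' i) (\<chi> i) \<zeta>)" .
  have 2: "tensor_diff R' i y2 = const_part (lin (rank R' i) (\<chi> i) \<zeta>) - z"
  proof (cases i)
    case 0
    then show ?thesis
      unfolding y2_def const_part_diff_map[symmetric] using h0 \<zeta>(2) cz by (simp add: const_part_diff)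
  next
    case (Suc i')
    have "const_part (lin (rank R' i') (h i') (diff_map R' i' \<zeta>)) = 0"
      unfolding const_part_lin closed[OF Suc] by simp
    then show ?thesis
      unfolding y2_def const_part_diff_map[symmetric] using hS \<zeta>(2) cz Suc by (simp add: const_part_diff)
  qed
  have "z = tensor_diff R' i (y1 - y2)" unfolding tensor_diff_diff 1 2 by simp
  then show "z \<in> tensor_boundaries R' i j"
    using tensor_module_diff[OF y1 y2] by (auto simp: tensor_boundaries_def)
qed

section \<open>Disjoint pairs of vertex sets as cells, and their cochains in each
  multidegree\<close>

section \<open>An explicit resolution of the Stanley--Reisner ring\<close>

definition fpart :: "('v \<times> bool) set \<Rightarrow> 'v set" where "fpart \<sigma> = {v. (v, False) \<in> \<sigma>}"
definition gpart :: "('v \<times> bool) set \<Rightarrow> 'v set" where "gpart \<sigma> = {v. (v, True) \<in> \<sigma>}"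

text \<open>A pair (F, G) is encoded as one set of tagged vertices, so the cells again form a set
  system to which the cochain machinery applies. Signs come from the lexicographic order on
  pairs.\<close>

definition pair_cells :: "'v set set \<Rightarrow> ('v \<times> bool) set set" where
  "pair_cells \<Delta> = {\<sigma>. fpart \<sigma> \<in> \<Delta> \<and> fpart \<sigma> \<inter> gpart \<sigma> = {}}"

text \<open>The basis vectors that contribute to a multidegree with support A: the degree V - G of
  the cell has to be contained in A.\<close>

definition cells_over :: "'v set set \<Rightarrow> 'v set \<Rightarrow> ('v \<times> bool) set set" where
  "cells_over \<Delta> A = {\<sigma> \<in> pair_cells \<Delta>. - A \<subseteq> gpart \<sigma>}"

lemma fg_eq: "fpart \<sigma> = fpart \<tau> \<Longrightarrow> gpart \<sigma> = gpart \<tau> \<Longrightarrow> \<sigma> = \<tau>"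
  unfolding fpart_def gpart_def by (intro set_eqI, case_tac x, case_tac b) auto

lemma fpart_mono: "\<sigma> \<subseteq> \<tau> \<Longrightarrow> fpart \<sigma> \<subseteq> fpart \<tau>" and gpart_mono: "\<sigma> \<subseteq> \<tau> \<Longrightarrow> gpart \<sigma> \<subseteq> gpart \<tau>"
  by (auto simp: fpart_def gpart_def)

lemma parts_insert [simp]:
  "fpart (insert (v, False) \<sigma>) = insert v (fpart \<sigma>)" "gpart (insert (v, False) \<sigma>) = gpart \<sigma>"
  "fpart (insert (v, True) \<sigma>) = fpart \<sigma>" "gpart (insert (v, True) \<sigma>) = insert v (gpart \<sigma>)"
  by (auto simp: fpart_def gpart_def)

lemma parts_remove [simp]:
  "fpart (\<sigma> - {(v, False)}) = fpart \<sigma> - {v}" "gpart (\<sigma> - {(v, False)}) = gpart \<sigma>"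
  "fpart (\<sigma> - {(v, True)}) = fpart \<sigma>" "gpart (\<sigma> - {(v, True)}) = gpart \<sigma> - {v}"
  by (auto simp: fpart_def gpart_def)

lemma cell_decomp: "\<sigma> = (\<lambda>v. (v, False)) ` fpart \<sigma> \<union> (\<lambda>v. (v, True)) ` gpart \<sigma>"
proof (intro set_eqI)
  fix x :: "'a \<times> bool"
  obtain v b where "x = (v, b)" by (cases x)
  then show "x \<in> \<sigma> \<longleftrightarrow> x \<in> (\<lambda>v. (v, False)) ` fpart \<sigma> \<union> (\<lambda>v. (v, True)) ` gpart \<sigma>"
    by (cases b) (auto simp: fpart_def gpart_def)
qed

lemma card_cell:
  fixes \<sigma> :: "('v::finite \<times> bool) set"
  shows "card \<sigma> = card (fpart \<sigma>) + card (gpart \<sigma>)"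
proof -
  have "card \<sigma> = card ((\<lambda>v. (v, False)) ` fpart \<sigma> \<union> (\<lambda>v. (v, True)) ` gpart \<sigma>)"
    using cell_decomp[of \<sigma>] by simp
  also have "\<dots> = card ((\<lambda>v. (v, False)) ` fpart \<sigma>) + card ((\<lambda>v. (v, True)) ` gpart \<sigma>)"
    by (rule card_Un_disjoint) auto
  also have "\<dots> = card (fpart \<sigma>) + card (gpart \<sigma>)"
    by (simp add: card_image inj_on_def)
  finally show ?thesis .
qed

lemma card_pair_cell:
  fixes \<sigma> :: "('v::finite \<times> bool) set"
  assumes "\<sigma> \<in> pair_cells \<Delta>"
  shows "card \<sigma> = card (fpart \<sigma> \<union> gpart \<sigma>)" and "card \<sigma> \<le> CARD('v)"
proof -
  show *: "card \<sigma> = card (fpart \<sigma> \<union> gpart \<sigma>)"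
    using assms unfolding card_cell pair_cells_def by (simp add: card_Un_disjoint)
  show "card \<sigma> \<le> CARD('v)" unfolding * by (simp add: card_mono)
qed

lemma top_cell:
  fixes \<sigma> :: "('v::finite \<times> bool) set"
  assumes "\<sigma> \<in> pair_cells \<Delta>" "card \<sigma> = CARD('v)"
  shows "gpart \<sigma> = - fpart \<sigma>"
proof -
  have "fpart \<sigma> \<union> gpart \<sigma> = UNIV"
    using card_pair_cell(1)[OF assms(1)] assms(2) by (metis card_subset_eq finite subset_UNIV)
  then show ?thesis using assms(1) unfolding pair_cells_def by blast
qed

text \<open>The augmentation in a multidegree with support A: the top cells are the pairs (F, V - F)
  with F \<subseteq> A, and all of them map to multiples of the same monomial, with sign (-1)^(card
  F).\<close>

definition cell_augmentation :: "'v::finite set set \<Rightarrow> 'v set \<Rightarrow> (('v \<times> bool) set \<Rightarrow> 'k::field) \<Rightarrow> 'k" where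
  "cell_augmentation \<Delta> A c =
     (\<Sum>\<sigma> | \<sigma> \<in> cells_over \<Delta> A \<and> card \<sigma> = CARD('v). (-1) ^ card (fpart \<sigma>) * c \<sigma>)"

context
  fixes \<Delta> :: "'v::{finite,linorder} set set"
  assumes \<Delta>: "simplicial_complex \<Delta>"
begin

lemma face_sub: "F \<in> \<Delta> \<Longrightarrow> G \<subseteq> F \<Longrightarrow> G \<in> \<Delta>"
  using \<Delta> by (simp add: simplicial_complex_def)

lemma empty_face: "{} \<in> \<Delta>"
  using \<Delta> unfolding simplicial_complex_def by (metis empty_subsetI)

lemma pair_cells_sub: "\<sigma> \<in> pair_cells \<Delta> \<Longrightarrow> \<tau> \<subseteq> \<sigma> \<Longrightarrow> \<tau> \<in> pair_cells \<Delta>"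
  using fpart_mono[of \<tau> \<sigma>] gpart_mono[of \<tau> \<sigma>] face_sub unfolding pair_cells_def by blast

lemma convex_cells_over: "convex_family (cells_over \<Delta> A)"
  unfolding convex_family_def cells_over_def using pair_cells_sub gpart_mono by blast

lemma cells_over_fpart: "\<sigma> \<in> cells_over \<Delta> A \<Longrightarrow> fpart \<sigma> \<subseteq> A"
  by (auto simp: cells_over_def pair_cells_def)

text \<open>Pick v in A - B and cut by whether v belongs to F. If it does, B has grown. If not, v
  may be toggled in G, because a vertex of A is not forced to lie there, and a cone results.\<close>

lemma cells_below_top_acyclic:
  assumes "B \<subseteq> A"
  shows "acyclic_at TYPE('k::field) {\<sigma> \<in> cells_over \<Delta> A. B \<subseteq> fpart \<sigma> \<and> fpart \<sigma> \<noteq> A} i"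
  using assms
proof (induction "card (A - B)" arbitrary: B)
  case 0
  then have "A = B" by auto
  then show ?case by (intro acyclic_at_no_faces) (use cells_over_fpart in blast)
next
  case (Suc n)
  then obtain v where v: "v \<in> A" "v \<notin> B" by (metis Diff_eq_empty_iff card.empty nat.distinct(1) subsetI)
  let ?X = "{\<sigma> \<in> cells_over \<Delta> A. B \<subseteq> fpart \<sigma> \<and> fpart \<sigma> \<noteq> A}"
  let ?Y = "{\<sigma> \<in> cells_over \<Delta> A. insert v B \<subseteq> fpart \<sigma> \<and> fpart \<sigma> \<noteq> A}"
  let ?Z = "{\<sigma> \<in> ?X. v \<notin> fpart \<sigma>}"
  have "cut_family ?X ?Y ?Z"
  proof
    show "convex_family ?X"
      unfolding convex_family_def
    proof (intro ballI allI impI)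
      fix F H G assume FH: "F \<in> ?X" "H \<in> ?X" and G: "F \<subseteq> G \<and> G \<subseteq> H"
      have "G \<in> cells_over \<Delta> A" using FH G convex_cells_over unfolding convex_family_def by blast
      moreover have "B \<subseteq> fpart G" "fpart G \<noteq> A"
        using FH fpart_mono[of F G] fpart_mono[of G H] G cells_over_fpart[of H A] by auto
      ultimately show "G \<in> ?X" by simp
    qed
    show "G \<in> ?Y" if "F \<in> ?Y" "G \<in> ?X" "F \<subseteq> G" for F G
      using that fpart_mono[of F G] by auto
  qed auto
  moreover have "acyclic_at TYPE('k) ?Y i"
  proof (rule Suc.hyps(1))
    have "A - B = insert v (A - insert v B)" using v by auto
    then have "Suc n = Suc (card (A - insert v B))" using Suc.hyps(2) by simp
    then show "n = card (A - insert v B)" by simp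
  qed (use v Suc.prems in auto)
  moreover have "acyclic_at TYPE('k) ?Z i"
  proof (rule acyclic_cone[where v = "(v, True)"])
    fix F assume "F \<in> ?Z"
    then show "insert (v, True) F \<in> ?Z \<and> F - {(v, True)} \<in> ?Z"
      using v by (auto simp: cells_over_def pair_cells_def)
  qed
  ultimately show ?case by (rule cut_family.acyclic_whole)
qed

text \<open>A top cell contains exactly one of (w, False) and (w, True) for each w, so the position
  of a pair over v depends on v alone.\<close>

lemma incidence_sign_top_cell:
  assumes "\<sigma> \<in> pair_cells \<Delta>" "card \<sigma> = CARD('v)" "(v, b) \<in> \<sigma>"
  shows "incidence_sign (v, b) \<sigma> = (-1 :: 'k::comm_ring_1) ^ card {w. w < v}"
proof -
  have iff: "(w, True) \<in> \<sigma> \<longleftrightarrow> (w, False) \<notin> \<sigma>" for w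
    using top_cell[OF assms(1,2)] by (auto simp: fpart_def gpart_def)
  have "bij_betw fst {x \<in> \<sigma>. x < (v, b)} {w. w < v}"
  proof (intro bij_betw_imageI inj_onI)
    fix x y assume xy: "x \<in> {x \<in> \<sigma>. x < (v, b)}" "y \<in> {x \<in> \<sigma>. x < (v, b)}" "fst x = fst y"
    obtain w p q where "x = (w, p)" "y = (w, q)" using xy(3) by (cases x, cases y) auto
    then show "x = y" using xy(1,2) iff[of w] by (cases p; cases q) auto
  next
    show "fst ` {x \<in> \<sigma>. x < (v, b)} = {w. w < v}"
    proof (intro set_eqI iffI)
      fix w assume "w \<in> fst ` {x \<in> \<sigma>. x < (v, b)}"
      then obtain p where p: "(w, p) \<in> \<sigma>" "(w, p) < (v, b)" by auto
      have "w \<le> v" using p(2) by auto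
      moreover have "w \<noteq> v"
      proof
        assume "w = v"
        with p(2) have "p = False" "b = True" by auto
        then show False using p(1) assms(3) iff \<open>w = v\<close> by blast
      qed
      ultimately show "w \<in> {w. w < v}" by simp
    next
      fix w assume w: "w \<in> {w. w < v}"
      obtain p where "(w, p) \<in> \<sigma>" using iff[of w] by blast
      then show "w \<in> fst ` {x \<in> \<sigma>. x < (v, b)}" using w by (intro image_eqI[of _ _ "(w, p)"]) auto
    qed
  qed
  from bij_betw_same_card[OF this] show ?thesis by (simp add: incidence_sign_def)
qed

text \<open>A cell missing exactly the vertex v \<in> A lies in two top cells, with v put into F or
  into G. Their incidence signs agree and their augmentation signs are opposite; A \<in> \<Delta>
  ensures that both are cells.\<close>

lemma cell_augmentation_coboundary:
  fixes c :: "('v \<times> bool) set \<Rightarrow> 'k::field"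
  assumes A: "A \<in> \<Delta>" and c: "c \<in> cochains (cells_over \<Delta> A) i"
  shows "cell_augmentation \<Delta> A (coboundary (cells_over \<Delta> A) c) = 0"
proof -
  let ?T = "{\<sigma> \<in> cells_over \<Delta> A. card \<sigma> = CARD('v)}"
  define t where "t b p = (-1) ^ card (fpart (fst p)) *
      (incidence_sign (snd p, b) (fst p) * c (fst p - {(snd p, b)}))" for b and p :: "('v \<times> bool) set \<times> 'v"
  define D0 where "D0 = Sigma ?T fpart"
  define D1 where "D1 = Sigma ?T (\<lambda>\<sigma>. gpart \<sigma> \<inter> A)"
  have T: "\<tau> \<in> pair_cells \<Delta>" "card \<tau> = CARD('v)" "gpart \<tau> = - fpart \<tau>" "fpart \<tau> \<subseteq> A" "fpart \<tau> \<in> \<Delta>"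
    if "\<tau> \<in> ?T" for \<tau>
    using that top_cell[of \<tau> \<Delta>] cells_over_fpart[of \<tau> A] by (auto simp: cells_over_def pair_cells_def)
  have "cell_augmentation \<Delta> A (coboundary (cells_over \<Delta> A) c) =
      (\<Sum>\<tau>\<in>?T. (\<Sum>v\<in>fpart \<tau>. t False (\<tau>, v)) + (\<Sum>v\<in>gpart \<tau> \<inter> A. t True (\<tau>, v)))"
    unfolding cell_augmentation_def
  proof (rule sum.cong)
    fix \<tau> assume \<tau>: "\<tau> \<in> ?T"
    have "(\<Sum>x\<in>\<tau>. incidence_sign x \<tau> * c (\<tau> - {x})) =
        (\<Sum>x\<in>(\<lambda>v. (v, False)) ` fpart \<tau> \<union> (\<lambda>v. (v, True)) ` gpart \<tau>. incidence_sign x \<tau> * c (\<tau> - {x}))"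
      by (rule sum.cong[OF cell_decomp refl])
    also have "\<dots> = (\<Sum>v\<in>fpart \<tau>. incidence_sign (v, False) \<tau> * c (\<tau> - {(v, False)})) +
        (\<Sum>v\<in>gpart \<tau>. incidence_sign (v, True) \<tau> * c (\<tau> - {(v, True)}))"
      by (subst sum.union_disjoint) (auto simp: sum.reindex inj_on_def)
    \<comment> \<open>Vertices outside A must stay in G: removing one leaves the family, and the
      term vanishes.\<close>
    also have "(\<Sum>v\<in>gpart \<tau>. incidence_sign (v, True) \<tau> * c (\<tau> - {(v, True)})) =
        (\<Sum>v\<in>gpart \<tau> \<inter> A. incidence_sign (v, True) \<tau> * c (\<tau> - {(v, True)}))"
    proof (rule sum.mono_neutral_right)
      show "\<forall>v\<in>gpart \<tau> - gpart \<tau> \<inter> A. incidence_sign (v, True) \<tau> * c (\<tau> - {(v, True)}) = 0"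
      proof
        fix v assume "v \<in> gpart \<tau> - gpart \<tau> \<inter> A"
        then have "\<tau> - {(v, True)} \<notin> cells_over \<Delta> A" by (auto simp: cells_over_def)
        then show "incidence_sign (v, True) \<tau> * c (\<tau> - {(v, True)}) = 0" using cochains_zero[OF c] by simp
      qed
    qed auto
    finally show "(-1) ^ card (fpart \<tau>) * coboundary (cells_over \<Delta> A) c \<tau> =
        (\<Sum>v\<in>fpart \<tau>. t False (\<tau>, v)) + (\<Sum>v\<in>gpart \<tau> \<inter> A. t True (\<tau>, v))"
      using \<tau> by (simp add: coboundary_def t_def sum_distrib_left ring_distribs)
  qed auto
  also have "\<dots> = (\<Sum>p\<in>D0. t False p) + (\<Sum>p\<in>D1. t True p)"
    unfolding D0_def D1_def by (simp add: sum.distrib sum.Sigma)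
  also have "(\<Sum>p\<in>D1. t True p) = (\<Sum>p\<in>D0. - t False p)"
  proof (rule sum.reindex_bij_witness[of _
      "\<lambda>(\<tau>, v). (insert (v, True) (\<tau> - {(v, False)}), v)" "\<lambda>(\<tau>, v). (insert (v, False) (\<tau> - {(v, True)}), v)"])
    fix p assume "p \<in> D1"
    then obtain \<tau> v where p: "p = (\<tau>, v)" "\<tau> \<in> ?T" "v \<in> gpart \<tau>" "v \<in> A" unfolding D1_def by blast
    note T\<tau> = T[OF p(2)]
    let ?\<rho> = "insert (v, False) (\<tau> - {(v, True)})"
    have vt: "(v, True) \<in> \<tau>" "(v, False) \<notin> \<tau>" using p(3) T\<tau>(3) by (auto simp: gpart_def fpart_def)
    have card: "card ?\<rho> = card \<tau>"
      unfolding card.remove[OF finite vt(1)] using vt(2) by (intro card_insert_disjoint) auto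
    have "insert v (fpart \<tau>) \<in> \<Delta>" by (rule face_sub[OF A]) (use p(4) T\<tau>(4) in simp)
    then have \<rho>: "?\<rho> \<in> ?T"
      using p(2,4) card T\<tau> by (auto simp: cells_over_def pair_cells_def)
    show "(case p of (\<tau>, v) \<Rightarrow> (insert (v, False) (\<tau> - {(v, True)}), v)) \<in> D0"
      using \<rho> by (simp add: p D0_def)
    show "(case (case p of (\<tau>, v) \<Rightarrow> (insert (v, False) (\<tau> - {(v, True)}), v)) of
        (\<tau>, v) \<Rightarrow> (insert (v, True) (\<tau> - {(v, False)}), v)) = p"
      using vt by (auto simp: p)
    have "?\<rho> - {(v, False)} = \<tau> - {(v, True)}" using vt by auto
    moreover have "card (fpart ?\<rho>) = Suc (card (fpart \<tau>))" using p(3) T\<tau>(3) by simp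
    moreover have "incidence_sign (v, False) ?\<rho> = (incidence_sign (v, True) \<tau> :: 'k)"
      using incidence_sign_top_cell[OF T\<tau>(1,2) vt(1), where 'k='k]
        incidence_sign_top_cell[OF T(1,2)[OF \<rho>], of v False, where 'k='k] by simp
    ultimately show "- t False (case p of (\<tau>, v) \<Rightarrow> (insert (v, False) (\<tau> - {(v, True)}), v)) = t True p"
      by (simp add: p t_def)
  next
    fix p assume "p \<in> D0"
    then obtain \<tau> v where p: "p = (\<tau>, v)" "\<tau> \<in> ?T" "v \<in> fpart \<tau>" unfolding D0_def by blast
    note T\<tau> = T[OF p(2)]
    let ?\<rho> = "insert (v, True) (\<tau> - {(v, False)})"
    have vt: "(v, False) \<in> \<tau>" "(v, True) \<notin> \<tau>" using p(3) T\<tau>(3) by (auto simp: gpart_def fpart_def)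
    have card: "card ?\<rho> = card \<tau>"
      unfolding card.remove[OF finite vt(1)] using vt(2) by (intro card_insert_disjoint) auto
    have "fpart \<tau> - {v} \<in> \<Delta>" using T\<tau>(5) by (rule face_sub) auto
    then have \<rho>: "?\<rho> \<in> ?T"
      using p(2) card T\<tau> by (auto simp: cells_over_def pair_cells_def)
    show "(case p of (\<tau>, v) \<Rightarrow> (insert (v, True) (\<tau> - {(v, False)}), v)) \<in> D1"
      using \<rho> p(3) T\<tau>(4) by (auto simp: p D1_def)
    show "(case (case p of (\<tau>, v) \<Rightarrow> (insert (v, True) (\<tau> - {(v, False)}), v)) of
        (\<tau>, v) \<Rightarrow> (insert (v, False) (\<tau> - {(v, True)}), v)) = p"
      using vt by (auto simp: p)
  qed
  finally show ?thesis by (simp add: sum_negf)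
qed

text \<open>Cells with F \<noteq> A form an acyclic lower part, and the upper part is at most the
  one cell (A, V - A), of top degree. So the cohomology is at most a line, present only for A \<in>
  \<Delta> and detected by the augmentation, just as k[\<Delta>] is in that multidegree.\<close>

lemma cells_over_exact:
  fixes c :: "('v \<times> bool) set \<Rightarrow> 'k::field"
  assumes c: "c \<in> cochains (cells_over \<Delta> A) i" "coboundary (cells_over \<Delta> A) c = 0"
    and aug: "i = int CARD('v) \<Longrightarrow> A \<in> \<Delta> \<Longrightarrow> cell_augmentation \<Delta> A c = 0"
  shows "\<exists>b \<in> cochains (cells_over \<Delta> A) (i - 1). coboundary (cells_over \<Delta> A) b = c"
proof -
  let ?X = "cells_over \<Delta> A"
  let ?Y = "{\<sigma> \<in> ?X. fpart \<sigma> = A}"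
  let ?Z = "{\<sigma> \<in> ?X. {} \<subseteq> fpart \<sigma> \<and> fpart \<sigma> \<noteq> A}"
  interpret cut_family ?X ?Y ?Z
  proof
    show "G \<in> ?Y" if "F \<in> ?Y" "G \<in> ?X" "F \<subseteq> G" for F G
      using that fpart_mono[of F G] cells_over_fpart[of G A] by auto
  qed (use convex_cells_over in auto)
  have Z: "acyclic_at TYPE('k) ?Z i" by (rule cells_below_top_acyclic) simp
  have Y: "A \<in> \<Delta> \<and> card \<sigma> = CARD('v) \<and> gpart \<sigma> = - A" if "\<sigma> \<in> ?Y" for \<sigma>
  proof -
    have g: "gpart \<sigma> = - A" using that by (auto simp: cells_over_def pair_cells_def)
    then have "card \<sigma> = card (A \<union> - A)" using that card_pair_cell(1)[of \<sigma> \<Delta>] by (auto simp: cells_over_def)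
    then show ?thesis using that g by (auto simp: cells_over_def pair_cells_def)
  qed
  show ?thesis
  proof (cases "i = int CARD('v) \<and> A \<in> \<Delta>")
    case False
    have "acyclic_at TYPE('k) ?Y i" using False Y by (intro acyclic_at_no_faces) auto
    then have "acyclic_at TYPE('k) ?X i" using Z by (rule acyclic_whole)
    then show ?thesis using c acyclic_atD by metis
  next
    case True
    have "coboundary ?Z (restrict_to ?Z c) = 0"
      unfolding restrict_lower[OF c(1), symmetric] c(2) restrict_0 ..
    then obtain b :: "('v \<times> bool) set \<Rightarrow> 'k" where b: "b \<in> cochains ?Z (i - 1)" "coboundary ?Z b = restrict_to ?Z c"
      by (rule acyclic_atD[OF Z cochains_restrict[OF c(1) ZX]])
    have bX: "b \<in> cochains ?X (i - 1)" using cochains_mono[OF b(1) ZX] .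
    \<comment> \<open>Modulo a coboundary c lives on the single cell (A, V - A), where the
      augmentation reads off its value up to sign.\<close>
    define e where "e = c - coboundary ?X b"
    have eX: "e \<in> cochains ?X i"
      unfolding e_def using coboundary_cochains[OF bX] c(1) by (intro cochains_diff) auto
    have "restrict_to ?Z e = 0"
      unfolding e_def restrict_diff restrict_lower[OF bX] restrict_Z[OF b(1)] b(2) by simp
    then have eY: "e \<in> cochains ?Y i" using upper_cochain eX by blast
    have "cell_augmentation \<Delta> A e = cell_augmentation \<Delta> A c - cell_augmentation \<Delta> A (coboundary ?X b)"
      by (simp add: e_def cell_augmentation_def algebra_simps sum_subtractf)
    also have "\<dots> = 0" using aug True cell_augmentation_coboundary[OF _ bX] by simp
    finally have e0: "cell_augmentation \<Delta> A e = 0" .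
    have "e \<sigma> = 0" for \<sigma>
    proof (cases "\<sigma> \<in> ?Y")
      case \<sigma>: True
      have "\<tau> = \<sigma>" if "\<tau> \<in> ?Y" for \<tau> using \<sigma> that Y by (intro fg_eq) auto
      then have "e \<tau> = 0" if "\<tau> \<noteq> \<sigma>" for \<tau> using that cochains_zero[OF eY] by blast
      then have "cell_augmentation \<Delta> A e = (\<Sum>\<tau> | \<tau> \<in> ?X \<and> card \<tau> = CARD('v). if \<tau> = \<sigma> then (-1) ^ card (fpart \<sigma>) * e \<sigma> else 0)"
        unfolding cell_augmentation_def by (intro sum.cong) auto
      also have "\<dots> = (-1) ^ card (fpart \<sigma>) * e \<sigma>" using \<sigma> Y[OF \<sigma>] by simp
      finally show ?thesis using e0 by simp
    qed (rule cochains_zero[OF eY])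
    then have "coboundary ?X b = c" by (auto simp: e_def fun_eq_iff)
    then show ?thesis using bX by blast
  qed
qed

end

section \<open>The free complex on the cells, its multigraded parts and its exactness\<close>

definition cell_basis :: "'v::{finite,linorder} set set \<Rightarrow> nat \<Rightarrow> ('v \<times> bool) set set" where
  "cell_basis \<Delta> i = {\<sigma> \<in> pair_cells \<Delta>. card \<sigma> + i = CARD('v)}"

text \<open>Free complexes number their bases by naturals, so some enumeration of the cells is
  fixed; \<open>spread\<close> and \<open>unspread\<close> convert vectors accordingly.\<close>

definition cell_enum :: "'v::{finite,linorder} set set \<Rightarrow> nat \<Rightarrow> nat \<Rightarrow> ('v \<times> bool) set" where
  "cell_enum \<Delta> i = (SOME h. bij_betw h {..<card (cell_basis \<Delta> i)} (cell_basis \<Delta> i))"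

definition cell_index :: "'v::{finite,linorder} set set \<Rightarrow> nat \<Rightarrow> ('v \<times> bool) set \<Rightarrow> nat" where
  "cell_index \<Delta> i = the_inv_into {..<card (cell_basis \<Delta> i)} (cell_enum \<Delta> i)"

definition cell_weight :: "'v \<times> bool \<Rightarrow> ('v, 'k::field) mpoly" where
  "cell_weight x = (if snd x then Poly_Mapping.single (Poly_Mapping.single (fst x) 1) 1 else 1)"

text \<open>At most one summand is nonzero, since \<tau> and \<sigma> determine x. The form as a sum
  lets \<open>sum_cell_entry\<close> exchange it with a sum over the basis.\<close>

definition cell_entry ::
    "('v::{finite,linorder} \<times> bool) set \<Rightarrow> ('v \<times> bool) set \<Rightarrow> ('v, 'k::field) mpoly" where
  "cell_entry \<tau> \<sigma> = (\<Sum>x\<in>\<tau>. if \<tau> - {x} = \<sigma> then incidence_sign x \<tau> * cell_weight x else 0)"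

text \<open>The basis vector of the cell \<open>(F, G)\<close> has degree \<open>V - G\<close>; the differential adds a vertex to \<open>F\<close>
  with constant coefficient, or a vertex \<open>v\<close> to \<open>G\<close> with coefficient \<open>x\<^sub>v\<close>.\<close>

definition cell_resolution :: "'v::{finite,linorder} set set \<Rightarrow> ('v, 'k::field) mpoly free_complex" where
  "cell_resolution \<Delta> =
     \<lparr>rank = \<lambda>i. card (cell_basis \<Delta> i),
      shift = \<lambda>i b. card (- gpart (cell_enum \<Delta> i b)),
      diff = \<lambda>i a b. cell_entry (cell_enum \<Delta> i a) (cell_enum \<Delta> (Suc i) b),
      aug = \<lambda>b. (-1) ^ card (fpart (cell_enum \<Delta> 0 b)) * squarefree_monomial (fpart (cell_enum \<Delta> 0 b))\<rparr>"

definition spread :: "'v::{finite,linorder} set set \<Rightarrow> nat \<Rightarrow> (nat \<Rightarrow> 'a::zero) \<Rightarrow> ('v \<times> bool) set \<Rightarrow> 'a" where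
  "spread \<Delta> i u \<sigma> = (if \<sigma> \<in> cell_basis \<Delta> i then u (cell_index \<Delta> i \<sigma>) else 0)"

definition unspread :: "'v::{finite,linorder} set set \<Rightarrow> nat \<Rightarrow> (('v \<times> bool) set \<Rightarrow> 'a::zero) \<Rightarrow> nat \<Rightarrow> 'a" where
  "unspread \<Delta> i c b = (if b < card (cell_basis \<Delta> i) then c (cell_enum \<Delta> i b) else 0)"

context
  fixes \<Delta> :: "'v::{finite,linorder} set set"
begin

lemma cell_enum_bij: "bij_betw (cell_enum \<Delta> i) {..<card (cell_basis \<Delta> i)} (cell_basis \<Delta> i)"
proof -
  have "\<exists>h. bij_betw h {..<card (cell_basis \<Delta> i)} (cell_basis \<Delta> i)"
    using ex_bij_betw_nat_finite[of "cell_basis \<Delta> i"] by (simp add: atLeast0LessThan)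
  then show ?thesis unfolding cell_enum_def by (rule someI_ex)
qed

lemma cell_enum_mem: "b < card (cell_basis \<Delta> i) \<Longrightarrow> cell_enum \<Delta> i b \<in> cell_basis \<Delta> i"
  using cell_enum_bij bij_betwE by blast

lemma cell_index_enum [simp]: "b < card (cell_basis \<Delta> i) \<Longrightarrow> cell_index \<Delta> i (cell_enum \<Delta> i b) = b"
  unfolding cell_index_def using cell_enum_bij[of i] by (intro the_inv_into_f_f) (auto simp: bij_betw_def)

lemma cell_enum_index [simp]: "\<sigma> \<in> cell_basis \<Delta> i \<Longrightarrow> cell_enum \<Delta> i (cell_index \<Delta> i \<sigma>) = \<sigma>"
  unfolding cell_index_def using cell_enum_bij[of i] by (intro f_the_inv_into_f) (auto simp: bij_betw_def)

lemma cell_index_less: "\<sigma> \<in> cell_basis \<Delta> i \<Longrightarrow> cell_index \<Delta> i \<sigma> < card (cell_basis \<Delta> i)"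
  unfolding cell_index_def using cell_enum_bij[of i]
  by (metis bij_betw_def lessThan_iff order_refl the_inv_into_into)

lemma spread_unspread: "\<sigma> \<in> cell_basis \<Delta> i \<Longrightarrow> spread \<Delta> i (unspread \<Delta> i c) \<sigma> = c \<sigma>"
  by (simp add: spread_def unspread_def cell_index_less)

lemma unspread_spread: "(\<And>b. card (cell_basis \<Delta> i) \<le> b \<Longrightarrow> u b = 0) \<Longrightarrow> unspread \<Delta> i (spread \<Delta> i u) = u"
  by (auto simp: spread_def unspread_def cell_enum_mem fun_eq_iff)

lemma sum_cell_basis: "(\<Sum>b<card (cell_basis \<Delta> i). g (cell_enum \<Delta> i b) b) = (\<Sum>\<sigma>\<in>cell_basis \<Delta> i. g \<sigma> (cell_index \<Delta> i \<sigma>))"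
  by (rule sum.reindex_bij_witness[of _ "cell_index \<Delta> i" "cell_enum \<Delta> i"])
    (auto simp: cell_index_less cell_enum_mem)

lemma sum_cell_entry:
  fixes e :: "'v \<times> bool \<Rightarrow> 'a::comm_ring_1"
  shows "(\<Sum>b<card (cell_basis \<Delta> i). (\<Sum>x\<in>\<tau>. if \<tau> - {x} = cell_enum \<Delta> i b then e x else 0) * u b) =
    (\<Sum>x\<in>\<tau>. e x * spread \<Delta> i u (\<tau> - {x}))"
proof -
  have "(\<Sum>b<card (cell_basis \<Delta> i). (\<Sum>x\<in>\<tau>. if \<tau> - {x} = cell_enum \<Delta> i b then e x else 0) * u b) =
      (\<Sum>\<sigma>\<in>cell_basis \<Delta> i. (\<Sum>x\<in>\<tau>. if \<tau> - {x} = \<sigma> then e x else 0) * u (cell_index \<Delta> i \<sigma>))"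
    by (rule sum_cell_basis)
  also have "\<dots> = (\<Sum>\<sigma>\<in>cell_basis \<Delta> i. \<Sum>x\<in>\<tau>. if \<tau> - {x} = \<sigma> then e x * u (cell_index \<Delta> i \<sigma>) else 0)"
    unfolding sum_distrib_right by (intro sum.cong refl) simp
  also have "\<dots> = (\<Sum>x\<in>\<tau>. \<Sum>\<sigma>\<in>cell_basis \<Delta> i. if \<tau> - {x} = \<sigma> then e x * u (cell_index \<Delta> i \<sigma>) else 0)"
    by (rule sum.swap)
  also have "\<dots> = (\<Sum>x\<in>\<tau>. e x * spread \<Delta> i u (\<tau> - {x}))"
    by (intro sum.cong refl) (simp add: spread_def)
  finally show ?thesis .
qed

lemma spread_diff_map:
  assumes "\<tau> \<in> cell_basis \<Delta> i"
  shows "spread \<Delta> i (diff_map (cell_resolution \<Delta> :: ('v, 'k::field) mpoly free_complex) i u) \<tau> =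
    (\<Sum>x\<in>\<tau>. incidence_sign x \<tau> * cell_weight x * spread \<Delta> (Suc i) u (\<tau> - {x}))"
  using assms
  by (simp add: spread_def[of \<Delta> i] diff_map_def cell_resolution_def cell_index_less cell_entry_def sum_cell_entry)

text \<open>Variables have zero constant term, so over k only the enlargements of F survive and G
  stays fixed.\<close>

lemma spread_tensor_diff:
  assumes \<tau>: "\<tau> \<in> cell_basis \<Delta> i"
  shows "spread \<Delta> i (tensor_diff (cell_resolution \<Delta> :: ('v, 'k::field) mpoly free_complex) i u) \<tau> =
    (\<Sum>x\<in>\<tau>. (if snd x then 0 else incidence_sign x \<tau>) * spread \<Delta> (Suc i) u (\<tau> - {x}))"
proof -
  have w: "Poly_Mapping.lookup (incidence_sign x \<tau> * cell_weight x :: ('v, 'k) mpoly) 0 =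
      (if snd x then 0 else incidence_sign x \<tau>)" for x
  proof -
    have "Poly_Mapping.single (fst x) (1::nat) \<noteq> 0" by (metis keys_single keys_zero insert_not_empty zero_neq_one)
    then show ?thesis
      unfolding incidence_sign_def lookup_sign_times by (simp add: cell_weight_def lookup_single when_def)
  qed
  have "Poly_Mapping.lookup (cell_entry \<tau> \<sigma> :: ('v, 'k) mpoly) 0 =
      (\<Sum>x\<in>\<tau>. if \<tau> - {x} = \<sigma> then (if snd x then 0 else incidence_sign x \<tau>) else 0)" for \<sigma>
    unfolding cell_entry_def lookup_sum by (intro sum.cong refl) (simp add: w)
  then show ?thesis
    using \<tau> by (simp add: spread_def[of \<Delta> i] tensor_diff_def cell_resolution_def cell_index_less sum_cell_entry)
qed

text \<open>The part of u in multidegree \<alpha>: a cell has degree V - G, so its coefficient sits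
  at \<alpha> minus the indicator of V - G. On \<open>cells_over\<close> this truncated subtraction
  is exact.\<close>

definition cell_component :: "nat \<Rightarrow> ('v \<Rightarrow>\<^sub>0 nat) \<Rightarrow> (nat \<Rightarrow> ('v, 'k::field) mpoly) \<Rightarrow> ('v \<times> bool) set \<Rightarrow> 'k" where
  "cell_component i \<alpha> u = restrict_to (cells_over \<Delta> (Poly_Mapping.keys \<alpha>))
     (\<lambda>\<sigma>. Poly_Mapping.lookup (spread \<Delta> i u \<sigma>) (\<alpha> - indicator_exp (- gpart \<sigma>)))"

lemma cell_component_cochain:
  "cell_component i \<alpha> u \<in> cochains (cells_over \<Delta> (Poly_Mapping.keys \<alpha>)) (int CARD('v) - int i)"
  by (auto simp: cell_component_def restrict_to_def cochains_def spread_def cell_basis_def split: if_splits)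

lemma exp_diff_add:
  assumes "W \<subseteq> Poly_Mapping.keys (\<alpha> :: 'v \<Rightarrow>\<^sub>0 nat)"
  shows "\<alpha> - indicator_exp W + indicator_exp W = \<alpha>"
  using assms by (intro poly_mapping_eqI) (auto simp: lookup_add lookup_minus lookup_indicator_exp in_keys_iff)

lemma lookup_spread_eq_component:
  assumes "\<sigma> \<in> cell_basis \<Delta> i"
  shows "Poly_Mapping.lookup (spread \<Delta> i u \<sigma>) t = cell_component i (t + indicator_exp (- gpart \<sigma>)) u \<sigma>"
proof -
  have "- Poly_Mapping.keys (t + indicator_exp (- gpart \<sigma>)) \<subseteq> gpart \<sigma>" by (auto simp: keys_plus_nat)
  then show ?thesis using assms
    by (simp add: cell_component_def restrict_to_def cells_over_def cell_basis_def)
qed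

lemma eq_if_components_eq:
  fixes u w :: "nat \<Rightarrow> ('v, 'k::field) mpoly"
  assumes "u \<in> free_module (cell_resolution \<Delta>) i" "w \<in> free_module (cell_resolution \<Delta>) i"
    and "\<And>\<alpha>. cell_component i \<alpha> u = cell_component i \<alpha> w"
  shows "u = w"
proof -
  have "spread \<Delta> i u \<sigma> = spread \<Delta> i w \<sigma>" for \<sigma>
  proof (cases "\<sigma> \<in> cell_basis \<Delta> i")
    case True
    then show ?thesis by (intro poly_mapping_eqI) (simp add: lookup_spread_eq_component assms(3))
  qed (simp add: spread_def)
  then have eq: "spread \<Delta> i u = spread \<Delta> i w" by blast
  have "unspread \<Delta> i (spread \<Delta> i u) = u"
    by (rule unspread_spread) (use assms(1) in \<open>simp add: free_module_def cell_resolution_def\<close>)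
  moreover have "unspread \<Delta> i (spread \<Delta> i w) = w"
    by (rule unspread_spread) (use assms(2) in \<open>simp add: free_module_def cell_resolution_def\<close>)
  ultimately show ?thesis using eq by metis
qed

lemma lookup_variable_times:
  fixes f :: "('v, 'k::field) mpoly"
  shows "Poly_Mapping.lookup (Poly_Mapping.single (Poly_Mapping.single v 1) 1 * f) \<beta> =
    (if v \<in> Poly_Mapping.keys \<beta> then Poly_Mapping.lookup f (\<beta> - Poly_Mapping.single v 1) else 0)"
proof (cases "v \<in> Poly_Mapping.keys \<beta>")
  case True
  have "\<beta> = Poly_Mapping.single v 1 + (\<beta> - Poly_Mapping.single v 1)"
    using True by (intro poly_mapping_eqI) (auto simp: lookup_add lookup_minus lookup_single when_def in_keys_iff)
  then show ?thesis using True lookup_single_times(1)[of "Poly_Mapping.single v 1" 1 f "\<beta> - Poly_Mapping.single v 1"]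
    by simp
next
  case False
  have "\<beta> \<noteq> Poly_Mapping.single v 1 + s" for s
  proof
    assume "\<beta> = Poly_Mapping.single v 1 + s"
    then have "v \<in> Poly_Mapping.keys \<beta>" by (simp add: keys_plus_nat)
    with False show False ..
  qed
  then show ?thesis using False by (simp add: lookup_single_times(2))
qed

text \<open>The weight x_v for adding v to G makes up for the change of V - G, so in each
  multidegree the differential is the plain coboundary.\<close>

lemma cell_component_diff_map:
  assumes \<Delta>: "simplicial_complex \<Delta>"
  shows "cell_component i \<alpha> (diff_map (cell_resolution \<Delta> :: ('v, 'k::field) mpoly free_complex) i u) =
    coboundary (cells_over \<Delta> (Poly_Mapping.keys \<alpha>)) (cell_component (Suc i) \<alpha> u)"
proof
  fix \<tau>
  let ?A = "Poly_Mapping.keys \<alpha>"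
  show "cell_component i \<alpha> (diff_map (cell_resolution \<Delta> :: ('v, 'k) mpoly free_complex) i u) \<tau> =
    coboundary (cells_over \<Delta> ?A) (cell_component (Suc i) \<alpha> u) \<tau>"
  proof (cases "\<tau> \<in> cells_over \<Delta> ?A \<and> \<tau> \<in> cell_basis \<Delta> i")
    case False
    have cob: "coboundary (cells_over \<Delta> ?A) (cell_component (Suc i) \<alpha> u) \<in> cochains (cells_over \<Delta> ?A) (int CARD('v) - int (Suc i) + 1)"
      by (rule coboundary_cochains[OF cell_component_cochain])
    have "coboundary (cells_over \<Delta> ?A) (cell_component (Suc i) \<alpha> u) \<tau> = 0"
    proof (rule ccontr)
      assume nz: "coboundary (cells_over \<Delta> ?A) (cell_component (Suc i) \<alpha> u) \<tau> \<noteq> 0"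
      then have \<tau>: "\<tau> \<in> cells_over \<Delta> ?A" using cochains_zero[OF cob] by blast
      have "int (card \<tau>) = int CARD('v) - int (Suc i) + 1" using cochains_card[OF cob nz] .
      then have "card \<tau> + i = CARD('v)" by linarith
      then show False using False \<tau> by (auto simp: cell_basis_def cells_over_def)
    qed
    moreover have "cell_component i \<alpha> (diff_map (cell_resolution \<Delta> :: ('v, 'k) mpoly free_complex) i u) \<tau> = 0"
      using False by (auto simp: cell_component_def restrict_to_def spread_def)
    ultimately show ?thesis by simp
  next
    case True
    define \<beta> where "\<beta> = \<alpha> - indicator_exp (- gpart \<tau>)"
    have "Poly_Mapping.lookup (incidence_sign x \<tau> * cell_weight x * spread \<Delta> (Suc i) u (\<tau> - {x})) \<beta> =
        incidence_sign x \<tau> * cell_component (Suc i) \<alpha> u (\<tau> - {x})" if x: "x \<in> \<tau>" for x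
    proof -
      have "Poly_Mapping.lookup (incidence_sign x \<tau> * cell_weight x * spread \<Delta> (Suc i) u (\<tau> - {x})) \<beta> =
          incidence_sign x \<tau> * Poly_Mapping.lookup (cell_weight x * spread \<Delta> (Suc i) u (\<tau> - {x})) \<beta>"
        unfolding mult.assoc incidence_sign_def lookup_sign_times ..
      also have "Poly_Mapping.lookup (cell_weight x * spread \<Delta> (Suc i) u (\<tau> - {x})) \<beta> =
          cell_component (Suc i) \<alpha> u (\<tau> - {x})"
      proof -
        have sub: "\<tau> - {x} \<in> pair_cells \<Delta>"
          using True pair_cells_sub[OF \<Delta>, of \<tau> "\<tau> - {x}"] by (auto simp: cells_over_def)
        obtain v b where vb: "x = (v, b)" by (cases x)
        show ?thesis
        proof (cases b)
          case False
          then have "\<tau> - {x} \<in> cells_over \<Delta> ?A" using True sub by (simp add: cells_over_def vb)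
          then show ?thesis using False
            by (simp add: cell_weight_def vb cell_component_def restrict_to_def \<beta>_def)
        next
          \<comment> \<open>Multiplying by x_v shifts the exponent by v, the vertex that V - G gains
            when (v, True) is removed. For v outside the support of \<alpha> both sides are
            0.\<close>
          case b: True
          have vg: "v \<in> gpart \<tau>" using x vb b by (simp add: gpart_def)
          have \<beta>v: "v \<in> Poly_Mapping.keys \<beta> \<longleftrightarrow> v \<in> ?A"
            using vg by (simp add: \<beta>_def in_keys_iff lookup_minus lookup_indicator_exp)
          have "\<tau> - {x} \<in> cells_over \<Delta> ?A \<longleftrightarrow> v \<in> ?A"
            using True sub vg by (auto simp: cells_over_def vb b)
          moreover have "\<beta> - Poly_Mapping.single v 1 = \<alpha> - indicator_exp (- gpart (\<tau> - {x}))"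
            using vg by (intro poly_mapping_eqI)
              (auto simp: \<beta>_def lookup_minus lookup_indicator_exp lookup_single when_def vb b)
          ultimately show ?thesis
            using b \<beta>v by (simp add: cell_weight_def vb lookup_variable_times[simplified] cell_component_def restrict_to_def)
        qed
      qed
      finally show ?thesis .
    qed
    then show ?thesis
      using True unfolding cell_component_def[of i] restrict_to_def
      by (simp add: spread_diff_map lookup_sum \<beta>_def[symmetric] coboundary_def)
  qed
qed

text \<open>For a fixed cell the exponent determines \<alpha>, so the components may be prescribed
  independently as long as finitely many are nonzero.\<close>

lemma components_assemble:
  fixes w :: "('v \<Rightarrow>\<^sub>0 nat) \<Rightarrow> ('v \<times> bool) set \<Rightarrow> 'k::field"
  assumes S: "finite S" "\<And>\<alpha>. \<alpha> \<notin> S \<Longrightarrow> w \<alpha> = 0"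
    and w: "\<And>\<alpha>. w \<alpha> \<in> cochains (cells_over \<Delta> (Poly_Mapping.keys \<alpha>)) (int CARD('v) - int i)"
  obtains u where "u \<in> free_module (cell_resolution \<Delta> :: ('v, 'k) mpoly free_complex) i"
    and "\<forall>\<alpha>. cell_component i \<alpha> u = w \<alpha>"
proof
  define c where "c \<sigma> = (\<Sum>\<alpha>\<in>S. Poly_Mapping.single (\<alpha> - indicator_exp (- gpart \<sigma>)) (w \<alpha> \<sigma>))" for \<sigma>
  define u where "u = unspread \<Delta> i c"
  show "u \<in> free_module (cell_resolution \<Delta>) i"
    by (simp add: u_def unspread_def free_module_def cell_resolution_def)
  have supp: "- gpart \<sigma> \<subseteq> Poly_Mapping.keys \<alpha> \<and> \<sigma> \<in> pair_cells \<Delta>" if "w \<alpha> \<sigma> \<noteq> 0" for \<alpha> \<sigma>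
    using w[of \<alpha>] that unfolding cochains_def cells_over_def by blast
  have basis: "\<sigma> \<in> cell_basis \<Delta> i" if "w \<alpha> \<sigma> \<noteq> 0" for \<alpha> \<sigma>
  proof -
    have "int (card \<sigma>) = int CARD('v) - int i" by (rule cochains_card[OF w that])
    then have "card \<sigma> + i = CARD('v)" by linarith
    then show ?thesis using supp[OF that] by (simp add: cell_basis_def)
  qed
  show "\<forall>\<alpha>. cell_component i \<alpha> u = w \<alpha>"
  proof (intro allI ext)
    fix \<alpha> \<sigma>
    show "cell_component i \<alpha> u \<sigma> = w \<alpha> \<sigma>"
    proof (cases "\<sigma> \<in> cell_basis \<Delta> i \<and> \<sigma> \<in> cells_over \<Delta> (Poly_Mapping.keys \<alpha>)")
      case True
      then have \<alpha>\<sigma>: "- gpart \<sigma> \<subseteq> Poly_Mapping.keys \<alpha>" by (auto simp: cells_over_def)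
      have inj: "\<gamma> = \<alpha>" if "w \<gamma> \<sigma> \<noteq> 0" "\<gamma> - indicator_exp (- gpart \<sigma>) = \<alpha> - indicator_exp (- gpart \<sigma>)" for \<gamma>
        using exp_diff_add[OF \<alpha>\<sigma>] exp_diff_add[of "- gpart \<sigma>" \<gamma>] supp[OF that(1)] that(2) by metis
      have "cell_component i \<alpha> u \<sigma> = Poly_Mapping.lookup (c \<sigma>) (\<alpha> - indicator_exp (- gpart \<sigma>))"
        using True by (simp add: cell_component_def restrict_to_def u_def spread_unspread)
      also have "\<dots> = (\<Sum>\<gamma>\<in>S. if \<gamma> = \<alpha> then w \<alpha> \<sigma> else 0)"
        unfolding c_def lookup_sum lookup_single
      proof (rule sum.cong[OF refl])
        fix \<gamma>
        show "(w \<gamma> \<sigma> when \<gamma> - indicator_exp (- gpart \<sigma>) = \<alpha> - indicator_exp (- gpart \<sigma>)) = (if \<gamma> = \<alpha> then w \<alpha> \<sigma> else 0)"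
          using inj[of \<gamma>] by (auto simp: when_def)
      qed
      also have "\<dots> = w \<alpha> \<sigma>" using S by auto
      finally show ?thesis .
    next
      case False
      then have "cell_component i \<alpha> u \<sigma> = 0" by (auto simp: cell_component_def restrict_to_def spread_def)
      moreover have "w \<alpha> \<sigma> = 0" using False basis[of \<alpha> \<sigma>] w[of \<alpha>] unfolding cochains_def by blast
      ultimately show ?thesis by simp
    qed
  qed
qed

lemma components_finite:
  fixes u :: "nat \<Rightarrow> ('v, 'k::field) mpoly"
  shows "finite {\<alpha>. cell_component i \<alpha> u \<noteq> 0}"
proof (rule finite_subset)
  show "{\<alpha>. cell_component i \<alpha> u \<noteq> 0} \<subseteq>
      (\<Union>\<sigma>. (\<lambda>t. t + indicator_exp (- gpart \<sigma>)) ` Poly_Mapping.keys (spread \<Delta> i u \<sigma>))"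
  proof
    fix \<alpha> assume "\<alpha> \<in> {\<alpha>. cell_component i \<alpha> u \<noteq> 0}"
    then obtain \<sigma> where \<sigma>: "cell_component i \<alpha> u \<sigma> \<noteq> 0" by (auto simp: fun_eq_iff)
    then have "\<sigma> \<in> cells_over \<Delta> (Poly_Mapping.keys \<alpha>)"
      and l: "Poly_Mapping.lookup (spread \<Delta> i u \<sigma>) (\<alpha> - indicator_exp (- gpart \<sigma>)) \<noteq> 0"
      by (auto simp: cell_component_def restrict_to_def split: if_splits)
    then have "\<alpha> = \<alpha> - indicator_exp (- gpart \<sigma>) + indicator_exp (- gpart \<sigma>)"
      by (intro exp_diff_add[symmetric]) (auto simp: cells_over_def)
    then show "\<alpha> \<in> (\<Union>\<sigma>. (\<lambda>t. t + indicator_exp (- gpart \<sigma>)) ` Poly_Mapping.keys (spread \<Delta> i u \<sigma>))"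
      using l by (intro UN_I[of \<sigma>] image_eqI[of _ _ "\<alpha> - indicator_exp (- gpart \<sigma>)"]) (auto simp: in_keys_iff)
  qed
qed simp

end

lemma mdegree_indicator_exp: "mdegree (indicator_exp F) = card (F :: 'v::finite set)"
  by (simp add: mdegree_def lookup_indicator_exp sum.If_cases)

lemma mdegree_single: "mdegree (Poly_Mapping.single (v :: 'v::finite) n) = n"
  by (simp add: mdegree_def lookup_single when_def)

lemma lookup_squarefree_times:
  fixes f :: "('v::finite, 'k::field) mpoly"
  shows "Poly_Mapping.lookup (squarefree_monomial F * f) \<alpha> =
    (if F \<subseteq> Poly_Mapping.keys \<alpha> then Poly_Mapping.lookup f (\<alpha> - indicator_exp F) else 0)"
proof (cases "F \<subseteq> Poly_Mapping.keys \<alpha>")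
  case True
  then have "\<alpha> = indicator_exp F + (\<alpha> - indicator_exp F)"
    by (intro poly_mapping_eqI) (auto simp: lookup_add lookup_minus lookup_indicator_exp in_keys_iff)
  then show ?thesis
    using True lookup_single_times(1)[of "indicator_exp F" 1 f "\<alpha> - indicator_exp F"]
    by (simp add: squarefree_monomial_eq)
next
  case False
  have "\<alpha> \<noteq> indicator_exp F + u" for u using False by (auto simp: keys_plus_nat)
  then show ?thesis using False by (simp add: squarefree_monomial_eq lookup_single_times(2))
qed

context
  fixes \<Delta> :: "'v::{finite,linorder} set set"
  assumes \<Delta>: "simplicial_complex \<Delta>"
begin

lemma lookup_cell_aug_map:
  fixes u :: "nat \<Rightarrow> ('v, 'k::field) mpoly"
  shows "Poly_Mapping.lookup (aug_map (cell_resolution \<Delta>) u) \<alpha> =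
    cell_augmentation \<Delta> (Poly_Mapping.keys \<alpha>) (cell_component \<Delta> 0 \<alpha> u)"
proof -
  have top: "gpart \<sigma> = - fpart \<sigma>" "\<sigma> \<in> pair_cells \<Delta>" if "\<sigma> \<in> cell_basis \<Delta> 0" for \<sigma>
    using that top_cell[of \<sigma> \<Delta>] by (auto simp: cell_basis_def)
  have "aug_map (cell_resolution \<Delta>) u =
      (\<Sum>\<sigma>\<in>cell_basis \<Delta> 0. (-1) ^ card (fpart \<sigma>) * (squarefree_monomial (fpart \<sigma>) * u (cell_index \<Delta> 0 \<sigma>)))"
  proof -
    have "aug_map (cell_resolution \<Delta>) u = (\<Sum>b<card (cell_basis \<Delta> 0). (-1) ^ card (fpart (cell_enum \<Delta> 0 b)) *
        (squarefree_monomial (fpart (cell_enum \<Delta> 0 b)) * u b))"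
      unfolding aug_map_def cell_resolution_def by (simp only: free_complex.simps mult.assoc)
    also have "\<dots> = (\<Sum>\<sigma>\<in>cell_basis \<Delta> 0. (-1) ^ card (fpart \<sigma>) *
        (squarefree_monomial (fpart \<sigma>) * u (cell_index \<Delta> 0 \<sigma>)))"
      by (rule sum_cell_basis[where g = "\<lambda>\<sigma> b. (-1) ^ card (fpart \<sigma>) * (squarefree_monomial (fpart \<sigma>) * u b)"])
    finally show ?thesis .
  qed
  then have "Poly_Mapping.lookup (aug_map (cell_resolution \<Delta>) u) \<alpha> =
      (\<Sum>\<sigma>\<in>cell_basis \<Delta> 0. (-1) ^ card (fpart \<sigma>) *
        (if fpart \<sigma> \<subseteq> Poly_Mapping.keys \<alpha> then Poly_Mapping.lookup (u (cell_index \<Delta> 0 \<sigma>)) (\<alpha> - indicator_exp (fpart \<sigma>)) else 0))"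
    by (simp only: lookup_sum lookup_sign_times lookup_squarefree_times)
  also have "\<dots> = (\<Sum>\<sigma>\<in>cell_basis \<Delta> 0. (-1) ^ card (fpart \<sigma>) * cell_component \<Delta> 0 \<alpha> u \<sigma>)"
  proof (rule sum.cong[OF refl])
    fix \<sigma> assume \<sigma>: "\<sigma> \<in> cell_basis \<Delta> 0"
    have "\<sigma> \<in> cells_over \<Delta> (Poly_Mapping.keys \<alpha>) \<longleftrightarrow> fpart \<sigma> \<subseteq> Poly_Mapping.keys \<alpha>"
      using top[OF \<sigma>] by (auto simp: cells_over_def)
    moreover have "indicator_exp (fpart \<sigma>) = indicator_exp (- gpart \<sigma>)" using top[OF \<sigma>] by simp
    ultimately show "(-1) ^ card (fpart \<sigma>) * (if fpart \<sigma> \<subseteq> Poly_Mapping.keys \<alpha>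
        then Poly_Mapping.lookup (u (cell_index \<Delta> 0 \<sigma>)) (\<alpha> - indicator_exp (fpart \<sigma>)) else 0) =
      (-1) ^ card (fpart \<sigma>) * cell_component \<Delta> 0 \<alpha> u \<sigma>"
      using \<sigma> by (simp add: cell_component_def restrict_to_def spread_def)
  qed
  also have "\<dots> = cell_augmentation \<Delta> (Poly_Mapping.keys \<alpha>) (cell_component \<Delta> 0 \<alpha> u)"
    unfolding cell_augmentation_def
    by (rule sum.mono_neutral_right) (auto simp: cell_basis_def cells_over_def cell_component_def restrict_to_def)
  finally show ?thesis .
qed

lemma diff_map_free_module: "diff_map R i u \<in> free_module R i"
  by (simp add: diff_map_def free_module_def)

text \<open>The multidegrees decouple: each is solved by \<open>cells_over_exact\<close>, and
  choosing 0 where the component vanishes keeps the solution finitely supported.\<close>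

lemma cell_resolution_exact:
  fixes u :: "nat \<Rightarrow> ('v, 'k::field) mpoly"
  assumes u: "u \<in> free_module (cell_resolution \<Delta>) i"
    and cyc: "\<And>\<alpha>. coboundary (cells_over \<Delta> (Poly_Mapping.keys \<alpha>)) (cell_component \<Delta> i \<alpha> u) = 0"
    and aug: "\<And>\<alpha>. i = 0 \<Longrightarrow> Poly_Mapping.keys \<alpha> \<in> \<Delta> \<Longrightarrow>
      cell_augmentation \<Delta> (Poly_Mapping.keys \<alpha>) (cell_component \<Delta> i \<alpha> u) = 0"
  shows "u \<in> diff_map (cell_resolution \<Delta>) i ` free_module (cell_resolution \<Delta>) (Suc i)"
proof -
  have "\<exists>b. b \<in> cochains (cells_over \<Delta> (Poly_Mapping.keys \<alpha>)) (int CARD('v) - int (Suc i)) \<and>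
      coboundary (cells_over \<Delta> (Poly_Mapping.keys \<alpha>)) b = cell_component \<Delta> i \<alpha> u \<and>
      (cell_component \<Delta> i \<alpha> u = 0 \<longrightarrow> b = 0)" for \<alpha>
  proof (cases "cell_component \<Delta> i \<alpha> u = 0")
    case False
    have "\<exists>b\<in>cochains (cells_over \<Delta> (Poly_Mapping.keys \<alpha>)) (int CARD('v) - int i - 1).
        coboundary (cells_over \<Delta> (Poly_Mapping.keys \<alpha>)) b = cell_component \<Delta> i \<alpha> u"
      by (rule cells_over_exact[OF \<Delta> cell_component_cochain cyc]) (rule aug, simp_all)
    moreover have "int CARD('v) - int i - 1 = int CARD('v) - int (Suc i)" by simp
    ultimately show ?thesis using False by metis
  qed (auto intro: exI[of _ 0])
  then obtain w where w: "\<And>\<alpha>. w \<alpha> \<in> cochains (cells_over \<Delta> (Poly_Mapping.keys \<alpha>)) (int CARD('v) - int (Suc i))"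
    "\<And>\<alpha>. coboundary (cells_over \<Delta> (Poly_Mapping.keys \<alpha>)) (w \<alpha>) = cell_component \<Delta> i \<alpha> u"
    "\<And>\<alpha>. cell_component \<Delta> i \<alpha> u = 0 \<Longrightarrow> w \<alpha> = 0" by metis
  obtain y :: "nat \<Rightarrow> ('v, 'k) mpoly" where y: "y \<in> free_module (cell_resolution \<Delta>) (Suc i)"
    "\<forall>\<alpha>. cell_component \<Delta> (Suc i) \<alpha> y = w \<alpha>"
    by (rule components_assemble[OF components_finite[of \<Delta> i u], where w = w and i = "Suc i"]) (use w in auto)
  have "diff_map (cell_resolution \<Delta>) i y = u"
    by (rule eq_if_components_eq[OF diff_map_free_module u])
      (simp add: cell_component_diff_map[OF \<Delta>] y(2) w(2))
  then show ?thesis using y(1) by blast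
qed

lemma cell_component_0 [simp]: "cell_component \<Delta> i \<alpha> (0 :: nat \<Rightarrow> ('v, 'k::field) mpoly) = 0"
  by (auto simp: cell_component_def restrict_to_def spread_def fun_eq_iff)

text \<open>Homogeneity is read off the cells: removing (v, True) enlarges V - G by v, matching the
  entry x_v. Exactness reduces to \<open>cell_resolution_exact\<close>.\<close>

theorem cell_resolution_graded:
  "graded_free_resolution (stanley_reisner_ideal \<Delta> :: ('v, 'k::field) mpoly set) (cell_resolution \<Delta>)"
  unfolding graded_free_resolution_def
proof (intro conjI allI impI ballI)
  let ?R = "cell_resolution \<Delta> :: ('v, 'k) mpoly free_complex"
  fix i a b t
  assume ab: "a < rank ?R i" "b < rank ?R (Suc i)" and t: "t \<in> Poly_Mapping.keys (diff ?R i a b)"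
  let ?\<tau> = "cell_enum \<Delta> i a" and ?\<sigma> = "cell_enum \<Delta> (Suc i) b"
  from t have "(\<Sum>x\<in>?\<tau>. Poly_Mapping.lookup (if ?\<tau> - {x} = ?\<sigma> then incidence_sign x ?\<tau> * cell_weight x else 0 :: ('v, 'k) mpoly) t) \<noteq> 0"
    by (simp add: cell_resolution_def cell_entry_def in_keys_iff lookup_sum)
  then obtain x where x: "x \<in> ?\<tau>"
    "Poly_Mapping.lookup (if ?\<tau> - {x} = ?\<sigma> then incidence_sign x ?\<tau> * cell_weight x else 0 :: ('v, 'k) mpoly) t \<noteq> 0"
    by (metis (no_types, lifting) sum.not_neutral_contains_not_neutral)
  then have \<sigma>: "?\<sigma> = ?\<tau> - {x}" and "Poly_Mapping.lookup (incidence_sign x ?\<tau> * cell_weight x :: ('v, 'k) mpoly) t \<noteq> 0"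
    by (auto split: if_splits)
  then have w: "Poly_Mapping.lookup (cell_weight x :: ('v, 'k) mpoly) t \<noteq> 0"
    unfolding incidence_sign_def lookup_sign_times by simp
  obtain v e where vb: "x = (v, e)" by (cases x)
  show "shift ?R i a + mdegree t = shift ?R (Suc i) b"
  proof (cases e)
    case True
    then have "t = Poly_Mapping.single v 1" using w by (simp add: cell_weight_def vb lookup_single when_def split: if_splits)
    moreover have "v \<in> gpart ?\<tau>" using x(1) vb True by (simp add: gpart_def)
    then have "- gpart ?\<sigma> = insert v (- gpart ?\<tau>)" "v \<notin> - gpart ?\<tau>" using True by (auto simp: \<sigma> vb)
    then have "card (- gpart ?\<sigma>) = Suc (card (- gpart ?\<tau>))" by simp
    ultimately show ?thesis by (simp add: cell_resolution_def mdegree_single)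
  next
    case False
    then have "t = 0" using w by (simp add: cell_weight_def vb lookup_one when_def split: if_splits)
    moreover have "gpart ?\<sigma> = gpart ?\<tau>" unfolding \<sigma> vb using False by simp
    ultimately show ?thesis by (simp add: cell_resolution_def)
  qed
next
  let ?R = "cell_resolution \<Delta> :: ('v, 'k) mpoly free_complex"
  fix b assume "b < rank ?R 0"
  then have \<sigma>: "cell_enum \<Delta> 0 b \<in> cell_basis \<Delta> 0" by (simp add: cell_resolution_def cell_enum_mem)
  let ?\<sigma> = "cell_enum \<Delta> 0 b"
  have g: "gpart ?\<sigma> = - fpart ?\<sigma>" using \<sigma> top_cell[of ?\<sigma> \<Delta>] by (simp add: cell_basis_def)
  show "homogeneous (shift ?R 0 b) (aug ?R b)"
    unfolding homogeneous_def
  proof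
    fix t assume "t \<in> Poly_Mapping.keys (aug ?R b)"
    then have "t = indicator_exp (fpart ?\<sigma>)"
      by (simp add: cell_resolution_def in_keys_iff lookup_sign_times squarefree_monomial_eq lookup_single when_def split: if_splits)
    then show "mdegree t = shift ?R 0 b" using g by (simp add: cell_resolution_def mdegree_indicator_exp)
  qed
next
  let ?R = "cell_resolution \<Delta> :: ('v, 'k) mpoly free_complex"
  fix f :: "('v, 'k) mpoly"
  \<comment> \<open>The cell ({}, V) has augmentation 1, so f placed there is a preimage of
    f.\<close>
  define \<sigma> :: "('v \<times> bool) set" where "\<sigma> = UNIV \<times> {True}"
  have fg: "fpart \<sigma> = {}" "gpart \<sigma> = UNIV" by (auto simp: \<sigma>_def fpart_def gpart_def)
  have \<sigma>: "\<sigma> \<in> cell_basis \<Delta> 0"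
    using empty_face[OF \<Delta>] card_cell[of \<sigma>] by (simp add: cell_basis_def pair_cells_def fg)
  define u where "u = (\<lambda>b. if b = cell_index \<Delta> 0 \<sigma> then f else 0)"
  have u: "u \<in> free_module ?R 0" using cell_index_less[OF \<sigma>] by (simp add: u_def free_module_def cell_resolution_def)
  have "squarefree_monomial {} = (1 :: ('v, 'k) mpoly)" by (simp add: squarefree_monomial_def)
  then have "aug_map ?R u = f"
    using cell_index_less[OF \<sigma>] \<sigma>
    by (simp add: aug_map_def u_def cell_resolution_def fg if_distrib cong: if_cong)
  then have "f - aug_map ?R u \<in> stanley_reisner_ideal \<Delta>"
    by (simp add: stanley_reisner_ideal_def ring_module.span_zero)
  then show "\<exists>u\<in>free_module ?R 0. f - aug_map ?R u \<in> stanley_reisner_ideal \<Delta>" using u by blast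
next
  let ?R = "cell_resolution \<Delta> :: ('v, 'k) mpoly free_complex"
  have aug: "aug_map ?R u \<in> stanley_reisner_ideal \<Delta> \<longleftrightarrow>
      (\<forall>\<alpha>. Poly_Mapping.keys \<alpha> \<in> \<Delta> \<longrightarrow> cell_augmentation \<Delta> (Poly_Mapping.keys \<alpha>) (cell_component \<Delta> 0 \<alpha> u) = 0)" for u
    unfolding stanley_reisner_ideal_iff[OF \<Delta>] in_keys_iff Ball_def lookup_cell_aug_map by blast
  show "{u \<in> free_module ?R 0. aug_map ?R u \<in> stanley_reisner_ideal \<Delta>} = diff_map ?R 0 ` free_module ?R 1"
  proof (intro equalityI subsetI)
    fix u assume "u \<in> {u \<in> free_module ?R 0. aug_map ?R u \<in> stanley_reisner_ideal \<Delta>}"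
    then have u: "u \<in> free_module ?R 0" "\<And>\<alpha>. Poly_Mapping.keys \<alpha> \<in> \<Delta> \<Longrightarrow>
        cell_augmentation \<Delta> (Poly_Mapping.keys \<alpha>) (cell_component \<Delta> 0 \<alpha> u) = 0"
      unfolding mem_Collect_eq aug by auto
    have "u \<in> diff_map ?R 0 ` free_module ?R (Suc 0)"
    proof (rule cell_resolution_exact[OF u(1)])
      fix \<alpha> :: "'v \<Rightarrow>\<^sub>0 nat"
      let ?X = "cells_over \<Delta> (Poly_Mapping.keys \<alpha>)"
      have c: "coboundary ?X (cell_component \<Delta> 0 \<alpha> u) \<in> cochains ?X (int CARD('v) - int 0 + 1)"
        by (rule coboundary_cochains[OF cell_component_cochain])
      \<comment> \<open>In homological degree 0 the cells have n elements and no cell is larger, so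
        every cochain is a cocycle.\<close>
      have "coboundary ?X (cell_component \<Delta> 0 \<alpha> u) T = 0" for T
      proof (rule ccontr)
        assume nz: "coboundary ?X (cell_component \<Delta> 0 \<alpha> u) T \<noteq> 0"
        have "T \<in> ?X" using nz cochains_zero[OF c] by blast
        then have "card T \<le> CARD('v)" using card_pair_cell(2)[of T \<Delta>] by (simp add: cells_over_def)
        then show False using cochains_card[OF c nz] by simp
      qed
      then show "coboundary ?X (cell_component \<Delta> 0 \<alpha> u) = 0" by auto
    qed (rule u(2))
    then show "u \<in> diff_map ?R 0 ` free_module ?R 1" by simp
  next
    fix u assume "u \<in> diff_map ?R 0 ` free_module ?R 1"
    then obtain w where w: "u = diff_map ?R 0 w" by blast
    have "aug_map ?R u \<in> stanley_reisner_ideal \<Delta>"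
      unfolding aug w cell_component_diff_map[OF \<Delta>]
      using cell_augmentation_coboundary[OF \<Delta> _ cell_component_cochain] by blast
    then show "u \<in> {u \<in> free_module ?R 0. aug_map ?R u \<in> stanley_reisner_ideal \<Delta>}"
      using diff_map_free_module[of ?R 0 w] w by simp
  qed
next
  let ?R = "cell_resolution \<Delta> :: ('v, 'k) mpoly free_complex"
  fix i
  show "{u \<in> free_module ?R (Suc i). diff_map ?R i u = (\<lambda>_. 0)} = diff_map ?R (Suc i) ` free_module ?R (Suc (Suc i))"
  proof (intro equalityI subsetI)
    fix u assume "u \<in> {u \<in> free_module ?R (Suc i). diff_map ?R i u = (\<lambda>_. 0)}"
    then have u: "u \<in> free_module ?R (Suc i)" "diff_map ?R i u = 0" by (auto simp: zero_fun_def)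
    show "u \<in> diff_map ?R (Suc i) ` free_module ?R (Suc (Suc i))"
    proof (rule cell_resolution_exact[OF u(1)])
      fix \<alpha>
      show "coboundary (cells_over \<Delta> (Poly_Mapping.keys \<alpha>)) (cell_component \<Delta> (Suc i) \<alpha> u) = 0"
        unfolding cell_component_diff_map[OF \<Delta>, symmetric] u(2) by simp
    qed simp
  next
    fix u assume "u \<in> diff_map ?R (Suc i) ` free_module ?R (Suc (Suc i))"
    then obtain w where w: "u = diff_map ?R (Suc i) w" by blast
    have "diff_map ?R i u = 0"
    proof (rule eq_if_components_eq[OF diff_map_free_module])
      show "(0 :: nat \<Rightarrow> ('v, 'k) mpoly) \<in> free_module ?R i" by (simp add: free_module_def)
      show "cell_component \<Delta> i \<alpha> (diff_map ?R i u) = cell_component \<Delta> i \<alpha> 0" for \<alpha>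
        unfolding w cell_component_diff_map[OF \<Delta>] cell_component_0
        by (rule coboundary_coboundary[OF convex_cells_over[OF \<Delta>] cell_component_cochain])
    qed
    then show "u \<in> {u \<in> free_module ?R (Suc i). diff_map ?R i u = (\<lambda>_. 0)}"
      using diff_map_free_module[of ?R "Suc i" w] w by (simp add: zero_fun_def)
  qed
qed

text \<open>One direction of Hochster's formula: over k the cells with G = V - W split off as a
  direct summand of degree \<open>card W\<close>, and up to a shift by \<open>card G\<close> they
  carry the cochains of \<Delta> restricted to W.\<close>

theorem tensor_exact_imp_acyclic:
  fixes W :: "'v set"
  assumes exact: "tensor_cycles (cell_resolution \<Delta> :: ('v, 'k::field) mpoly free_complex) i (card W) \<subseteq>
    tensor_boundaries (cell_resolution \<Delta>) i (card W)"
  shows "acyclic_at TYPE('k) {F \<in> \<Delta>. F \<subseteq> W} (int (card W) - int i)"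
proof -
  let ?R = "cell_resolution \<Delta> :: ('v, 'k) mpoly free_complex"
  define f where "f = (\<lambda>v :: 'v. (v, False))"
  define G where "G = (\<lambda>v :: 'v. (v, True)) ` (- W)"
  define X where "X = {\<sigma> \<in> pair_cells \<Delta>. gpart \<sigma> = - W}"
  have X_eq: "X = (\<lambda>F. f ` F \<union> G) ` {F \<in> \<Delta>. F \<subseteq> W}"
  proof (intro equalityI subsetI)
    fix \<sigma> assume "\<sigma> \<in> X"
    then have "\<sigma> = f ` fpart \<sigma> \<union> G" "fpart \<sigma> \<in> \<Delta>" "fpart \<sigma> \<subseteq> W"
      using cell_decomp[of \<sigma>] by (auto simp: X_def f_def G_def pair_cells_def)
    then show "\<sigma> \<in> (\<lambda>F. f ` F \<union> G) ` {F \<in> \<Delta>. F \<subseteq> W}" by blast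
  next
    fix \<sigma> assume "\<sigma> \<in> (\<lambda>F. f ` F \<union> G) ` {F \<in> \<Delta>. F \<subseteq> W}"
    then obtain F where F: "F \<in> \<Delta>" "F \<subseteq> W" "\<sigma> = f ` F \<union> G" by blast
    have "fpart \<sigma> = F" "gpart \<sigma> = - W" unfolding F(3) by (auto simp: fpart_def gpart_def f_def G_def)
    then show "\<sigma> \<in> X" using F by (auto simp: X_def pair_cells_def)
  qed
  have "card G = card (- W)" by (simp add: G_def card_image inj_on_def)
  then have cardG: "int (card (W :: 'v set)) + int (card G) = int CARD('v)"
    using card_Un_disjoint[of W "- W"] by simp
  have "acyclic_at TYPE('k) X (int CARD('v) - int i)"
  proof (rule acyclic_atI)
    fix c :: "('v \<times> bool) set \<Rightarrow> 'k"
    assume c: "c \<in> cochains X (int CARD('v) - int i)" "coboundary X c = 0"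
    have basis: "\<sigma> \<in> cell_basis \<Delta> i \<and> \<sigma> \<in> X" if "c \<sigma> \<noteq> 0" for \<sigma>
    proof -
      have "\<sigma> \<in> X" using that cochains_zero[OF c(1)] by blast
      moreover have "card \<sigma> + i = CARD('v)" using cochains_card[OF c(1) that] by linarith
      ultimately show ?thesis by (simp add: cell_basis_def X_def)
    qed
    define u where "u = unspread \<Delta> i c"
    have su: "spread \<Delta> i u = c"
      using basis by (auto simp: fun_eq_iff u_def spread_def unspread_def cell_index_less)
    have um: "u \<in> tensor_module ?R i (card W)"
      unfolding tensor_module_def
    proof (intro CollectI allI impI)
      fix b assume b: "u b \<noteq> 0"
      then have "b < card (cell_basis \<Delta> i)" "c (cell_enum \<Delta> i b) \<noteq> 0"
        by (auto simp: u_def unspread_def split: if_splits)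
      with basis show "b < rank ?R i \<and> shift ?R i b = card W" by (simp add: cell_resolution_def X_def)
    qed
    have "u \<in> tensor_cycles ?R i (card W)"
    proof (cases i)
      case (Suc i')
      \<comment> \<open>c is supported on cells with G = V - W. At \<tau> in X the dropped terms
        would change G and vanish anyway; at other \<tau> the surviving terms keep G and miss
        X.\<close>
      have sz: "spread \<Delta> i' (tensor_diff ?R i' u) \<tau> = 0" if \<tau>: "\<tau> \<in> cell_basis \<Delta> i'" for \<tau>
      proof -
        have "spread \<Delta> i' (tensor_diff ?R i' u) \<tau> = (\<Sum>x\<in>\<tau>. (if snd x then 0 else incidence_sign x \<tau>) * c (\<tau> - {x}))"
          unfolding spread_tensor_diff[OF \<tau>] Suc[symmetric] su ..
        also have "\<dots> = 0"
        proof (cases "\<tau> \<in> X")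
          case True
          have "(\<Sum>x\<in>\<tau>. (if snd x then 0 else incidence_sign x \<tau>) * c (\<tau> - {x})) = coboundary X c \<tau>"
            unfolding coboundary_def if_P[OF True]
          proof (intro sum.cong refl)
            fix x assume x: "x \<in> \<tau>"
            obtain v e where vb: "x = (v, e)" by (cases x)
            have "\<tau> - {x} \<notin> X" if e using x that True by (auto simp: X_def vb gpart_def)
            then show "(if snd x then 0 else incidence_sign x \<tau>) * c (\<tau> - {x}) = incidence_sign x \<tau> * c (\<tau> - {x})"
              using cochains_zero[OF c(1)] by (auto simp: vb)
          qed
          then show ?thesis using c(2) by simp
        next
          case False
          have "(if snd x then 0 else incidence_sign x \<tau>) * c (\<tau> - {x}) = 0" if x: "x \<in> \<tau>" for x
          proof -
            obtain v e where vb: "x = (v, e)" by (cases x)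
            have "\<tau> - {x} \<notin> X" if "\<not> e"
              using that False \<tau> by (auto simp: X_def vb cell_basis_def)
            then show ?thesis using cochains_zero[OF c(1)] by (auto simp: vb)
          qed
          then show ?thesis by (intro sum.neutral) simp
        qed
        finally show ?thesis .
      qed
      have "tensor_diff ?R i' u a = 0" for a
      proof (cases "a < card (cell_basis \<Delta> i')")
        case True
        then show ?thesis using sz[OF cell_enum_mem[OF True]] by (simp add: spread_def cell_enum_mem)
      qed (simp add: tensor_diff_def cell_resolution_def)
      then show ?thesis using um by (auto simp: tensor_cycles_def Suc)
    qed (use um in \<open>simp add: tensor_cycles_def\<close>)
    then obtain w where w: "w \<in> tensor_module ?R (Suc i) (card W)" "u = tensor_diff ?R i w"
      using exact by (auto simp: tensor_boundaries_def)
    define b where "b = restrict_to X (spread \<Delta> (Suc i) w)"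
    have b: "b \<in> cochains X (int CARD('v) - int i - 1)"
      by (auto simp: b_def cochains_def restrict_to_def spread_def cell_basis_def split: if_splits)
    have "coboundary X b \<tau> = c \<tau>" for \<tau>
    proof (cases "\<tau> \<in> X \<and> \<tau> \<in> cell_basis \<Delta> i")
      case True
      have "c \<tau> = spread \<Delta> i (tensor_diff ?R i w) \<tau>" using su w(2) by simp
      also have "\<dots> = (\<Sum>x\<in>\<tau>. (if snd x then 0 else incidence_sign x \<tau>) * spread \<Delta> (Suc i) w (\<tau> - {x}))"
        using True by (simp add: spread_tensor_diff)
      also have "\<dots> = coboundary X b \<tau>"
        unfolding coboundary_def if_P[OF conjunct1[OF True]]
      proof (intro sum.cong refl)
        fix x assume x: "x \<in> \<tau>"
        obtain v e where vb: "x = (v, e)" by (cases x)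
        show "(if snd x then 0 else incidence_sign x \<tau>) * spread \<Delta> (Suc i) w (\<tau> - {x}) = incidence_sign x \<tau> * b (\<tau> - {x})"
        proof (cases e)
          case e: True
          have "\<tau> - {x} \<notin> X" using x True e by (auto simp: X_def vb gpart_def)
          then show ?thesis by (simp add: b_def restrict_to_def vb e)
        next
          case e: False
          have "\<tau> - {x} \<in> pair_cells \<Delta>" using True pair_cells_sub[OF \<Delta>, of \<tau> "\<tau> - {x}"] by (auto simp: X_def)
          then have "\<tau> - {x} \<in> X" using True e by (auto simp: X_def vb)
          then show ?thesis by (simp add: b_def restrict_to_def vb e)
        qed
      qed
      finally show ?thesis by simp
    next
      case False
      have bi: "coboundary X b \<in> cochains X (int CARD('v) - int i)" using coboundary_cochains[OF b] by simp
      have "coboundary X b \<tau> = 0"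
      proof (rule ccontr)
        assume nz: "coboundary X b \<tau> \<noteq> 0"
        have "\<tau> \<in> X" using nz cochains_zero[OF bi] by blast
        moreover have "card \<tau> + i = CARD('v)" using cochains_card[OF bi nz] by linarith
        ultimately show False using False by (simp add: cell_basis_def X_def)
      qed
      then show ?thesis using False basis[of \<tau>] by fastforce
    qed
    then show "\<exists>b \<in> cochains X (int CARD('v) - int i - 1). coboundary X b = c" using b by blast
  qed
  moreover have "int CARD('v) - int i = int (card W) - int i + int (card G)" using cardG by simp
  ultimately have "acyclic_at TYPE('k) X (int (card W) - int i + int (card G))" by simp
  then show ?thesis
    by (subst (asm) acyclic_translate[OF _ _ X_eq]) (auto simp: strict_mono_def f_def G_def)
qed

end

section \<open>Betti numbers, regularity and acyclic restrictions of \<Delta>\<close>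

section \<open>Regularity\<close>

text \<open>Proved from the definition, as it is applied inside the space of all sequences, which is
  not finite-dimensional.\<close>

lemma quotient_dim_eq_0_iff:
  fixes scale :: "'k::field \<Rightarrow> 'a::ab_group_add \<Rightarrow> 'a"
  assumes vs: "vector_space scale" and B: "module.subspace scale B" and Z: "module.subspace scale Z"
  shows "quotient_dim scale Z B = 0 \<longleftrightarrow> Z \<subseteq> B"
proof -
  interpret vector_space scale by (rule vs)
  let ?S = "{enat (card X) | X. finite X \<and> X \<subseteq> Z \<and> (\<forall>u. (\<Sum>x\<in>X. scale (u x) x) \<in> B \<longrightarrow> (\<forall>x\<in>X. u x = 0))}"
  show ?thesis
  proof
    assume zero: "quotient_dim scale Z B = 0"
    show "Z \<subseteq> B"
    proof (rule subsetI, rule ccontr)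
      fix z assume z: "z \<in> Z" "z \<notin> B"
      have "u z = 0" if "scale (u z) z \<in> B" for u :: "'a \<Rightarrow> 'k"
      proof (rule ccontr)
        assume nz: "u z \<noteq> 0"
        have "scale (inverse (u z)) (scale (u z) z) \<in> B" by (rule subspace_scale[OF B that])
        then show False using nz z(2) by simp
      qed
      then have "enat 1 \<in> ?S"
        using z(1) by (intro CollectI exI[of _ "{z}"]) auto
      then have "enat 1 \<le> quotient_dim scale Z B" unfolding quotient_dim_def by (rule Sup_upper)
      then show False using zero by (simp add: zero_enat_def)
    qed
  next
    assume ZB: "Z \<subseteq> B"
    have "e \<le> 0" if "e \<in> ?S" for e
    proof -
      from that obtain X where X: "e = enat (card X)" "finite X" "X \<subseteq> Z"
        "\<forall>u. (\<Sum>x\<in>X. scale (u x) x) \<in> B \<longrightarrow> (\<forall>x\<in>X. u x = 0)" by blast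
      \<comment> \<open>With all coefficients 1 the sum lies in B, so independence modulo B leaves
        no element in X.\<close>
      have "(\<Sum>x\<in>X. scale 1 x) \<in> B" using X ZB by (intro subspace_sum[OF B] subspace_scale[OF B]) auto
      with X(4)[rule_format, of "\<lambda>_. 1"] have "X = {}" by auto
      then show ?thesis using X(1) by (simp add: zero_enat_def)
    qed
    then have "Sup ?S \<le> 0" by (rule Sup_least)
    then show "quotient_dim scale Z B = 0" unfolding quotient_dim_def by simp
  qed
qed

lemma tensor_diff_linear: "fun_linear (tensor_diff R i)"
proof (rule fun_linearI)
  show "tensor_diff R i (x + y) = tensor_diff R i x + tensor_diff R i y" for x y
    by (auto simp: tensor_diff_def fun_eq_iff distrib_left sum.distrib)
  show "tensor_diff R i (\<lambda>z. c * x z) = (\<lambda>z. c * tensor_diff R i x z)" for c x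
  proof
    fix b
    have "(\<Sum>n<rank R (Suc i). Poly_Mapping.lookup (diff R i b n) 0 * (c * x n)) =
        (\<Sum>n<rank R (Suc i). c * (Poly_Mapping.lookup (diff R i b n) 0 * x n))"
      by (intro sum.cong refl mult.left_commute)
    then show "tensor_diff R i (\<lambda>z. c * x z) b = c * tensor_diff R i x b"
      unfolding tensor_diff_def sum_distrib_left[symmetric] by simp
  qed
qed

lemma tensor_module_subspace: "fun_space.subspace (tensor_module R i j)"
  unfolding fun_space.subspace_def tensor_module_def by auto (metis add.right_neutral)+

lemma betti_eq_0_iff:
  fixes I :: "('v::finite, 'k::field) mpoly set"
  defines "R \<equiv> SOME R. graded_free_resolution I R"
  shows "betti I i j = 0 \<longleftrightarrow> tensor_cycles R i j \<subseteq> tensor_boundaries R i j"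
proof -
  have "fun_space.subspace (tensor_cycles R i j)"
  proof (cases i)
    case 0
    then show ?thesis by (simp add: tensor_cycles_def tensor_module_subspace)
  next
    case (Suc i')
    interpret T: Vector_Spaces.linear "(\<lambda>a f x. a * f x) :: 'k \<Rightarrow> (nat \<Rightarrow> 'k) \<Rightarrow> nat \<Rightarrow> 'k" "\<lambda>a f x. a * f x" "tensor_diff R i'"
      by (rule tensor_diff_linear)
    show ?thesis using tensor_module_subspace[of R i j] unfolding Suc tensor_cycles_def nat.case
      unfolding fun_space.subspace_def zero_fun_def[symmetric] by (auto simp: T.add T.scale fun_eq_iff)
  qed
  moreover have "fun_space.subspace (tensor_boundaries R i j)"
  proof -
    interpret T: Vector_Spaces.linear "(\<lambda>a f x. a * f x) :: 'k \<Rightarrow> (nat \<Rightarrow> 'k) \<Rightarrow> nat \<Rightarrow> 'k" "\<lambda>a f x. a * f x" "tensor_diff R i"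
      by (rule tensor_diff_linear)
    show ?thesis unfolding tensor_boundaries_def by (rule T.subspace_image[OF tensor_module_subspace])
  qed
  ultimately show ?thesis
    unfolding betti_def R_def[symmetric] Let_def by (intro quotient_dim_eq_0_iff fun_space.vector_space_axioms)
qed

context
  fixes \<Delta> :: "'v::{finite,linorder} set set" and I :: "('v, 'k::field) mpoly set"
  assumes \<Delta>: "simplicial_complex \<Delta>" and I: "I = stanley_reisner_ideal \<Delta>"
begin

lemma cell_resolution_I: "graded_free_resolution I (cell_resolution \<Delta>)"
  unfolding I by (rule cell_resolution_graded[OF \<Delta>])

lemma some_resolution: "graded_free_resolution I (SOME R. graded_free_resolution I R)"
  using cell_resolution_I by (rule someI)

lemma resolution_pair_stanley_reisner:
  assumes "graded_free_resolution I R" "graded_free_resolution I R'"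
  shows "resolution_pair I R R'"
proof
  show "ring_module.subspace I" unfolding I stanley_reisner_ideal_def by (rule ring_module.subspace_span)
  show "graded_part 0 s f \<in> I" if "f \<in> I" for f s
    using that unfolding I stanley_reisner_ideal_iff[OF \<Delta>] by (auto simp: in_keys_iff lookup_graded_part split: if_splits)
qed (use assms in auto)

lemma betti_eq_0_imp_acyclic:
  assumes "betti I i (card W) = 0"
  shows "acyclic_at TYPE('k) {F \<in> \<Delta>. F \<subseteq> W} (int (card W) - int i)"
proof (rule tensor_exact_imp_acyclic[OF \<Delta>])
  show "tensor_cycles (cell_resolution \<Delta> :: ('v, 'k) mpoly free_complex) i (card W) \<subseteq>
      tensor_boundaries (cell_resolution \<Delta>) i (card W)"
    using resolution_pair_stanley_reisner[OF some_resolution cell_resolution_I]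
      assms[unfolded betti_eq_0_iff]
    by (rule tensor_exact_transfer)
qed

text \<open>Makes the maximum in \<open>regularity\<close> meaningful. Homological degrees are
  bounded by n through the cell resolution; for each i the internal degrees are among the finitely
  many shifts of the chosen resolution.\<close>

lemma betti_finite: "finite {int j - int i | i j. betti I i j \<noteq> 0}"
proof (rule finite_subset)
  define R where "R = (SOME R. graded_free_resolution I R)"
  show "{int j - int i | i j. betti I i j \<noteq> 0} \<subseteq>
      (\<Union>i\<in>{..CARD('v)}. (\<lambda>b. int (shift R i b) - int i) ` {..<rank R i})"
  proof
    fix x assume "x \<in> {int j - int i | i j. betti I i j \<noteq> 0}"
    then obtain i j where ij: "x = int j - int i" "betti I i j \<noteq> 0" by blast
    have "i \<le> CARD('v)"
    proof (rule ccontr)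
      assume i: "\<not> i \<le> CARD('v)"
      have "cell_basis \<Delta> i = {}" using i by (auto simp: cell_basis_def)
      then have "tensor_cycles (cell_resolution \<Delta> :: ('v, 'k) mpoly free_complex) i j \<subseteq> {0}"
        by (cases i) (auto simp: tensor_cycles_def tensor_module_def cell_resolution_def fun_eq_iff)
      moreover have "0 \<in> tensor_boundaries (cell_resolution \<Delta> :: ('v, 'k) mpoly free_complex) i j"
        unfolding tensor_boundaries_def
        by (rule image_eqI[of _ _ 0]) (auto simp: tensor_diff_def tensor_module_def fun_eq_iff)
      ultimately have "tensor_cycles (cell_resolution \<Delta> :: ('v, 'k) mpoly free_complex) i j \<subseteq> tensor_boundaries (cell_resolution \<Delta>) i j"
        by blast
      with resolution_pair_stanley_reisner[OF cell_resolution_I some_resolution]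
      have "betti I i j = 0" unfolding betti_eq_0_iff by (rule tensor_exact_transfer)
      with ij(2) show False ..
    qed
    moreover have "\<exists>b<rank R i. shift R i b = j"
    proof (rule ccontr)
      assume no: "\<not> ?thesis"
      have "u = 0" if "u \<in> tensor_cycles R i j" for u
      proof
        fix b
        have "u \<in> tensor_module R i j" using that by (cases i) (auto simp: tensor_cycles_def)
        then show "u b = 0 b" using no unfolding tensor_module_def by auto
      qed
      then have "tensor_cycles R i j \<subseteq> {0}" by blast
      moreover have "0 \<in> tensor_boundaries R i j"
        unfolding tensor_boundaries_def
        by (rule image_eqI[of _ _ 0]) (auto simp: tensor_diff_def tensor_module_def fun_eq_iff)
      ultimately have "betti I i j = 0" unfolding betti_eq_0_iff R_def[symmetric] by blast
      with ij(2) show False ..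
    qed
    ultimately show "x \<in> (\<Union>i\<in>{..CARD('v)}. (\<lambda>b. int (shift R i b) - int i) ` {..<rank R i})"
      using ij(1) by blast
  qed
qed auto

text \<open>A nonface F gives a nonzero element of degree \<open>card F\<close> in the ideal, so the
  initial degree q is at most \<open>card F\<close>.\<close>

lemma linear_resolution_skeleton:
  assumes lin: "has_linear_resolution q I" and F: "card F < q"
  shows "F \<in> \<Delta>"
proof (rule ccontr)
  assume "F \<notin> \<Delta>"
  then have "squarefree_monomial F \<in> I"
    unfolding I stanley_reisner_ideal_def by (intro ring_module.span_base) blast
  moreover have "squarefree_monomial F \<noteq> (0 :: ('v, 'k) mpoly)"
    unfolding squarefree_monomial_eq by (metis keys_single keys_zero insert_not_empty zero_neq_one)
  moreover have "homogeneous (card F) (squarefree_monomial F :: ('v, 'k) mpoly)"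
    by (simp add: homogeneous_def squarefree_monomial_eq mdegree_indicator_exp)
  ultimately have "indeg I \<le> card F" unfolding indeg_def by (intro Least_le) blast
  then show False using lin F by (simp add: has_linear_resolution_def)
qed

text \<open>With i = \<open>card W\<close> - j, a nonzero Betti number at (i, \<open>card W\<close>)
  would push the regularity to at least j \<ge> q, beyond q - 1.\<close>

lemma linear_resolution_acyclic:
  assumes lin: "has_linear_resolution q I" and j: "int q \<le> j"
  shows "acyclic_at TYPE('k) {F \<in> \<Delta>. F \<subseteq> W} j"
proof (cases "int (card W) < j")
  case True
  show ?thesis
  proof (rule acyclic_at_no_faces)
    fix F assume "F \<in> {F \<in> \<Delta>. F \<subseteq> W}"
    then have "card F \<le> card W" by (simp add: card_mono)
    then show "int (card F) \<noteq> j" using True by simp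
  qed
next
  case False
  define i where "i = nat (int (card W) - j)"
  have i: "int i = int (card W) - j" using False by (simp add: i_def)
  have "betti I i (card W) = 0"
  proof (rule ccontr)
    assume "betti I i (card W) \<noteq> 0"
    then have "int (card W) - int i \<in> {int j - int i | i j. betti I i j \<noteq> 0}" by blast
    then have "int (card W) - int i \<le> regularity I"
      unfolding regularity_def by (rule Max_ge[OF betti_finite])
    then show False using lin i j by (simp add: has_linear_resolution_def)
  qed
  from betti_eq_0_imp_acyclic[OF this] show ?thesis using i by simp
qed

end

section \<open>Chains of primes and the dimension of k[\<Delta>]\<close>

section \<open>Krull dimension\<close>

lemma prime_ideal_subspace: "prime_ideal P \<Longrightarrow> ring_module.subspace P"
  by (simp add: prime_ideal_def)

lemma prime_ideal_mult_right: "prime_ideal P \<Longrightarrow> x \<in> P \<Longrightarrow> x * y \<in> P"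
  using ring_module.subspace_scale[OF prime_ideal_subspace, of P x y] by (simp add: mult.commute)

lemma prime_ideal_mult_left: "prime_ideal P \<Longrightarrow> x \<in> P \<Longrightarrow> y * x \<in> P"
  by (rule ring_module.subspace_scale[OF prime_ideal_subspace])

lemma prime_ideal_unit: "prime_ideal P \<Longrightarrow> x dvd 1 \<Longrightarrow> x \<notin> P"
proof
  assume P: "prime_ideal P" and "x dvd 1" "x \<in> P"
  then obtain y where "1 = x * y" by auto
  then have "1 \<in> P" using prime_ideal_mult_right[OF P \<open>x \<in> P\<close>] by metis
  then have "z \<in> P" for z using prime_ideal_mult_right[OF P, of 1 z] by simp
  then show False using P by (auto simp: prime_ideal_def)
qed

lemma prime_ideal_power: "prime_ideal P \<Longrightarrow> x ^ n \<in> P \<Longrightarrow> x \<in> P"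
proof (induction n)
  case 0
  then show ?case using prime_ideal_unit[of P 1] by simp
qed (auto simp: prime_ideal_def)

lemma prime_ideal_prod:
  assumes P: "prime_ideal P" and "finite F" "(\<Prod>v\<in>F. f v) \<in> P"
  shows "\<exists>v\<in>F. f v \<in> P"
  using assms(2,3)
proof (induction F)
  case empty
  then show ?case using prime_ideal_unit[OF P, of 1] by simp
next
  case (insert v F)
  then have "f v \<in> P \<or> (\<Prod>v\<in>F. f v) \<in> P" using P by (simp add: prime_ideal_def)
  then show ?case using insert by blast
qed

text \<open>Divide a relation in \<open>P l\<close> by the largest power of \<open>a l\<close> dividing all its monomials. The terms still
  divisible by \<open>a l\<close> lie in \<open>P (l + 1)\<close>, hence so does the sum of the others, which does not involve \<open>a l\<close>.\<close>

lemma prime_chain_no_relation: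
  fixes P :: "nat \<Rightarrow> 'a::comm_ring_1 set" and a :: "nat \<Rightarrow> 'a"
  assumes P: "\<And>i. i \<le> m \<Longrightarrow> prime_ideal (P i)" and sub: "\<And>i. i < m \<Longrightarrow> P i \<subseteq> P (Suc i)"
    and a: "\<And>i. i < m \<Longrightarrow> a i \<in> P (Suc i) \<and> a i \<notin> P i"
    and E: "finite E" "E \<noteq> {}" "E \<subseteq> extensional {..<m}" and c: "\<And>e. e \<in> E \<Longrightarrow> c e dvd 1"
  shows "(\<Sum>e\<in>E. c e * (\<Prod>j<m. a j ^ e j)) \<notin> P 0"
proof
  assume rel: "(\<Sum>e\<in>E. c e * (\<Prod>j<m. a j ^ e j)) \<in> P 0"
  define Q where "Q l \<longleftrightarrow> (\<exists>E c. finite E \<and> E \<noteq> {} \<and> E \<subseteq> extensional {..<m} \<and>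
      (\<forall>e\<in>E. c e dvd 1 \<and> (\<forall>j<l. e j = (0::nat))) \<and> (\<Sum>e\<in>E. c e * (\<Prod>j<m. a j ^ e j)) \<in> P l)" for l
  have "Q l" if "l \<le> m" for l
    using that
  proof (induction l)
    case 0
    show ?case unfolding Q_def using E c rel by (intro exI[of _ E] exI[of _ c]) auto
  next
    case (Suc l)
    then have l: "l < m" by simp
    from Suc have "Q l" by simp
    then obtain E c where Ec: "finite E \<and> E \<noteq> {} \<and> E \<subseteq> extensional {..<m} \<and>
      (\<forall>e\<in>E. c e dvd 1 \<and> (\<forall>j<l. e j = (0::nat))) \<and> (\<Sum>e\<in>E. c e * (\<Prod>j<m. a j ^ e j)) \<in> P l"
      unfolding Q_def by (elim exE)
    then have E: "finite E" "E \<noteq> {}" "E \<subseteq> extensional {..<m}"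
      and c: "\<And>e. e \<in> E \<Longrightarrow> c e dvd 1" and e0: "\<And>e j. e \<in> E \<Longrightarrow> j < l \<Longrightarrow> e j = 0"
      and rel: "(\<Sum>e\<in>E. c e * (\<Prod>j<m. a j ^ e j)) \<in> P l"
      by auto
    define r where "r = Min ((\<lambda>e. e l) ` E)"
    have r: "r \<le> e l" if "e \<in> E" for e unfolding r_def using E that by (intro Min_le) auto
    have "r \<in> (\<lambda>e. e l) ` E" unfolding r_def using E by (intro Min_in) auto
    then obtain e1 where e1: "e1 \<in> E" "e1 l = r" by auto
    define down where "down e = e(l := e l - r)" for e :: "nat \<Rightarrow> nat"
    have mono: "(\<Prod>j<m. a j ^ e j) = a l ^ e l * (\<Prod>j\<in>{..<m} - {l}. a j ^ e j)" for e
      using l by (intro prod.remove) auto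
    have rest: "(\<Prod>j\<in>{..<m} - {l}. a j ^ down e j) = (\<Prod>j\<in>{..<m} - {l}. a j ^ e j)" for e
      by (rule prod.cong) (auto simp: down_def)
    have step: "(\<Prod>j<m. a j ^ e j) = a l ^ r * (\<Prod>j<m. a j ^ down e j)" if "e \<in> E" for e
      unfolding mono rest using r[OF that] by (simp add: down_def mult.assoc[symmetric] flip: power_add)
    have "(\<Sum>e\<in>E. c e * (\<Prod>j<m. a j ^ e j)) = a l ^ r * (\<Sum>e\<in>E. c e * (\<Prod>j<m. a j ^ down e j))"
      unfolding sum_distrib_left by (rule sum.cong[OF refl]) (simp add: step mult.left_commute)
    then have "(\<Sum>e\<in>E. c e * (\<Prod>j<m. a j ^ down e j)) \<in> P l"
      using rel P[of l] l a[OF l] prime_ideal_power[of "P l" "a l" r] by (auto simp: prime_ideal_def)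
    then have sum1: "(\<Sum>e\<in>E. c e * (\<Prod>j<m. a j ^ down e j)) \<in> P (Suc l)" using sub[OF l] by blast
    define E1 where "E1 = {e \<in> E. e l = r}"
    have PS: "prime_ideal (P (Suc l))" using P l by simp
    have "c e * (\<Prod>j<m. a j ^ down e j) \<in> P (Suc l)" if "e \<in> E - E1" for e
    proof -
      have dl: "down e l = Suc (e l - r - 1)" using that r[of e] by (auto simp: E1_def down_def)
      have "c e * (\<Prod>j<m. a j ^ down e j) =
          a l * (c e * (a l ^ (e l - r - 1) * (\<Prod>j\<in>{..<m} - {l}. a j ^ down e j)))"
        unfolding mono[of "down e"] dl power_Suc by (simp only: mult_ac)
      then show ?thesis using prime_ideal_mult_right[OF PS] a[OF l] by metis
    qed
    then have sum2: "(\<Sum>e\<in>E - E1. c e * (\<Prod>j<m. a j ^ down e j)) \<in> P (Suc l)"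
      by (intro ring_module.subspace_sum[OF prime_ideal_subspace[OF PS]])
    have "(\<Sum>e\<in>E. c e * (\<Prod>j<m. a j ^ down e j)) =
        (\<Sum>e\<in>E - E1. c e * (\<Prod>j<m. a j ^ down e j)) + (\<Sum>e\<in>E1. c e * (\<Prod>j<m. a j ^ down e j))"
      by (rule sum.subset_diff) (use E in \<open>auto simp: E1_def\<close>)
    then have sum3: "(\<Sum>e\<in>E1. c e * (\<Prod>j<m. a j ^ down e j)) \<in> P (Suc l)"
      using ring_module.subspace_diff[OF prime_ideal_subspace[OF PS] sum1 sum2] by simp
    define up where "up e = e(l := r)" for e :: "nat \<Rightarrow> nat"
    have up_down: "up (down e) = e" if "e \<in> E1" for e using that by (auto simp: up_def down_def E1_def)
    have inj: "inj_on down E1" by (metis inj_onI up_down)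
    have "(\<Sum>e\<in>down ` E1. c (up e) * (\<Prod>j<m. a j ^ e j)) \<in> P (Suc l)"
      using sum3 by (simp add: sum.reindex[OF inj] up_down)
    moreover have "down ` E1 \<subseteq> extensional {..<m}"
      using E(3) l by (auto simp: E1_def down_def extensional_def)
    moreover have "c (up e) dvd 1 \<and> (\<forall>j<Suc l. e j = 0)" if "e \<in> down ` E1" for e
      using that c e0 up_down by (auto simp: E1_def down_def less_Suc_eq)
    moreover have "finite (down ` E1)" "down ` E1 \<noteq> {}" using E e1 by (auto simp: E1_def)
    ultimately show ?case unfolding Q_def by (intro exI[of _ "down ` E1"] exI[of _ "\<lambda>e. c (up e)"]) auto
  qed
  \<comment> \<open>After m rounds all exponents are 0, so the relation has shrunk to a single unit,
    and a prime contains no unit.\<close>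
  then have "Q m" by simp
  then obtain E c where Ec: "finite E \<and> E \<noteq> {} \<and> E \<subseteq> extensional {..<m} \<and>
      (\<forall>e\<in>E. c e dvd 1 \<and> (\<forall>j<m. e j = (0::nat))) \<and> (\<Sum>e\<in>E. c e * (\<Prod>j<m. a j ^ e j)) \<in> P m"
    unfolding Q_def by (elim exE)
  then have E: "finite E" "E \<noteq> {}" "E \<subseteq> extensional {..<m}"
    and c: "\<And>e. e \<in> E \<Longrightarrow> c e dvd 1" and e0: "\<And>e j. e \<in> E \<Longrightarrow> j < m \<Longrightarrow> e j = 0"
    and rel: "(\<Sum>e\<in>E. c e * (\<Prod>j<m. a j ^ e j)) \<in> P m"
    by auto
  obtain e1 where e1: "e1 \<in> E" using E by blast
  have "e = e1" if "e \<in> E" for e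
  proof (rule extensionalityI)
    show "e \<in> extensional {..<m}" "e1 \<in> extensional {..<m}" using that e1 E by auto
    fix j assume "j \<in> {..<m}"
    then show "e j = e1 j" using e0[OF that, of j] e0[OF e1, of j] by simp
  qed
  then have "E = {e1}" using e1 by blast
  then have "c e1 \<in> P m" using rel e0[OF e1] by simp
  then show False using prime_ideal_unit[OF P c[OF e1], of m] by simp
qed

section \<open>Algebraic dependence by counting monomials\<close>

definition bounded_poly :: "'v set \<Rightarrow> nat \<Rightarrow> ('v, 'k::field) mpoly \<Rightarrow> bool" where
  "bounded_poly F B f \<longleftrightarrow> (\<forall>t\<in>Poly_Mapping.keys f. Poly_Mapping.keys t \<subseteq> F \<and> (\<forall>v. Poly_Mapping.lookup t v \<le> B))"

lemma bounded_poly_mono: "bounded_poly F B f \<Longrightarrow> B \<le> B' \<Longrightarrow> bounded_poly F B' f"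
  unfolding bounded_poly_def by (meson order_trans)

lemma bounded_poly_1: "bounded_poly F 0 1"
  by (simp add: bounded_poly_def)

lemma bounded_poly_mult: "bounded_poly F B f \<Longrightarrow> bounded_poly F B' g \<Longrightarrow> bounded_poly F (B + B') (f * g)"
  unfolding bounded_poly_def
proof
  fix t assume f: "\<forall>t\<in>Poly_Mapping.keys f. Poly_Mapping.keys t \<subseteq> F \<and> (\<forall>v. Poly_Mapping.lookup t v \<le> B)"
    and g: "\<forall>t\<in>Poly_Mapping.keys g. Poly_Mapping.keys t \<subseteq> F \<and> (\<forall>v. Poly_Mapping.lookup t v \<le> B')"
    and "t \<in> Poly_Mapping.keys (f * g)"
  then obtain s u where "s \<in> Poly_Mapping.keys f" "u \<in> Poly_Mapping.keys g" "t = s + u"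
    by (elim keys_times_subset)
  with f g show "Poly_Mapping.keys t \<subseteq> F \<and> (\<forall>v. Poly_Mapping.lookup t v \<le> B + B')"
    by (auto simp: keys_plus_nat lookup_add add_mono)
qed

lemma bounded_poly_power: "bounded_poly F B f \<Longrightarrow> bounded_poly F (n * B) (f ^ n)"
  by (induction n) (auto simp: bounded_poly_1 bounded_poly_mult)

lemma bounded_poly_prod:
  "finite J \<Longrightarrow> (\<And>j. j \<in> J \<Longrightarrow> bounded_poly F B (f j)) \<Longrightarrow> bounded_poly F (card J * B) (\<Prod>j\<in>J. f j)"
  by (induction J rule: finite_induct) (auto simp: bounded_poly_1 bounded_poly_mult)

lemma bounded_exps:
  fixes F :: "'v::finite set" and B :: nat
  defines "M \<equiv> {t :: 'v \<Rightarrow>\<^sub>0 nat. Poly_Mapping.keys t \<subseteq> F \<and> (\<forall>v. Poly_Mapping.lookup t v \<le> B)}"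
  shows "finite M" and "card M \<le> Suc B ^ card F"
proof -
  let ?r = "\<lambda>t :: 'v \<Rightarrow>\<^sub>0 nat. restrict (Poly_Mapping.lookup t) F"
  have inj: "inj_on ?r M"
  proof (intro inj_onI poly_mapping_eqI)
    fix s t v assume st: "s \<in> M" "t \<in> M" "?r s = ?r t"
    show "Poly_Mapping.lookup s v = Poly_Mapping.lookup t v"
    proof (cases "v \<in> F")
      case True
      then show ?thesis using fun_cong[OF st(3), of v] by simp
    next
      case False
      then have "v \<notin> Poly_Mapping.keys s" "v \<notin> Poly_Mapping.keys t" using st by (auto simp: M_def)
      then show ?thesis by (simp add: in_keys_iff)
    qed
  qed
  have img: "?r ` M \<subseteq> PiE F (\<lambda>_. {..B})" by (auto simp: M_def)
  have fin: "finite (PiE F (\<lambda>_. {..B}))" by (simp add: finite_PiE)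
  show "finite M" using inj_on_finite[OF inj img fin] .
  have "card M \<le> card (PiE F (\<lambda>_. {..B}))" by (rule card_inj_on_le[OF inj img fin])
  then show "card M \<le> Suc B ^ card F" by (simp add: card_PiE)
qed

interpretation mpoly_space: vector_space "(\<lambda>c f. Poly_Mapping.single 0 c * f) :: 'k::field \<Rightarrow> ('v, 'k) mpoly \<Rightarrow> ('v, 'k) mpoly"
proof
  show "Poly_Mapping.single 0 a * (x + y) = Poly_Mapping.single 0 a * x + Poly_Mapping.single 0 a * y"
    for a and x y :: "('v, 'k) mpoly" by (rule distrib_left)
  show "Poly_Mapping.single 0 (a + b) * x = Poly_Mapping.single 0 a * x + Poly_Mapping.single 0 b * x"
    for a b and x :: "('v, 'k) mpoly" by (simp only: single_add distrib_right)
  show "Poly_Mapping.single 0 a * (Poly_Mapping.single 0 b * x) = Poly_Mapping.single 0 (a * b) * x"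
    for a b and x :: "('v, 'k) mpoly" unfolding mult.assoc[symmetric] mult_single by simp
  show "Poly_Mapping.single 0 1 * x = x" for x :: "('v, 'k) mpoly" by simp
qed

text \<open>With C = m \<delta> + 1 the left side is at most C^N T^N, which T > C^N keeps below
  T^(N+1).\<close>

lemma exp_growth:
  assumes "N < m"
  obtains T :: nat where "0 < T" "Suc (m * (T * \<delta>)) ^ N < T ^ m"
proof
  define C where "C = Suc (m * \<delta>)"
  define T where "T = Suc (C ^ N)"
  show "0 < T" by (simp add: T_def)
  have "C * T = m * (T * \<delta>) + T" by (simp add: C_def algebra_simps)
  then have "Suc (m * (T * \<delta>)) \<le> C * T" by (simp add: T_def)
  then have "Suc (m * (T * \<delta>)) ^ N \<le> (C * T) ^ N" by (rule power_mono) simp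
  also have "\<dots> = C ^ N * T ^ N" by (rule power_mult_distrib)
  also have "\<dots> < T * T ^ N" by (simp add: T_def)
  also have "\<dots> = T ^ Suc N" by simp
  also have "\<dots> \<le> T ^ m" using assms by (intro power_increasing) (auto simp: T_def)
  finally show "Suc (m * (T * \<delta>)) ^ N < T ^ m" .
qed

text \<open>The a_j have T^m power products with exponents below T, all in a space of polynomials in
  \<open>card F\<close> variables with each exponent at most m T \<delta>, whose dimension is at
  most (m T \<delta> + 1)^(card F). For suitable T this is smaller, so they are dependent.\<close>

lemma algebraic_relation:
  fixes a :: "nat \<Rightarrow> ('v::finite, 'k::field) mpoly"
  assumes a: "\<And>j. j < m \<Longrightarrow> bounded_poly F \<delta> (a j)" and N: "card F < m"
  shows "\<exists>E u. finite E \<and> E \<noteq> {} \<and> E \<subseteq> extensional {..<m} \<and> (\<forall>e\<in>E. u e \<noteq> (0::'k)) \<and>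
    (\<Sum>e\<in>E. Poly_Mapping.single 0 (u e) * (\<Prod>j<m. a j ^ e j)) = 0"
proof -
  obtain T where T: "0 < T" "Suc (m * (T * \<delta>)) ^ card F < T ^ m" using exp_growth[OF N] by blast
  define D where "D = PiE {..<m} (\<lambda>_. {..<T})"
  have D: "finite D" "card D = T ^ m" "D \<subseteq> extensional {..<m}"
    unfolding D_def by (simp_all add: finite_PiE card_PiE) (simp add: PiE_def)
  define mono where "mono e = (\<Prod>j<m. a j ^ e j)" for e
  define M where "M = {t :: 'v \<Rightarrow>\<^sub>0 nat. Poly_Mapping.keys t \<subseteq> F \<and> (\<forall>v. Poly_Mapping.lookup t v \<le> m * (T * \<delta>))}"
  have M: "finite M" "card M < card D"
    using bounded_exps[of F "m * (T * \<delta>)"] T D(2) unfolding M_def[symmetric] by auto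
  define S :: "('v, 'k) mpoly set" where "S = (\<lambda>t. Poly_Mapping.single t 1) ` M"
  have S: "finite S" "card S \<le> card M" using M by (auto simp: S_def card_image_le)
  have span: "mono e \<in> mpoly_space.span S" if e: "e \<in> D" for e
  proof -
    have "bounded_poly F (T * \<delta>) (a j ^ e j)" if "j < m" for j
    proof -
      have "e j \<le> T" using e that by (auto simp: D_def PiE_def Pi_def intro: less_imp_le)
      then show ?thesis using bounded_poly_power[OF a[OF that], of "e j"] by (elim bounded_poly_mono) simp
    qed
    then have b: "bounded_poly F (m * (T * \<delta>)) (mono e)"
      unfolding mono_def using bounded_poly_prod[of "{..<m}" F "T * \<delta>" "\<lambda>j. a j ^ e j"] by simp
    have "(\<Sum>t\<in>Poly_Mapping.keys (mono e). Poly_Mapping.single t (Poly_Mapping.lookup (mono e) t)) \<in> mpoly_space.span S"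
    proof (rule mpoly_space.span_sum)
      fix t assume "t \<in> Poly_Mapping.keys (mono e)"
      then have "t \<in> M" using b by (auto simp: bounded_poly_def M_def)
      then have "Poly_Mapping.single 0 (Poly_Mapping.lookup (mono e) t) * Poly_Mapping.single t 1 \<in> mpoly_space.span S"
        by (intro mpoly_space.span_scale mpoly_space.span_base) (auto simp: S_def)
      then show "Poly_Mapping.single t (Poly_Mapping.lookup (mono e) t) \<in> mpoly_space.span S"
        by (simp add: mult_single)
    qed
    then show ?thesis using poly_mapping_expansion[of "mono e"] by simp
  qed
  have "\<exists>u. (\<Sum>e\<in>D. Poly_Mapping.single 0 (u e) * mono e) = 0 \<and> (\<exists>e\<in>D. u e \<noteq> 0)"
  \<comment> \<open>Two exponent vectors with equal power products give a relation at once;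
    otherwise a dependence of the image set is pulled back.\<close>
  proof (cases "inj_on mono D")
    case False
    then obtain e e' where ee: "e \<in> D" "e' \<in> D" "e \<noteq> e'" "mono e = mono e'" by (auto simp: inj_on_def)
    define u where "u x = (if x = e then 1 else if x = e' then -1 else 0 :: 'k)" for x
    have "(\<Sum>x\<in>D. Poly_Mapping.single 0 (u x) * mono x) = (\<Sum>x\<in>{e, e'}. Poly_Mapping.single 0 (u x) * mono x)"
      using ee D by (intro sum.mono_neutral_right) (auto simp: u_def)
    also have "\<dots> = 0" using ee by (simp add: u_def single_uminus)
    finally show ?thesis using ee by (intro exI[of _ u]) (auto simp: u_def)
  next
    case True
    have dep: "mpoly_space.dependent (mono ` D)"
    proof (rule ccontr)
      assume "\<not> mpoly_space.dependent (mono ` D)"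
      then have "card (mono ` D) \<le> card S"
        using mpoly_space.independent_span_bound[OF S(1)] span by blast
      then show False using card_image[OF True] S M by simp
    qed
    define L where "L U w = (\<Sum>y\<in>U. Poly_Mapping.single 0 (w y) * y)"
      for U :: "('v, 'k) mpoly set" and w
    have "\<not> (\<forall>U\<subseteq>mono ` D. finite U \<longrightarrow> (\<forall>w. L U w = 0 \<longrightarrow> (\<forall>x\<in>U. w x = 0)))"
    proof
      assume "\<forall>U\<subseteq>mono ` D. finite U \<longrightarrow> (\<forall>w. L U w = 0 \<longrightarrow> (\<forall>x\<in>U. w x = 0))"
      then have "\<not> mpoly_space.dependent (mono ` D)"
        unfolding L_def by (rule iffD2[OF mpoly_space.independent_explicit_finite_subsets])
      with dep show False by blast
    qed
    then obtain U w x where U': "finite U" "U \<subseteq> mono ` D" "L U w = 0" "x \<in> U" "w x \<noteq> 0" by blast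
    then have U: "finite U" "U \<subseteq> mono ` D" "(\<Sum>y\<in>U. Poly_Mapping.single 0 (w y) * y) = 0" "x \<in> U" "w x \<noteq> 0"
      by (simp_all add: L_def)
    define u where "u e = (if mono e \<in> U then w (mono e) else 0)" for e
    have "(\<Sum>e\<in>D. Poly_Mapping.single 0 (u e) * mono e) =
        (\<Sum>y\<in>mono ` D. Poly_Mapping.single 0 (if y \<in> U then w y else 0) * y)"
      by (simp add: sum.reindex[OF True] u_def)
    also have "\<dots> = (\<Sum>y\<in>U. Poly_Mapping.single 0 (w y) * y)"
      using U D by (intro sum.mono_neutral_cong_right) auto
    finally have "(\<Sum>e\<in>D. Poly_Mapping.single 0 (u e) * mono e) = 0" using U(3) by simp
    moreover have "\<exists>e\<in>D. u e \<noteq> 0" using U by (auto simp: u_def)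
    ultimately show ?thesis by blast
  qed
  then obtain u e1 where u: "(\<Sum>e\<in>D. Poly_Mapping.single 0 (u e) * mono e) = 0" "e1 \<in> D" "u e1 \<noteq> 0" by blast
  have "(\<Sum>e\<in>{e \<in> D. u e \<noteq> 0}. Poly_Mapping.single 0 (u e) * mono e) = (\<Sum>e\<in>D. Poly_Mapping.single 0 (u e) * mono e)"
    using D by (intro sum.mono_neutral_left) auto
  then show ?thesis using D u unfolding mono_def
    by (intro exI[of _ "{e \<in> D. u e \<noteq> 0}"] exI[of _ u]) auto
qed

text \<open>The ideal generated by the variables outside F, described by monomials.\<close>

definition face_prime :: "'v set \<Rightarrow> ('v, 'k::field) mpoly set" where
  "face_prime F = {g. \<forall>t\<in>Poly_Mapping.keys g. \<not> Poly_Mapping.keys t \<subseteq> F}"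

lemma face_prime_subspace: "ring_module.subspace (face_prime F :: ('v, 'k::field) mpoly set)"
proof (rule ring_module.subspaceI)
  show "0 \<in> (face_prime F :: ('v, 'k) mpoly set)" by (simp add: face_prime_def)
  show "f + g \<in> face_prime F" if "f \<in> face_prime F" "g \<in> face_prime F" for f g :: "('v, 'k) mpoly"
    using that keys_add[of f g] unfolding face_prime_def by blast
  show "c * g \<in> face_prime F" if "g \<in> face_prime F" for c g :: "('v, 'k) mpoly"
    unfolding face_prime_def
  proof (intro CollectI ballI)
    fix t assume "t \<in> Poly_Mapping.keys (c * g)"
    then obtain s u where "s \<in> Poly_Mapping.keys c" "u \<in> Poly_Mapping.keys g" "t = s + u" by (rule keys_times_subset)
    then show "\<not> Poly_Mapping.keys t \<subseteq> F" using that by (auto simp: face_prime_def keys_plus_nat)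
  qed
qed

definition face_part :: "'v set \<Rightarrow> ('v, 'k::field) mpoly \<Rightarrow> ('v, 'k) mpoly" where
  "face_part F g = (\<Sum>t | t \<in> Poly_Mapping.keys g \<and> Poly_Mapping.keys t \<subseteq> F. Poly_Mapping.single t (Poly_Mapping.lookup g t))"

lemma lookup_face_part:
  "Poly_Mapping.lookup (face_part F g) t = (if Poly_Mapping.keys t \<subseteq> F then Poly_Mapping.lookup g t else 0)"
proof -
  have "Poly_Mapping.lookup (face_part F g) t =
      (\<Sum>s | s \<in> Poly_Mapping.keys g \<and> Poly_Mapping.keys s \<subseteq> F. if s = t then Poly_Mapping.lookup g t else 0)"
    unfolding face_part_def lookup_sum lookup_single by (rule sum.cong) (auto simp: when_def)
  then show ?thesis by (auto simp: in_keys_iff)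
qed

lemma diff_face_part: "g - face_part F g \<in> face_prime F"
  by (auto simp: face_prime_def in_keys_iff lookup_minus lookup_face_part)

text \<open>Setting the variables outside F to 0 lands in a domain: the product of the two face
  parts lies in the ideal and involves only variables from F, hence is 0.\<close>

lemma face_prime_prime: "prime_ideal (face_prime F :: ('v::linorder, 'k::field) mpoly set)"
  unfolding prime_ideal_def
proof (intro conjI allI impI)
  show sub: "ring_module.subspace (face_prime F :: ('v, 'k) mpoly set)" by (rule face_prime_subspace)
  have "1 \<notin> (face_prime F :: ('v, 'k) mpoly set)" by (simp add: face_prime_def)
  then show "face_prime F \<noteq> (UNIV :: ('v, 'k) mpoly set)" by blast
  fix x y :: "('v, 'k) mpoly" assume xy: "x * y \<in> face_prime F"
  let ?x = "face_part F x" and ?y = "face_part F y"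
  have "?x * ?y = x * y - (x - ?x) * y - ?x * (y - ?y)" by (simp add: algebra_simps)
  also have "\<dots> \<in> face_prime F"
    using xy diff_face_part[of x F] diff_face_part[of y F]
      ring_module.subspace_scale[OF sub, of "x - ?x" y] ring_module.subspace_scale[OF sub, of "y - ?y" ?x]
    by (intro ring_module.subspace_diff[OF sub]) (auto simp: mult.commute)
  finally have mem: "?x * ?y \<in> face_prime F" .
  have "?x * ?y = 0"
  proof (rule ccontr)
    assume "?x * ?y \<noteq> 0"
    then obtain t where t: "t \<in> Poly_Mapping.keys (?x * ?y)" by (metis equals0I keys_zero poly_mapping_eqI in_keys_iff lookup_zero)
    then obtain s u where "s \<in> Poly_Mapping.keys ?x" "u \<in> Poly_Mapping.keys ?y" "t = s + u" by (rule keys_times_subset)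
    then have "Poly_Mapping.keys t \<subseteq> F" by (auto simp: keys_plus_nat in_keys_iff lookup_face_part split: if_splits)
    then show False using mem t by (auto simp: face_prime_def)
  qed
  then have "?x = 0 \<or> ?y = 0" by simp
  then show "x \<in> face_prime F \<or> y \<in> face_prime F" using diff_face_part[of x F] diff_face_part[of y F] by auto
qed

text \<open>Elements of \<open>P (Suc i)\<close> outside \<open>P i\<close> may be replaced by their
  face parts, which lie in the same primes of the chain. If m > \<open>card F\<close>, these are
  algebraically dependent, against \<open>prime_chain_no_relation\<close>, as 0 lies in
  \<open>P 0\<close>.\<close>

lemma prime_chain_bound:
  fixes P :: "nat \<Rightarrow> ('v::finite, 'k::field) mpoly set"
  assumes P: "\<And>i. i \<le> m \<Longrightarrow> prime_ideal (P i)" and chain: "\<And>i. i < m \<Longrightarrow> P i \<subset> P (Suc i)"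
    and F: "\<And>v. v \<notin> F \<Longrightarrow> Poly_Mapping.single (Poly_Mapping.single v 1) 1 \<in> P 0"
  shows "m \<le> card F"
proof (rule ccontr)
  assume "\<not> m \<le> card F"
  then have m: "card F < m" by simp
  have P0: "P 0 \<subseteq> P i" if "i \<le> m" for i
    using that chain by (induction i) (auto simp: Suc_le_eq less_imp_le_nat)
  note sub = prime_ideal_subspace[OF P]
  have outside: "g - face_part F g \<in> P 0" for g
  proof -
    let ?h = "g - face_part F g"
    have "(\<Sum>t\<in>Poly_Mapping.keys ?h. Poly_Mapping.single t (Poly_Mapping.lookup ?h t)) \<in> P 0"
    proof (rule ring_module.subspace_sum[OF sub])
      fix t assume "t \<in> Poly_Mapping.keys ?h"
      then obtain v where v: "v \<in> Poly_Mapping.keys t" "v \<notin> F"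
        using diff_face_part[of g F] by (auto simp: face_prime_def)
      have "t - Poly_Mapping.single v 1 + Poly_Mapping.single v 1 = t"
        using v(1) by (intro poly_mapping_eqI) (auto simp: lookup_add lookup_minus lookup_single when_def in_keys_iff)
      then have "Poly_Mapping.single t (Poly_Mapping.lookup ?h t) =
          Poly_Mapping.single (t - Poly_Mapping.single v 1) (Poly_Mapping.lookup ?h t) * Poly_Mapping.single (Poly_Mapping.single v 1) 1"
        by (simp add: mult_single)
      also have "\<dots> \<in> P 0" by (rule prime_ideal_mult_left[OF P F[OF v(2)]]) simp
      finally show "Poly_Mapping.single t (Poly_Mapping.lookup ?h t) \<in> P 0" .
    qed simp
    then show ?thesis using poly_mapping_expansion[of ?h] by simp
  qed
  have "\<exists>x. x \<in> P (Suc i) \<and> x \<notin> P i" if "i < m" for i using chain[OF that] by blast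
  then obtain a where a: "\<And>i. i < m \<Longrightarrow> a i \<in> P (Suc i) \<and> a i \<notin> P i" by metis
  define b where "b i = face_part F (a i)" for i
  have mem: "b i \<in> P j \<longleftrightarrow> a i \<in> P j" if "j \<le> m" for i j
  proof -
    have d: "a i - b i \<in> P j" using outside P0[OF that] unfolding b_def by blast
    show ?thesis using ring_module.subspace_add[OF sub[OF that] d, of "b i"]
        ring_module.subspace_diff[OF sub[OF that] _ d, of "a i"] by auto
  qed
  have b: "b i \<in> P (Suc i) \<and> b i \<notin> P i" if "i < m" for i
    using a[OF that] mem[of i] mem[of "Suc i"] that by simp
  define \<delta> where "\<delta> = (\<Sum>j<m. \<Sum>t\<in>Poly_Mapping.keys (b j). \<Sum>v\<in>UNIV. Poly_Mapping.lookup t v)"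
  have bounded: "bounded_poly F \<delta> (b j)" if "j < m" for j
    unfolding bounded_poly_def
  proof (intro ballI conjI allI)
    fix t v assume t: "t \<in> Poly_Mapping.keys (b j)"
    then show "Poly_Mapping.keys t \<subseteq> F" by (auto simp: b_def in_keys_iff lookup_face_part split: if_splits)
    have "Poly_Mapping.lookup t v \<le> (\<Sum>v\<in>UNIV. Poly_Mapping.lookup t v)" by (rule member_le_sum) auto
    also have "\<dots> \<le> (\<Sum>t\<in>Poly_Mapping.keys (b j). \<Sum>v\<in>UNIV. Poly_Mapping.lookup t v)"
      using t by (intro member_le_sum[of t]) auto
    also have "\<dots> \<le> \<delta>" unfolding \<delta>_def
      using that by (intro member_le_sum[of j "{..<m}" "\<lambda>j. \<Sum>t\<in>Poly_Mapping.keys (b j). \<Sum>v\<in>UNIV. Poly_Mapping.lookup t v"]) auto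
    finally show "Poly_Mapping.lookup t v \<le> \<delta>" .
  qed
  have "\<exists>E u. finite E \<and> E \<noteq> {} \<and> E \<subseteq> extensional {..<m} \<and> (\<forall>e\<in>E. u e \<noteq> (0::'k)) \<and>
      (\<Sum>e\<in>E. Poly_Mapping.single 0 (u e) * (\<Prod>j<m. b j ^ e j)) = 0"
    by (rule algebraic_relation[OF bounded m])
  then obtain E u where Eu:
    "finite E \<and> E \<noteq> {} \<and> E \<subseteq> extensional {..<m} \<and> (\<forall>e\<in>E. u e \<noteq> (0::'k)) \<and>
      (\<Sum>e\<in>E. Poly_Mapping.single 0 (u e) * (\<Prod>j<m. b j ^ e j)) = 0"
    by (elim exE)
  then have E: "finite E" "E \<noteq> {}" "E \<subseteq> extensional {..<m}" and u: "\<And>e. e \<in> E \<Longrightarrow> u e \<noteq> 0"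
    and rel: "(\<Sum>e\<in>E. Poly_Mapping.single 0 (u e) * (\<Prod>j<m. b j ^ e j)) = 0"
    by auto
  have unit: "Poly_Mapping.single 0 (u e) dvd (1 :: ('v, 'k) mpoly)" if "e \<in> E" for e
    using u[OF that] by (intro dvdI[of _ _ "Poly_Mapping.single 0 (inverse (u e))"]) (simp add: mult_single)
  have "(\<Sum>e\<in>E. Poly_Mapping.single 0 (u e) * (\<Prod>j<m. b j ^ e j)) \<notin> P 0"
  proof (rule prime_chain_no_relation[OF P])
    show "P i \<subseteq> P (Suc i)" if "i < m" for i using chain[OF that] by blast
  qed (use b E unit in auto)
  then show False unfolding rel using ring_module.subspace_0[OF sub[of 0]] by simp
qed

text \<open>The lower bound removes the vertices of a largest face one at a time; the upper bound
  applies \<open>prime_chain_bound\<close> to the vertices whose variables avoid the smallest prime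
  of a chain.\<close>

theorem krull_dim_stanley_reisner:
  fixes \<Delta> :: "'v::{finite,linorder} set set"
  assumes \<Delta>: "simplicial_complex \<Delta>"
  shows "krull_dim_quotient (stanley_reisner_ideal \<Delta> :: ('v, 'k::field) mpoly set) = enat (Max (card ` \<Delta>))"
proof -
  let ?I = "stanley_reisner_ideal \<Delta> :: ('v, 'k) mpoly set"
  let ?S = "{enat m | m. \<exists>P. (\<forall>i\<le>m. prime_ideal (P i) \<and> ?I \<subseteq> P i) \<and> (\<forall>i<m. P i \<subset> P (Suc i))}"
  have ne: "{} \<in> \<Delta>" using \<Delta> unfolding simplicial_complex_def by (metis empty_subsetI)
  have down: "G \<in> \<Delta>" if "F \<in> \<Delta>" "G \<subseteq> F" for F G using \<Delta> that by (simp add: simplicial_complex_def)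
  obtain F where F: "F \<in> \<Delta>" "card F = Max (card ` \<Delta>)"
    using Max_in[of "card ` \<Delta>"] ne by (metis finite finite_imageI image_is_empty empty_iff imageE)
  have "enat (card F) \<in> ?S"
  proof -
    obtain f where f: "bij_betw f {..<card F} F"
      using ex_bij_betw_nat_finite[of F] by (auto simp: atLeast0LessThan)
    define G where "G i = f ` {i..<card F}" for i
    define P where "P i = (face_prime (G i) :: ('v, 'k) mpoly set)" for i
    have GF: "G i \<subseteq> F" for i using f by (auto simp: G_def bij_betw_def)
    have "?I \<subseteq> P i" for i
    proof
      fix g assume "g \<in> ?I"
      then have "Poly_Mapping.keys t \<notin> \<Delta>" if "t \<in> Poly_Mapping.keys g" for t
        using that by (simp add: stanley_reisner_ideal_iff[OF \<Delta>])
      then show "g \<in> P i" using down[OF F(1)] GF[of i] unfolding P_def face_prime_def by blast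
    qed
    moreover have "P i \<subset> P (Suc i)" if "i < card F" for i
    proof
      have "G (Suc i) \<subseteq> G i" by (auto simp: G_def)
      then show "P i \<subseteq> P (Suc i)" by (auto simp: P_def face_prime_def)
      have "f i \<noteq> f x" if "Suc i \<le> x" "x < card F" for x
        using f that inj_onD[of f "{..<card F}" i x] by (auto simp: bij_betw_def)
      then have "f i \<notin> G (Suc i)" unfolding G_def by (metis atLeastLessThan_iff imageE)
      moreover have "f i \<in> G i" using that by (auto simp: G_def)
      ultimately have "Poly_Mapping.single (Poly_Mapping.single (f i) 1) 1 \<in> P (Suc i)"
        and "Poly_Mapping.single (Poly_Mapping.single (f i) 1) 1 \<notin> P i"
        by (auto simp: P_def face_prime_def)
      then show "P i \<noteq> P (Suc i)" by blast
    qed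
    moreover have "prime_ideal (P i)" for i unfolding P_def by (rule face_prime_prime)
    ultimately show ?thesis by blast
  qed
  then have "enat (Max (card ` \<Delta>)) \<le> Sup ?S" unfolding F(2) by (rule Sup_upper)
  moreover have "Sup ?S \<le> enat (Max (card ` \<Delta>))"
  proof (rule Sup_least)
    fix e assume "e \<in> ?S"
    then obtain m P where e: "e = enat m" and P: "\<And>i. i \<le> m \<Longrightarrow> prime_ideal (P i)" "\<And>i. i \<le> m \<Longrightarrow> ?I \<subseteq> P i"
      and chain: "\<And>i. i < m \<Longrightarrow> P i \<subset> P (Suc i)" by blast
    \<comment> \<open>H is a face: otherwise the product of its variables lies in the prime
      \<open>P 0\<close>, which would then contain one of them.\<close>
    define H where "H = {v. Poly_Mapping.single (Poly_Mapping.single v 1) 1 \<notin> P 0}"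
    have "H \<in> \<Delta>"
    proof (rule ccontr)
      assume "H \<notin> \<Delta>"
      then have "squarefree_monomial H \<in> ?I" unfolding stanley_reisner_ideal_def by (intro ring_module.span_base) blast
      moreover have "squarefree_monomial H = (\<Prod>v\<in>H. Poly_Mapping.single (Poly_Mapping.single v 1) (1::'k))"
      proof -
        have *: "(\<Prod>v\<in>K. Poly_Mapping.single (Poly_Mapping.single v 1) (1::'k)) = Poly_Mapping.single (\<Sum>v\<in>K. Poly_Mapping.single v 1) 1"
          if "finite K" for K :: "'v set"
          using that by (induction K) (simp_all add: mult_single)
        show ?thesis unfolding squarefree_monomial_def by (rule *[symmetric]) simp
      qed
      ultimately have "(\<Prod>v\<in>H. Poly_Mapping.single (Poly_Mapping.single v 1) (1::'k)) \<in> P 0" using P(2)[of 0] by auto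
      then have "\<exists>v\<in>H. Poly_Mapping.single (Poly_Mapping.single v 1) (1::'k) \<in> P 0"
        by (intro prime_ideal_prod[OF P(1)]) auto
      then show False by (simp add: H_def)
    qed
    then have "card H \<le> Max (card ` \<Delta>)" by (intro Max_ge) auto
    moreover have "m \<le> card H"
      using prime_chain_bound[of m P H, OF P(1) chain] by (simp add: H_def)
    ultimately show "e \<le> enat (Max (card ` \<Delta>))" using e by simp
  qed
  ultimately show ?thesis unfolding krull_dim_quotient_def by (rule antisym[rotated])
qed

section \<open>Assembling the ring-theoretic statement\<close>

section \<open>Buchsbaum rings with linear resolution\<close>

theorem theorem2p6:
  fixes \<Delta> :: "'v::{finite,linorder} set set"
    and I :: "('v, 'k::field) mpoly set"
    and c d q :: nat
  assumes "simplicial_complex \<Delta>"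
    and "I = stanley_reisner_ideal \<Delta>"
    and "1 \<le> c" and "2 \<le> q" and "q \<le> d"
    and "krull_dim_quotient I = enat d"
    and "codim_quotient I = enat c"
    and "buchsbaum TYPE('k) \<Delta>"
    and "has_linear_resolution q I"
  shows "\<exists>h::nat. local_cohomology_dim I (int q - 1) = enat h \<and>
    h_vector \<Delta> 0 = 1 \<and>
    (\<forall>p. 1 \<le> p \<and> p \<le> q - 1 \<longrightarrow> h_vector \<Delta> p = int ((c + p - 1) choose p)) \<and>
    (\<forall>p. q \<le> p \<and> p \<le> d \<longrightarrow> h_vector \<Delta> p = (-1) ^ (p - q + 1) * int (d choose p) * int h) \<and>
    0 \<le> real h \<and>
    real h \<le> (\<Prod>i<q - 1. real (c + i)) / (\<Prod>i<q - 1. real (d - i))"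
proof -
  note \<Delta> = assms(1) and I = assms(2)
  have dmax: "Max (card ` \<Delta>) = d"
    using krull_dim_stanley_reisner[OF \<Delta>, where 'k='k] assms(6) unfolding I by simp
  have dim: "complex_dim \<Delta> = int d - 1"
    using complex_dim_eq[OF empty_face[OF \<Delta>]] dmax by simp
  have "enat CARD('v) - enat d = enat c" using assms(6,7) by (simp add: codim_quotient_def)
  \<comment> \<open>Subtraction of extended naturals truncates; c \<ge> 1 excludes that d exceeds
    the number of vertices.\<close>
  then have n: "CARD('v) = d + c" using assms(3) by simp
  obtain h where h: "cohomology_dim TYPE('k) \<Delta> (int q - 1) = enat h"
    and low: "\<And>p. p < q \<Longrightarrow> h_vector \<Delta> p = int ((c + p - 1) choose p)"
    and high: "\<And>p. q \<le> p \<Longrightarrow> p \<le> d \<Longrightarrow> h_vector \<Delta> p = (-1) ^ (p - q + 1) * int (d choose p) * int h"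
    and bound: "(d choose (q - 1)) * h \<le> (c + q - 2) choose (q - 1)"
    using h_vector_buchsbaum_linear[OF \<Delta> assms(8) dim n assms(3,4,5)
        linear_resolution_skeleton[OF \<Delta> I assms(9)] linear_resolution_acyclic[OF \<Delta> I assms(9)]]
    by metis
  \<comment> \<open>The strand computation covers degrees up to d - 1, and q \<le> d puts q - 1
    among them.\<close>
  have "local_cohomology_dim I (int q - 1) = enat h"
    unfolding I using local_cohomology_dim_eq[OF \<Delta> assms(8), of "int q - 1"] dim assms(5) h by simp
  moreover have "real h \<le> (\<Prod>i<q - 1. real (c + i)) / (\<Prod>i<q - 1. real (d - i))"
  proof -
    have "(\<Prod>i<q - 1. real (c + i)) = real (fact (q - 1) * ((c + q - 2) choose (q - 1)))"
    proof -
      have "0 < c" "c + (q - 1) - 1 = c + q - 2" using assms(3,4) by auto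
      then show ?thesis by (simp only: of_nat_prod[symmetric] prod_rising)
    qed
    moreover have "(\<Prod>i<q - 1. real (d - i)) = real (fact (q - 1) * (d choose (q - 1)))"
      by (simp only: of_nat_prod[symmetric] prod_falling)
    moreover have "0 < d choose (q - 1)" using assms(5) by simp
    moreover have "real (d choose (q - 1)) * real h \<le> real ((c + q - 2) choose (q - 1))"
      using bound by (simp only: of_nat_mult[symmetric] of_nat_le_iff)
    \<comment> \<open>Multiplying the binomial bound by the factorial of q - 1 gives the two
      products of the statement.\<close>
    ultimately have "real h * (\<Prod>i<q - 1. real (d - i)) \<le> (\<Prod>i<q - 1. real (c + i))"
      "0 < (\<Prod>i<q - 1. real (d - i))"
      using mult_left_mono[of "real (d choose (q - 1)) * real h" "real ((c + q - 2) choose (q - 1))" "fact (q - 1)"]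
      by (simp_all only: of_nat_mult of_nat_fact mult.assoc mult.commute[of "real h"] fact_ge_zero) simp_all
    then show ?thesis by (simp add: pos_le_divide_eq)
  qed
  moreover have "h_vector \<Delta> 0 = 1" using low[of 0] assms(4) by simp
  ultimately show ?thesis using low high assms(4) by (intro exI[of _ h]) auto
qed

end
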